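(* Let $\Omega\subset\mathbb{R}^N$ be a bounded domain with $C^2$ boundary, $1<q<p<\infty$, $\delta>0$, and let $f\in L^\infty_{loc}(\Omega)$ be nonnegative with $c_1 d(x)^{-\beta}\le f(x)\le c_2 d(x)^{-\beta}$ in $\Omega_\varrho$ for some constants $c_1,c_2\ge0$, $\varrho>0$, where $0\le\beta<2-\frac1p$. If $u,v\in W^{1,p}_{loc}(\Omega)$ are respectively a weak sub-solution and a weak super-solution of $-\Delta_p w-\Delta_q w=f(x)w^{-\delta}$, $w>0$ in $\Omega$, $w=0$ on $\partial\Omega$, then $u\le v$ a.e. in $\Omega$.
   Context: $d(x)=\operatorname{dist}(x,\partial\Omega)$, $\Omega_\varrho=\{x\in\overline\Omega:d(x)<\varrho\}$, $\Delta_s w=\operatorname{div}(|\nabla w|^{s-2}\nabla w)$. A function $u\in W^{1,p}_{loc}(\Omega)$ is a weak sub-solution (resp. super-solution) if: (i) for every $K\Subset\Omega$ there is $C_K>0$ with $u\ge C_K$ in $K$; (ii) for all $\phi\in C_c^\infty(\Omega)$ with $\phi\ge0$, $\int_\Omega|\nabla u|^{p-2}\nabla u\cdot\nabla\phi+\int_\Omega|\nabla u|^{q-2}\nabla u\cdot\nabla\phi\le$ (resp. $\ge$) $\int_\Omega f u^{-\delta}\phi$; (iii) there is $\gamma\ge1$ with $u^\gamma\in W^{1,p}_0(\Omega)$. *)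

theory Defs
  imports "HOL-Analysis.Analysis"
begin

coinductive smooth_on :: "(real^'n) set \<Rightarrow> (real^'n \<Rightarrow> real) \<Rightarrow> bool" where
  smooth_onI: "(\<And>x. x \<in> S \<Longrightarrow> (f has_derivative (\<lambda>h. \<Sum>i\<in>UNIV. h $ i * Df i x)) (at x))
     \<Longrightarrow> (\<And>i. smooth_on S (Df i)) \<Longrightarrow> smooth_on S f"

definition tsupp :: "(real^'n \<Rightarrow> real) \<Rightarrow> (real^'n) set" where
  "tsupp \<phi> = closure {x. \<phi> x \<noteq> 0}"

definition test_fun :: "(real^'n) set \<Rightarrow> (real^'n \<Rightarrow> real) \<Rightarrow> bool" where
  "test_fun \<Omega> \<phi> \<longleftrightarrow> smooth_on UNIV \<phi> \<and> compact (tsupp \<phi>) \<and> tsupp \<phi> \<subseteq> \<Omega>"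

definition grad :: "(real^'n \<Rightarrow> real) \<Rightarrow> real^'n \<Rightarrow> real^'n" where
  "grad \<phi> x = (\<chi> i. frechet_derivative \<phi> (at x) (axis i 1))"

definition Lp_loc :: "(real^'n) set \<Rightarrow> real \<Rightarrow> (real^'n \<Rightarrow> real) \<Rightarrow> bool" where
  "Lp_loc \<Omega> p u \<longleftrightarrow> u \<in> borel_measurable lebesgue \<and>
     (\<forall>K. compact K \<and> K \<subseteq> \<Omega> \<longrightarrow> set_integrable lebesgue K (\<lambda>x. \<bar>u x\<bar> powr p))"

definition Lp_loc_vec :: "(real^'n) set \<Rightarrow> real \<Rightarrow> (real^'n \<Rightarrow> real^'n) \<Rightarrow> bool" where
  "Lp_loc_vec \<Omega> p g \<longleftrightarrow> g \<in> borel_measurable lebesgue \<and>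
     (\<forall>K. compact K \<and> K \<subseteq> \<Omega> \<longrightarrow> set_integrable lebesgue K (\<lambda>x. norm (g x) powr p))"

definition weak_grad :: "(real^'n) set \<Rightarrow> (real^'n \<Rightarrow> real) \<Rightarrow> (real^'n \<Rightarrow> real^'n) \<Rightarrow> bool" where
  "weak_grad \<Omega> u g \<longleftrightarrow>
     u \<in> borel_measurable lebesgue \<and> g \<in> borel_measurable lebesgue \<and>
     (\<forall>K. compact K \<and> K \<subseteq> \<Omega> \<longrightarrow>
        set_integrable lebesgue K u \<and> (\<forall>i. set_integrable lebesgue K (\<lambda>x. g x $ i))) \<and>
     (\<forall>\<phi>. test_fun \<Omega> \<phi> \<longrightarrow> (\<forall>i.
        (LINT x:\<Omega>|lebesgue. u x * grad \<phi> x $ i) = - (LINT x:\<Omega>|lebesgue. g x $ i * \<phi> x)))"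

definition W1p_loc :: "(real^'n) set \<Rightarrow> real \<Rightarrow> (real^'n \<Rightarrow> real) \<Rightarrow> (real^'n \<Rightarrow> real^'n) \<Rightarrow> bool" where
  "W1p_loc \<Omega> p u g \<longleftrightarrow> weak_grad \<Omega> u g \<and> Lp_loc \<Omega> p u \<and> Lp_loc_vec \<Omega> p g"

definition W1p :: "(real^'n) set \<Rightarrow> real \<Rightarrow> (real^'n \<Rightarrow> real) \<Rightarrow> (real^'n \<Rightarrow> real^'n) \<Rightarrow> bool" where
  "W1p \<Omega> p u g \<longleftrightarrow> weak_grad \<Omega> u g \<and>
     set_integrable lebesgue \<Omega> (\<lambda>x. \<bar>u x\<bar> powr p) \<and>
     set_integrable lebesgue \<Omega> (\<lambda>x. norm (g x) powr p)"

definition W01p :: "(real^'n) set \<Rightarrow> real \<Rightarrow> (real^'n \<Rightarrow> real) \<Rightarrow> bool" where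
  "W01p \<Omega> p w \<longleftrightarrow> (\<exists>g. W1p \<Omega> p w g \<and>
     (\<exists>\<phi>s. (\<forall>k. test_fun \<Omega> (\<phi>s k)) \<and>
        (\<lambda>k. LINT x:\<Omega>|lebesgue. \<bar>\<phi>s k x - w x\<bar> powr p) \<longlonglongrightarrow> 0 \<and>
        (\<lambda>k. LINT x:\<Omega>|lebesgue. norm (grad (\<phi>s k) x - g x) powr p) \<longlonglongrightarrow> 0))"

definition Linf_loc :: "(real^'n) set \<Rightarrow> (real^'n \<Rightarrow> real) \<Rightarrow> bool" where
  "Linf_loc \<Omega> f \<longleftrightarrow> f \<in> borel_measurable lebesgue \<and>
     (\<forall>K. compact K \<and> K \<subseteq> \<Omega> \<longrightarrow> (\<exists>M. AE x in lebesgue. x \<in> K \<longrightarrow> \<bar>f x\<bar> \<le> M))"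

definition C2_boundary :: "(real^'n) set \<Rightarrow> bool" where
  "C2_boundary \<Omega> \<longleftrightarrow> (\<forall>z\<in>frontier \<Omega>. \<exists>r>0. \<exists>\<phi> G H.
     (\<forall>x\<in>ball z r. (\<phi> has_derivative (\<lambda>h. G x \<bullet> h)) (at x) \<and>
                     (G has_derivative (\<lambda>h. H x *v h)) (at x) \<and> G x \<noteq> 0) \<and>
     continuous_on (ball z r) (H :: real^'n \<Rightarrow> real^'n^'n) \<and>
     \<Omega> \<inter> ball z r = {x \<in> ball z r. \<phi> x < 0})"

definition bounded_C2_domain :: "(real^'n) set \<Rightarrow> bool" where
  "bounded_C2_domain \<Omega> \<longleftrightarrow> open \<Omega> \<and> connected \<Omega> \<and> \<Omega> \<noteq> {} \<and> bounded \<Omega> \<and> C2_boundary \<Omega>"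

definition weak_subsol ::
  "(real^'n) set \<Rightarrow> real \<Rightarrow> real \<Rightarrow> real \<Rightarrow> (real^'n \<Rightarrow> real) \<Rightarrow> (real^'n \<Rightarrow> real) \<Rightarrow> bool" where
  "weak_subsol \<Omega> p q \<delta> f u \<longleftrightarrow> (\<exists>g. W1p_loc \<Omega> p u g \<and>
     (\<forall>K. compact K \<and> K \<subseteq> \<Omega> \<longrightarrow> (\<exists>C>0. AE x in lebesgue. x \<in> K \<longrightarrow> C \<le> u x)) \<and>
     (\<forall>\<phi>. test_fun \<Omega> \<phi> \<and> (\<forall>x. 0 \<le> \<phi> x) \<longrightarrow>
        (LINT x:\<Omega>|lebesgue. norm (g x) powr (p - 2) * (g x \<bullet> grad \<phi> x))
        + (LINT x:\<Omega>|lebesgue. norm (g x) powr (q - 2) * (g x \<bullet> grad \<phi> x))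
        \<le> (LINT x:\<Omega>|lebesgue. f x * u x powr (- \<delta>) * \<phi> x)) \<and>
     (\<exists>\<gamma>\<ge>1. W01p \<Omega> p (\<lambda>x. u x powr \<gamma>)))"

definition weak_supersol ::
  "(real^'n) set \<Rightarrow> real \<Rightarrow> real \<Rightarrow> real \<Rightarrow> (real^'n \<Rightarrow> real) \<Rightarrow> (real^'n \<Rightarrow> real) \<Rightarrow> bool" where
  "weak_supersol \<Omega> p q \<delta> f u \<longleftrightarrow> (\<exists>g. W1p_loc \<Omega> p u g \<and>
     (\<forall>K. compact K \<and> K \<subseteq> \<Omega> \<longrightarrow> (\<exists>C>0. AE x in lebesgue. x \<in> K \<longrightarrow> C \<le> u x)) \<and>
     (\<forall>\<phi>. test_fun \<Omega> \<phi> \<and> (\<forall>x. 0 \<le> \<phi> x) \<longrightarrow>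
        (LINT x:\<Omega>|lebesgue. norm (g x) powr (p - 2) * (g x \<bullet> grad \<phi> x))
        + (LINT x:\<Omega>|lebesgue. norm (g x) powr (q - 2) * (g x \<bullet> grad \<phi> x))
        \<ge> (LINT x:\<Omega>|lebesgue. f x * u x powr (- \<delta>) * \<phi> x)) \<and>
     (\<exists>\<gamma>\<ge>1. W01p \<Omega> p (\<lambda>x. u x powr \<gamma>)))"

end

theory Submission
  imports Defs
begin

text \<open>
  The classical argument tests the difference of the two inequalities with a function of
  \<open>u - v\<close>.  The obstacle is the boundary: \<open>u\<close> is controlled there through
  \<open>u\<^sup>\<gamma>\<close>, but the gradient of \<open>v\<close> is a priori only locally integrable.

  Let \<open>\<psi>\<^sub>k\<close> be test functions approximating \<open>u\<^sup>\<gamma>\<close> in \<open>W\<^sup>1\<^sup>p\<close>.  Composing them with a step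
  function gives compactly supported cut-offs \<open>\<eta>\<^sub>k\<close> whose limit is 1 on \<open>{u \<ge> 2\<epsilon>}\<close> and 0 on
  \<open>{u \<le> \<epsilon>}\<close>, and whose gradients converge to a multiple of the gradient of \<open>u\<close> supported in between.
  The inequality for \<open>v\<close>, whose right-hand side is nonnegative, tested with
  \<open>\<eta>\<^sub>k\<^sup>m exp (- v / M)\<close> yields a Caccioppoli estimate of
  \<open>exp (- v / M) |\<nabla>v|\<^sup>p\<close> over \<open>{u \<ge> 2\<epsilon>}\<close> by \<open>|\<nabla>u|\<^sup>p + |\<nabla>u|\<^sup>q\<close> over \<open>{u \<ge> \<epsilon>}\<close>, which is finite.

  Therefore the difference of the inequalities may be tested with \<open>\<eta>\<^sub>k H (S\<^sub>M u - v - 2\<epsilon>)\<close>, where \<open>H\<close> is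
  increasing and vanishes on the negative half-line and \<open>S\<^sub>M\<close> is a concave truncation at height of order
  \<open>M\<close>.  The truncation error lives on \<open>{u \<ge> M, v \<le> 2M}\<close>; the Caccioppoli estimate with
  \<open>\<epsilon> = M / 2\<close> bounds it by the tail of \<open>|\<nabla>u|\<^sup>p + |\<nabla>u|\<^sup>q\<close> over \<open>{u \<ge> M / 2}\<close>, uniformly in \<open>M\<close>.
  As \<open>M\<close> tends to infinity, strict monotonicity of the flux forces \<open>\<nabla>u = \<nabla>v\<close> almost everywhere on
  \<open>{u > v}\<close>.  So \<open>H (u - v - 2\<epsilon>)\<close> has zero gradient, and integrating
  \<open>\<eta>\<^sub>k H (u - v - 2\<epsilon>)\<close> by parts against a coordinate function shows that it is zero.
\<close>

section \<open>Smooth bump functions and mollifiers\<close>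

text \<open>The weight \<open>exp (- v / M)\<close> decreases in \<open>v\<close>, which gives the
  gradient term of \<open>v\<close> a favourable sign, but it controls little where \<open>v\<close>
  is much larger than \<open>M\<close>. This is why \<open>u\<close> is truncated:
  \<open>S\<^sub>M u\<close> stays below \<open>2 M\<close>, so the comparison test function lives
  where \<open>v < 2 M\<close> and the weight is at least \<open>exp (-2)\<close>. Since
  \<open>v\<close> is positive, it also lives where \<open>u > 2 \<epsilon>\<close>; there the limit
  cut-off is 1 with zero gradient and leaves no trace.

  The Caccioppoli constant has a factor \<open>M\<close> from the logarithmic slope of the weight
  and a factor \<open>1 / \<epsilon>\<close> from the cut-off, which rises while \<open>u\<close>
  goes from \<open>\<epsilon>\<close> to \<open>2 \<epsilon>\<close>. Only the ratio matters, and
  coupling \<open>\<epsilon>\<close> to \<open>M\<close> freezes it.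

  The definitions admit smooth test functions only, whereas these constructions are nonlinear in
  \<open>u\<close> and \<open>v\<close>. They are reached in two steps: C1 functions of compact
  support by mollification, then composites of \<open>u\<close> and \<open>v\<close> as limits of
  composites of mollified functions. The limits come in a fixed order: mollification radius, index
  of the cut-off, \<open>M\<close>, and finally \<open>\<epsilon>\<close>.\<close>

definition exp_recip :: "nat \<Rightarrow> real \<Rightarrow> real" where
  "exp_recip k t = (if t > 0 then exp (- (1 / t)) / t ^ k else 0)"

lemma exp_recip_tendsto_0: "((\<lambda>t::real. exp (- (1 / t)) / t ^ k) \<longlongrightarrow> 0) (at_right 0)"
proof -
  have "((\<lambda>s::real. s ^ k / exp s) \<longlongrightarrow> 0) at_top"
    by (rule tendsto_power_div_exp_0)
  moreover have "filterlim (\<lambda>t::real. inverse t) at_top (at_right 0)"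
    by (rule filterlim_inverse_at_top_right)
  ultimately have "((\<lambda>t::real. (inverse t) ^ k / exp (inverse t)) \<longlongrightarrow> 0) (at_right 0)"
    by (rule filterlim_compose)
  thus ?thesis
    by (simp add: exp_minus field_simps)
qed

text \<open>Differentiation stays inside the span of the family: the exponent \<open>1 / t\<close>
  contributes two more powers in the denominator, the factor \<open>1 / t ^ k\<close> one more. This
  is why the parameter \<open>k\<close> is carried along instead of the single function
  \<open>exp (- (1 / t))\<close>.\<close>

lemma exp_recip_deriv:
  "(exp_recip k has_real_derivative (exp_recip (k + 2) t - real k * exp_recip (Suc k) t)) (at t)"
proof -
  consider "t > 0" | "t < 0" | "t = 0" by linarith
  thus ?thesis
  proof cases
    case 1
    have "((\<lambda>t. exp (- (1 / t)) / t ^ k) has_real_derivative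
       exp (- (1 / t)) / t ^ (k + 2) - real k * (exp (- (1 / t)) / t ^ Suc k)) (at t)"
      using 1
      by (auto intro!: derivative_eq_intros)
         (cases k; auto simp: field_simps power2_eq_square)
    moreover have "eventually (\<lambda>s. exp (- (1 / s)) / s ^ k = exp_recip k s) (nhds t)"
      using 1 eventually_nhds_in_open[of "{0<..}" t]
      by (auto simp: exp_recip_def elim!: eventually_mono)
    ultimately show ?thesis
      using 1 by (subst DERIV_cong_ev[OF refl _ refl, of _ "\<lambda>s. exp (- (1 / s)) / s ^ k"])
        (auto simp: exp_recip_def elim!: eventually_mono)
  next
    case 2
    have "eventually (\<lambda>s. exp_recip k s = 0) (nhds t)"
      using 2 eventually_nhds_in_open[of "{..<0}" t]
      by (auto simp: exp_recip_def elim!: eventually_mono)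
    thus ?thesis
      using 2 by (subst DERIV_cong_ev[OF refl _ refl, of _ "\<lambda>s. 0"]) (auto simp: exp_recip_def)
  next
    case 3
    have "((\<lambda>h. (exp_recip k h - exp_recip k 0) / h) \<longlongrightarrow> 0) (at_left 0)"
      by (rule tendsto_eventually)
         (auto simp: eventually_at_left_field exp_recip_def intro!: exI[of _ "-1"])
    \<comment> \<open>The right difference quotient at 0 is the function with exponent
      \<open>Suc k\<close>, which the exponential still drives to 0.\<close>
    moreover have "((\<lambda>h. (exp_recip k h - exp_recip k 0) / h) \<longlongrightarrow> 0) (at_right 0)"
    proof (rule Lim_transform_eventually[OF exp_recip_tendsto_0[of "Suc k"]])
      show "\<forall>\<^sub>F h in at_right 0. exp (- (1 / h)) / h ^ Suc k = (exp_recip k h - exp_recip k 0) / h"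
        by (auto simp: eventually_at_right_field exp_recip_def intro!: exI[of _ "1"])
    qed
    ultimately have "((\<lambda>h. (exp_recip k h - exp_recip k 0) / h) \<longlongrightarrow> 0) (at 0)"
      by (simp add: filterlim_split_at_real)
    thus ?thesis
      using 3 by (simp add: DERIV_def exp_recip_def)
  qed
qed

text \<open>
  This algebra is closed under partial derivatives, which makes it an invariant for the coinductive
  \<open>smooth_on\<close>.
\<close>

inductive_set bump_alg :: "(real^'n \<Rightarrow> real) set" where
  const: "(\<lambda>x. c) \<in> bump_alg"
| coord: "(\<lambda>x. x $ i) \<in> bump_alg"
| bump: "(\<lambda>x. exp_recip k (r - (x - a) \<bullet> (x - a))) \<in> bump_alg"
| add: "f \<in> bump_alg \<Longrightarrow> g \<in> bump_alg \<Longrightarrow> (\<lambda>x. f x + g x) \<in> bump_alg"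
| mult: "f \<in> bump_alg \<Longrightarrow> g \<in> bump_alg \<Longrightarrow> (\<lambda>x. f x * g x) \<in> bump_alg"

lemma bump_alg_deriv:
  fixes f :: "real^'n \<Rightarrow> real"
  assumes "f \<in> bump_alg"
  shows "\<exists>Df. (\<forall>x. (f has_derivative (\<lambda>h. \<Sum>i\<in>UNIV. h $ i * Df i x)) (at x)) \<and> (\<forall>i. Df i \<in> bump_alg)"
  using assms
proof induction
  case (const c)
  show ?case by (rule exI[of _ "\<lambda>i x. 0"]) (auto intro: bump_alg.const)
next
  case (coord i)
  have "(\<Sum>j\<in>UNIV. h $ j * (if j = i then 1 else 0)) = h $ i" for h :: "real^'n"
    by (simp add: if_distrib cong: if_cong)
  thus ?case
    by (intro exI[of _ "\<lambda>j x. if j = i then 1 else 0"])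
       (auto intro!: bump_alg.const bounded_linear_imp_has_derivative bounded_linear_vec_nth)
next
  case (bump k r a)
  let ?D = "\<lambda>t. exp_recip (k + 2) t - real k * exp_recip (Suc k) t"
  let ?N = "\<lambda>x. r - (x - a) \<bullet> (x - a)"
  \<comment> \<open>Differences are spelled as sums and products with constants so that the rules of
    \<open>bump_alg\<close> apply to the partial derivatives literally.\<close>
  let ?Df = "\<lambda>i x. (exp_recip (k + 2) (?N x) + (- real k) * exp_recip (Suc k) (?N x)) * ((-2) * (x $ i + (- (a $ i))))"
  have "((\<lambda>x. exp_recip k (?N x)) has_derivative (\<lambda>h. \<Sum>i\<in>UNIV. h $ i * ?Df i x)) (at x)" for x
  proof -
    have "((\<lambda>x. exp_recip k (?N x)) has_derivative (\<lambda>h. (- (2 * ((x - a) \<bullet> h))) * ?D (?N x))) (at x)"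
      by (rule has_derivative_compose[OF _ exp_recip_deriv[unfolded has_field_derivative_def], THEN has_derivative_eq_rhs])
         (auto intro!: derivative_eq_intros simp: inner_commute algebra_simps)
    also have "(\<lambda>h. (- (2 * ((x - a) \<bullet> h))) * ?D (?N x)) = (\<lambda>h. \<Sum>i\<in>UNIV. h $ i * ?Df i x)"
    proof
      fix h
      have "(- (2 * ((x - a) \<bullet> h))) * c = (\<Sum>i\<in>UNIV. h $ i * (c * ((-2) * (x $ i + (- (a $ i))))))" for c
        by (auto simp: inner_vec_def sum_distrib_left sum_distrib_right sum_negf[symmetric] algebra_simps intro!: sum.cong)
      from this[of "?D (?N x)"] show "(- (2 * ((x - a) \<bullet> h))) * ?D (?N x) = (\<Sum>i\<in>UNIV. h $ i * ?Df i x)"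
        by simp
    qed
    finally show ?thesis .
  qed
  moreover have "?Df i \<in> bump_alg" for i
    by (intro bump_alg.intros)
  ultimately show ?case by (intro exI[of _ ?Df]) blast
next
  case (add f g)
  then obtain Df Dg where *: "\<And>x. (f has_derivative (\<lambda>h. \<Sum>i\<in>UNIV. h $ i * Df i x)) (at x)" "\<And>i. Df i \<in> bump_alg"
     "\<And>x. (g has_derivative (\<lambda>h. \<Sum>i\<in>UNIV. h $ i * Dg i x)) (at x)" "\<And>i. Dg i \<in> bump_alg"
    by blast
  show ?case
    by (rule exI[of _ "\<lambda>i x. Df i x + Dg i x"])
       (auto intro!: bump_alg.intros * derivative_eq_intros simp: sum.distrib algebra_simps)
next
  case (mult f g)
  then obtain Df Dg where *: "\<And>x. (f has_derivative (\<lambda>h. \<Sum>i\<in>UNIV. h $ i * Df i x)) (at x)" "\<And>i. Df i \<in> bump_alg"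
     "\<And>x. (g has_derivative (\<lambda>h. \<Sum>i\<in>UNIV. h $ i * Dg i x)) (at x)" "\<And>i. Dg i \<in> bump_alg"
    by blast
  have "((\<lambda>x. f x * g x) has_derivative (\<lambda>h. \<Sum>i\<in>UNIV. h $ i * (f x * Dg i x + Df i x * g x))) (at x)" for x
    by (rule has_derivative_mult[OF *(1,3), THEN has_derivative_eq_rhs])
       (auto simp: sum.distrib sum_distrib_left sum_distrib_right algebra_simps)
  moreover have "(\<lambda>x. f x * Dg i x + Df i x * g x) \<in> bump_alg" for i
    by (intro bump_alg.intros mult.hyps *)
  ultimately show ?case by (intro exI[of _ "\<lambda>i x. f x * Dg i x + Df i x * g x"]) blast
qed

lemma smooth_on_bump_alg:
  fixes f :: "real^'n \<Rightarrow> real"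
  assumes "f \<in> bump_alg"
  shows "smooth_on UNIV f"
  using assms
proof (coinduction arbitrary: f rule: smooth_on.coinduct)
  case smooth_on
  from bump_alg_deriv[OF this] show ?case by blast
qed

text \<open>The argument uses \<open>x \<bullet> x\<close> and not \<open>norm x\<close>: the
  squared norm is differentiable at 0, and the expression is a generator of
  \<open>bump_alg\<close>.\<close>

definition bump :: "real \<Rightarrow> real^'n \<Rightarrow> real" where
  "bump h x = exp_recip 0 (h\<^sup>2 - x \<bullet> x)"

lemma bump_nonneg: "0 \<le> bump h x"
  by (simp add: bump_def exp_recip_def)

lemma bump_pos_iff: "h > 0 \<Longrightarrow> 0 < bump h x \<longleftrightarrow> norm x < h"
  by (auto simp: bump_def exp_recip_def dot_square_norm power_strict_mono
      dest: power_less_imp_less_base[of _ 2])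

lemma bump_eq_0: "h > 0 \<Longrightarrow> h \<le> norm x \<Longrightarrow> bump h x = 0"
  using bump_pos_iff[of h x] bump_nonneg[of h x] by auto

lemma continuous_on_exp_recip: "continuous_on UNIV (exp_recip k)"
  by (meson DERIV_isCont continuous_at_imp_continuous_on exp_recip_deriv)

lemma continuous_on_bump: "continuous_on UNIV (bump h)"
  unfolding bump_def
  by (rule continuous_on_compose2[OF continuous_on_exp_recip]) (auto intro!: continuous_intros)

lemma integrable_lborel_compact_support:
  fixes f :: "real^'n \<Rightarrow> 'b::euclidean_space"
  assumes "continuous_on UNIV f" "\<And>x. norm x > R \<Longrightarrow> f x = 0"
  shows "integrable lborel f"
proof -
  have "integrable lborel (\<lambda>x. indicator (cball 0 R) x *\<^sub>R f x)"
    by (rule borel_integrable_compact) (auto intro: continuous_on_subset[OF assms(1)])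
  also have "(\<lambda>x. indicator (cball 0 R) x *\<^sub>R f x) = f"
    using assms(2) by (force simp: indicator_def)
  finally show ?thesis .
qed

text \<open>If the integral vanished, the open ball on which the bump is positive would be a null
  set.\<close>

lemma bump_integral_pos:
  assumes "h > 0"
  shows "0 < (LINT x|lborel. bump h (x::real^'n))"
proof -
  have int: "integrable lborel (bump h :: real^'n \<Rightarrow> real)"
    by (rule integrable_lborel_compact_support[OF continuous_on_bump, of h]) (use assms in \<open>auto intro: bump_eq_0\<close>)
  have "(LINT x|lborel. bump h (x::real^'n)) \<noteq> 0"
  proof
    assume "(LINT x|lborel. bump h (x::real^'n)) = 0"
    hence "AE x::real^'n in lborel. bump h x = 0"
      using int by (subst (asm) integral_nonneg_eq_0_iff_AE) (auto simp: bump_nonneg)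
    hence "AE x::real^'n in lborel. x \<notin> ball 0 h"
      by (rule AE_mp) (use assms bump_pos_iff[of h] in \<open>auto intro!: AE_I2 simp: less_le\<close>)
    hence "ball 0 h \<in> null_sets (lborel :: (real^'n) measure)"
      by (subst AE_iff_null_sets) auto
    thus False using assms emeasure_lborel_ball_finite[of 0 h]
      by (metis open_ball negligible_iff_null_sets null_sets_completionI open_not_negligible ball_eq_empty not_le)
  qed
  moreover have "0 \<le> (LINT x|lborel. bump h (x::real^'n))"
    by (rule integral_nonneg_AE) (auto simp: bump_nonneg)
  ultimately show ?thesis by linarith
qed

definition mollifier :: "real \<Rightarrow> real^'n \<Rightarrow> real" where
  "mollifier h x = bump h x / (LINT x|lborel. bump h (x::real^'n))"

lemma mollifier_nonneg: "h > 0 \<Longrightarrow> 0 \<le> mollifier h x"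
  using bump_integral_pos[of h] by (auto simp: mollifier_def bump_nonneg)

lemma mollifier_eq_0: "h > 0 \<Longrightarrow> h \<le> norm x \<Longrightarrow> mollifier h x = 0"
  by (auto simp: mollifier_def bump_eq_0)

lemma mollifier_minus: "mollifier h (- x) = mollifier h x"
  by (simp add: mollifier_def bump_def)

lemma mollifier_diff_commute: "mollifier h (x - y) = mollifier h (y - x)"
  by (metis minus_diff_eq mollifier_minus)

lemma continuous_on_mollifier: "continuous_on UNIV (mollifier h)"
  unfolding mollifier_def by (auto simp: divide_inverse intro!: continuous_intros continuous_on_bump)

lemma integral_mollifier: "h > 0 \<Longrightarrow> (LINT x|lborel. mollifier h (x::real^'n)) = 1"
  using bump_integral_pos[of h, where 'n='n] by (simp add: mollifier_def)

lemma smooth_on_mollifier_shift: "smooth_on UNIV (\<lambda>x. mollifier h (x - a))"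
proof -
  have "(\<lambda>x. (1 / (LINT x|lborel. bump h (x::real^'n))) * exp_recip 0 (h\<^sup>2 - (x - a) \<bullet> (x - a))) \<in> bump_alg"
    by (intro bump_alg.intros)
  thus ?thesis using smooth_on_bump_alg by (auto simp: mollifier_def bump_def)
qed

lemma smooth_on_mollifier: "smooth_on UNIV (mollifier h)"
  using smooth_on_mollifier_shift[of h 0] by simp

text \<open>\<open>grad\<close> selects a value even where no derivative exists. This relation
  records differentiability at every point together with the gradient.\<close>

definition has_grad :: "(real^'n \<Rightarrow> real) \<Rightarrow> (real^'n \<Rightarrow> real^'n) \<Rightarrow> bool" where
  "has_grad r D \<longleftrightarrow> (\<forall>x. (r has_derivative (\<lambda>h. D x \<bullet> h)) (at x))"

lemma has_gradD: "has_grad r D \<Longrightarrow> (r has_derivative (\<lambda>h. D x \<bullet> h)) (at x)"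
  by (simp add: has_grad_def)

lemma has_grad_continuous: "has_grad r D \<Longrightarrow> continuous_on UNIV r"
  by (meson continuous_at_imp_continuous_on has_derivative_continuous has_gradD)

lemma has_grad_unique: "has_grad r D \<Longrightarrow> has_grad r D' \<Longrightarrow> D = D'"
proof
  fix x assume "has_grad r D" "has_grad r D'"
  hence "(\<lambda>h. D x \<bullet> h) = (\<lambda>h. D' x \<bullet> h)"
    by (meson has_derivative_unique has_gradD)
  hence "\<And>h. D x \<bullet> h = D' x \<bullet> h" by metis
  thus "D x = D' x"
    by (metis inner_commute vector_eq_ldot)
qed

lemma has_grad_grad:
  assumes "has_grad r D" shows "grad r = D"
proof
  fix x
  have "frechet_derivative r (at x) = (\<lambda>h. D x \<bullet> h)"
    using has_gradD[OF assms, of x] by (metis frechet_derivative_at)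
  thus "grad r x = D x"
    by (simp add: grad_def vec_eq_iff inner_axis)
qed

lemma has_grad_components:
  "(\<forall>x. (r has_derivative (\<lambda>h. \<Sum>i\<in>UNIV. h $ i * Df i x)) (at x)) \<longleftrightarrow> has_grad r (\<lambda>x. \<chi> i. Df i x)"
  for r :: "real^'n \<Rightarrow> real"
proof -
  have "(\<lambda>h. \<Sum>i\<in>UNIV. h $ i * Df i x) = (\<lambda>h. (\<chi> i. Df i x) \<bullet> h)" for x
    by (auto simp: inner_vec_def mult.commute)
  thus ?thesis by (simp add: has_grad_def)
qed

lemma smooth_onE:
  assumes "smooth_on UNIV (r :: real^'n \<Rightarrow> real)"
  obtains D where "has_grad r D" "\<And>i. smooth_on UNIV (\<lambda>x. D x $ i)"
proof -
  from assms obtain Df where Df: "\<And>x. (r has_derivative (\<lambda>h. \<Sum>i\<in>UNIV. h $ i * Df i x)) (at x)"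
    "\<And>i. smooth_on UNIV (Df i)"
    by (cases rule: smooth_on.cases) auto
  have "has_grad r (\<lambda>x. \<chi> i. Df i x)"
    using Df(1) has_grad_components[of r Df] by blast
  thus ?thesis using Df(2) by (intro that) auto
qed

lemma continuous_on_smooth: "smooth_on UNIV (r :: real^'n \<Rightarrow> real) \<Longrightarrow> continuous_on UNIV r"
  by (erule smooth_onE) (rule has_grad_continuous)

lemma smooth_on_has_grad:
  assumes "smooth_on UNIV (r :: real^'n \<Rightarrow> real)"
  shows "has_grad r (grad r)" "continuous_on UNIV (grad r)" "smooth_on UNIV (\<lambda>x. grad r x $ i)"
proof -
  from assms obtain D where D: "has_grad r D" "\<And>i. smooth_on UNIV (\<lambda>x. D x $ i)"
    using smooth_onE by blast
  have [simp]: "grad r = D" using D(1) by (rule has_grad_grad)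
  show "has_grad r (grad r)" "smooth_on UNIV (\<lambda>x. grad r x $ i)" using D by auto
  have "continuous_on UNIV (\<lambda>x. \<chi> i. D x $ i)"
    by (rule continuous_on_vec_lambda) (use D(2) continuous_on_smooth in blast)
  thus "continuous_on UNIV (grad r)" by simp
qed

lemma has_grad_eq_0_open:
  assumes "has_grad r D" "open S" "\<And>x. x \<in> S \<Longrightarrow> r x = 0" "x \<in> S"
  shows "D x = 0"
proof -
  have "((\<lambda>x. 0) has_derivative (\<lambda>h. D x \<bullet> h)) (at x)"
    using has_derivative_transform_within_open[OF has_gradD[OF assms(1), of x] assms(2) assms(4)] assms(3)
    by auto
  hence "(\<lambda>h. D x \<bullet> h) = (\<lambda>h. 0)"
    by (metis has_derivative_const has_derivative_unique)
  thus ?thesis by (metis inner_eq_zero_iff)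
qed

lemma has_grad_eq_0_outside:
  assumes "has_grad r D" "\<And>x. norm x > R \<Longrightarrow> r x = 0" "norm x > R"
  shows "D x = 0"
proof (rule has_grad_eq_0_open[OF assms(1), of "- cball 0 R"])
qed (use assms in auto)

lemma has_grad_eq_0_tsupp:
  assumes "has_grad r D" "x \<notin> tsupp r"
  shows "D x = 0"
proof (rule has_grad_eq_0_open[OF assms(1), of "- tsupp r"])
  show "\<And>x. x \<in> - tsupp r \<Longrightarrow> r x = 0"
    using closure_subset[of "{x. r x \<noteq> 0}"] by (auto simp: tsupp_def)
qed (use assms in \<open>auto simp: tsupp_def\<close>)

lemma tsupp_eq_0: "x \<notin> tsupp r \<Longrightarrow> r x = 0"
  using closure_subset[of "{x. r x \<noteq> 0}"] by (auto simp: tsupp_def)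

lemma compact_tsupp_iff:
  "compact (tsupp r) \<longleftrightarrow> (\<exists>R. \<forall>x. norm x > R \<longrightarrow> r x = 0)"
proof
  assume "compact (tsupp r)"
  then obtain R where "\<And>x. x \<in> tsupp r \<Longrightarrow> norm x \<le> R"
    by (meson bounded_iff compact_imp_bounded)
  thus "\<exists>R. \<forall>x. norm x > R \<longrightarrow> r x = 0"
    by (intro exI[of _ R]) (meson not_le tsupp_eq_0)
next
  assume "\<exists>R. \<forall>x. norm x > R \<longrightarrow> r x = 0"
  then obtain R where R: "\<forall>x. norm x > R \<longrightarrow> r x = 0" by blast
  have "{x. r x \<noteq> 0} \<subseteq> cball 0 R" using R by (auto simp: not_le[symmetric])
  thus "compact (tsupp r)" unfolding tsupp_def
    by (meson bounded_cball bounded_subset compact_closure)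
qed

lemma compact_tsupp_subset: "compact K \<Longrightarrow> tsupp f \<subseteq> K \<Longrightarrow> compact (tsupp f)"
  by (metis closed_Int_compact closed_closure inf.absorb1 tsupp_def)

lemma tsupp_subset_closed: "closed K \<Longrightarrow> (\<And>x. x \<notin> K \<Longrightarrow> f x = 0) \<Longrightarrow> tsupp f \<subseteq> K"
  unfolding tsupp_def by (rule closure_minimal) auto

lemma compact_support_bounded:
  fixes r :: "real^'n \<Rightarrow> 'b::real_normed_vector"
  assumes "continuous_on UNIV r" "\<And>x. norm x > R \<Longrightarrow> r x = 0"
  shows "\<exists>B>0. \<forall>x. norm (r x) \<le> B"
proof -
  have "compact (r ` cball 0 R)"
    by (rule compact_continuous_image) (auto intro: continuous_on_subset[OF assms(1)])
  then obtain B where B: "\<And>x. norm x \<le> R \<Longrightarrow> norm (r x) \<le> B"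
    by (meson bounded_iff compact_imp_bounded imageI mem_cball_0)
  have "norm (r x) \<le> max B 1" for x
    using B[of x] assms(2)[of x] by (cases "norm x \<le> R") (auto simp: not_le)
  thus ?thesis by (intro exI[of _ "max B 1"]) auto
qed

text \<open>Heine-Cantor on the ball of radius \<open>R + 1\<close>. The margin 1 settles the
  remaining pairs: two points at distance below 1, one of them outside that ball, both lie where
  \<open>r\<close> vanishes.\<close>

lemma compact_support_uniformly_continuous:
  fixes r :: "real^'n \<Rightarrow> 'b::real_normed_vector"
  assumes "continuous_on UNIV r" "\<And>x. norm x > R \<Longrightarrow> r x = 0"
  shows "uniformly_continuous_on UNIV r"
proof -
  have u: "uniformly_continuous_on (cball 0 (R+1)) r"
    by (rule compact_uniformly_continuous) (auto intro: continuous_on_subset[OF assms(1)])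
  show ?thesis unfolding uniformly_continuous_on_def
  proof (intro allI impI)
    fix e :: real assume "e > 0"
    then obtain d where d: "d > 0" "\<And>x y. x \<in> cball 0 (R+1) \<Longrightarrow> y \<in> cball 0 (R+1) \<Longrightarrow> dist y x < d \<Longrightarrow> dist (r y) (r x) < e"
      using u unfolding uniformly_continuous_on_def by meson
    have "dist (r y) (r x) < e" if "dist y x < min d 1" for x y
    proof (cases "x \<in> cball 0 (R+1) \<and> y \<in> cball 0 (R+1)")
      case True thus ?thesis using d(2) that by auto
    next
      case False
      have "norm y \<le> norm x + dist y x" "norm x \<le> norm y + dist y x"
        by (metis add.commute dist_norm norm_triangle_sub,
            metis add.commute dist_norm norm_triangle_sub dist_commute)
      hence "norm x > R" "norm y > R" using that False by auto
      thus ?thesis using assms(2) \<open>e > 0\<close> by simp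
    qed
    thus "\<exists>d>0. \<forall>x\<in>UNIV. \<forall>y\<in>UNIV. dist y x < d \<longrightarrow> dist (r y) (r x) < e"
      using d(1) by (intro exI[of _ "min d 1"]) auto
  qed
qed

section \<open>Convolution: continuity, differentiability, smoothness\<close>

definition conv :: "(real^'n \<Rightarrow> real) \<Rightarrow> (real^'n \<Rightarrow> real) \<Rightarrow> real^'n \<Rightarrow> real" where
  "conv f r x = (LINT y|lebesgue. f y * r (x - y))"

lemma borel_measurable_lebesgue_continuous:
  fixes r :: "'a::euclidean_space \<Rightarrow> 'b::euclidean_space"
  assumes "continuous_on UNIV r"
  shows "r \<in> borel_measurable lebesgue"
  using borel_measurable_continuous_onI[OF assms]
  by (intro measurable_completion) simp

lemma integrable_mult_bounded_continuous:
  fixes f r :: "real^'n \<Rightarrow> real"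
  assumes f: "integrable lebesgue f" and r: "continuous_on UNIV r" and B: "\<And>x. \<bar>r x\<bar> \<le> B"
  shows "integrable lebesgue (\<lambda>y. f y * r y)"
proof (rule Bochner_Integration.integrable_bound)
  show "integrable lebesgue (\<lambda>y. B * f y)" using f by simp
  show "(\<lambda>y. f y * r y) \<in> borel_measurable lebesgue"
    using f borel_measurable_lebesgue_continuous[OF r] by measurable
  have "\<bar>f y\<bar> * \<bar>r y\<bar> \<le> \<bar>f y\<bar> * \<bar>B\<bar>" for y
    using B[of y] by (intro mult_left_mono) auto
  thus "AE y in lebesgue. norm (f y * r y) \<le> norm (B * f y)"
    by (intro AE_I2) (simp add: abs_mult mult.commute)
qed

lemma conv_integrable:
  fixes f r :: "real^'n \<Rightarrow> real"
  assumes f: "integrable lebesgue f" and r: "continuous_on UNIV r" and B: "\<And>x. \<bar>r x\<bar> \<le> B"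
  shows "integrable lebesgue (\<lambda>y. f y * r (x - y))"
  by (rule integrable_mult_bounded_continuous[OF f, of _ B])
     (auto intro!: continuous_on_compose2[OF r] continuous_intros B)

lemma integral_mult_bound:
  fixes f a :: "real^'n \<Rightarrow> real"
  assumes f: "integrable lebesgue f"
    and r: "integrable lebesgue (\<lambda>y. f y * a y)" and B: "\<And>y. \<bar>a y\<bar> \<le> B"
  shows "\<bar>LINT y|lebesgue. f y * a y\<bar> \<le> B * (LINT y|lebesgue. \<bar>f y\<bar>)"
proof -
  have "\<bar>LINT y|lebesgue. f y * a y\<bar> \<le> (LINT y|lebesgue. \<bar>f y * a y\<bar>)"
    using integral_norm_bound[of lebesgue "\<lambda>y. f y * a y"] by simp
  also have "\<dots> \<le> (LINT y|lebesgue. B * \<bar>f y\<bar>)"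
  proof (rule integral_mono)
    show "\<bar>f x * a x\<bar> \<le> B * \<bar>f x\<bar>" for x
      using mult_left_mono[OF B[of x], of "\<bar>f x\<bar>"] by (simp add: abs_mult mult.commute)
  qed (use f r in auto)
  finally show ?thesis by simp
qed

lemma conv_continuous:
  assumes f: "integrable lebesgue f" and r: "continuous_on UNIV r" and R: "\<And>x. norm x > R \<Longrightarrow> r x = 0"
  shows "continuous_on UNIV (conv f r)"
proof -
  obtain B where B: "\<And>x. \<bar>r x\<bar> \<le> B" using compact_support_bounded[OF r, of R] R by auto
  \<comment> \<open>The summand 1 keeps \<open>C\<close> positive, and the final estimate strict,
    even when \<open>f\<close> vanishes almost everywhere.\<close>
  define C where "C = (LINT y|lebesgue. \<bar>f y\<bar>) + 1"
  have C: "C > 0" "(LINT y|lebesgue. \<bar>f y\<bar>) < C" unfolding C_def by (auto intro: add_nonneg_pos)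
  have u: "uniformly_continuous_on UNIV r" by (rule compact_support_uniformly_continuous[OF r R])
  show ?thesis unfolding continuous_on_iff
  proof (intro ballI allI impI)
    fix x :: "real^'a" and e :: real assume "e > 0"
    then obtain d where d: "d > 0" "\<And>x y. dist y x < d \<Longrightarrow> dist (r y) (r x) < e / C"
      using u C(1) unfolding uniformly_continuous_on_def by (metis UNIV_I divide_pos_pos)
    have "dist (conv f r y) (conv f r x) < e" if "dist y x < d" for y
    proof -
      have "conv f r y - conv f r x = (LINT z|lebesgue. f z * (r (y - z) - r (x - z)))"
        unfolding conv_def right_diff_distrib
        by (rule Bochner_Integration.integral_diff[symmetric]) (rule conv_integrable[OF f r B])+
      moreover have "\<bar>LINT z|lebesgue. f z * (r (y - z) - r (x - z))\<bar> \<le> (e / C) * (LINT y|lebesgue. \<bar>f y\<bar>)"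
      proof (rule integral_mult_bound[OF f])
        show "integrable lebesgue (\<lambda>z. f z * (r (y - z) - r (x - z)))"
          unfolding right_diff_distrib by (intro Bochner_Integration.integrable_diff conv_integrable[OF f r B])
        show "\<bar>r (y - z) - r (x - z)\<bar> \<le> e / C" for z
          using d(2)[of "y - z" "x - z"] that by (simp add: dist_norm)
      qed
      moreover have "(e / C) * (LINT y|lebesgue. \<bar>f y\<bar>) < (e / C) * C"
        using C \<open>e > 0\<close> by (intro mult_strict_left_mono) auto
      ultimately show ?thesis using C by (simp add: dist_real_def)
    qed
    thus "\<exists>d>0. \<forall>x'\<in>UNIV. dist x' x < d \<longrightarrow> dist (conv f r x') (conv f r x) < e"
      using d(1) by blast
  qed
qed

text \<open>Compact support makes \<open>D\<close> uniformly continuous, so the linearisation error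
  of \<open>r\<close> is small uniformly in the base point. Integration against \<open>f\<close>
  multiplies this uniform bound by the \<open>L^1\<close> norm of \<open>f\<close>.\<close>

lemma conv_has_grad:
  assumes f: "integrable lebesgue f" and r: "has_grad r D" and D: "continuous_on UNIV D"
    and R: "\<And>x. norm x > R \<Longrightarrow> r x = 0"
  shows "has_grad (conv f r) (\<lambda>x. \<chi> i. conv f (\<lambda>z. D z $ i) x)"
proof -
  note rc = has_grad_continuous[OF r]
  obtain B where B: "\<And>x. \<bar>r x\<bar> \<le> B" using compact_support_bounded[OF rc, of R] R by auto
  have DR: "norm x > R \<Longrightarrow> D x = 0" for x using has_grad_eq_0_outside[OF r R] by blast
  obtain B' where B': "\<And>x. norm (D x) \<le> B'" using compact_support_bounded[OF D, of R] DR by auto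
  have Dic: "continuous_on UNIV (\<lambda>z. D z $ i)" for i by (intro continuous_intros D)
  have DiB: "\<bar>D z $ i\<bar> \<le> B'" for z i using component_le_norm_cart[of "D z" i] B'[of z] by linarith
  define C where "C = (LINT y|lebesgue. \<bar>f y\<bar>) + 1"
  have C: "C > 0" "(LINT y|lebesgue. \<bar>f y\<bar>) < C" unfolding C_def by (auto intro: add_nonneg_pos)
  have u: "uniformly_continuous_on UNIV D" by (rule compact_support_uniformly_continuous[OF D DR])
  have int_inner: "integrable lebesgue (\<lambda>z. f z * (D (x - z) \<bullet> h))" for x h
    unfolding inner_vec_def sum_distrib_left inner_real_def
    using conv_integrable[OF f Dic DiB]
    by (auto simp: mult.assoc[symmetric])
  have inner_eq: "(\<chi> i. conv f (\<lambda>z. D z $ i) x) \<bullet> h = (LINT z|lebesgue. f z * (D (x - z) \<bullet> h))" for x h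
    unfolding inner_vec_def sum_distrib_left inner_real_def conv_def
    using conv_integrable[OF f Dic DiB]
    by (auto simp: mult.assoc[symmetric] Bochner_Integration.integral_sum)
  show ?thesis unfolding has_grad_def has_derivative_at_alt
  proof (intro allI conjI impI)
    fix x :: "real^'a" and e :: real assume "e > 0"
    then obtain d where d: "d > 0" "\<And>x y. dist y x < d \<Longrightarrow> dist (D y) (D x) < e / C"
      using u C(1) unfolding uniformly_continuous_on_def by (metis UNIV_I divide_pos_pos)
    have "norm (conv f r y - conv f r x - (\<chi> i. conv f (\<lambda>z. D z $ i) x) \<bullet> (y - x)) \<le> e * norm (y - x)"
      if y: "norm (y - x) < d" for y
    proof -
      let ?a = "\<lambda>z. r (y - z) - r (x - z) - D (x - z) \<bullet> (y - x)"
      have "conv f r y - conv f r x - (\<chi> i. conv f (\<lambda>z. D z $ i) x) \<bullet> (y - x) = (LINT z|lebesgue. f z * ?a z)"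
        unfolding inner_eq unfolding right_diff_distrib conv_def
        by (subst Bochner_Integration.integral_diff Bochner_Integration.integrable_diff;
            (intro Bochner_Integration.integrable_diff conv_integrable[OF f rc B] int_inner)?)+ simp
      moreover have "\<bar>LINT z|lebesgue. f z * ?a z\<bar> \<le> (norm (y - x) * (e / C)) * (LINT y|lebesgue. \<bar>f y\<bar>)"
      proof (rule integral_mult_bound[OF f])
        show "integrable lebesgue (\<lambda>z. f z * ?a z)"
          unfolding right_diff_distrib[of "f _"]
          by (intro Bochner_Integration.integrable_diff conv_integrable[OF f rc B] int_inner)
        show "\<bar>?a z\<bar> \<le> norm (y - x) * (e / C)" for z
        proof -
          have "norm (r (y - z) - r (x - z) - D (x - z) \<bullet> ((y - z) - (x - z))) \<le> norm ((y - z) - (x - z)) * (e / C)"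
          proof (rule differentiable_bound_linearization[of _ _ "ball (x - z) d" r "\<lambda>w h. D w \<bullet> h"])
            fix t :: real assume "t \<in> {0..1}"
            hence "norm (t *\<^sub>R ((y - z) - (x - z))) \<le> norm (y - x)"
              by (auto intro: mult_left_le_one_le)
            hence "dist (x - z) (x - z + t *\<^sub>R (y - z - (x - z))) \<le> norm (y - x)"
              by (simp add: dist_norm)
            thus "x - z + t *\<^sub>R (y - z - (x - z)) \<in> ball (x - z) d"
              using y by simp
          next
            fix w assume w: "w \<in> ball (x - z) d"
            show "(r has_derivative (\<bullet>) (D w)) (at w within ball (x - z) d)"
              using has_gradD[OF r, of w] by (rule has_derivative_at_withinI)
            have "dist (D w) (D (x - z)) < e / C" using d(2) w by (simp add: dist_commute)
            hence *: "norm (D w - D (x - z)) \<le> e / C" by (simp add: dist_norm)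
            have "\<bar>(D w - D (x - z)) \<bullet> h\<bar> \<le> e / C * norm h" for h
              using Cauchy_Schwarz_ineq2[of "D w - D (x - z)" h] mult_right_mono[OF * norm_ge_zero[of h]]
              by linarith
            thus "onorm ((\<lambda>h. D w \<bullet> h) - (\<lambda>h. D (x - z) \<bullet> h)) \<le> e / C"
              by (intro onorm_le) (simp add: inner_diff_left)
          qed (use d in auto)
          thus ?thesis by simp
        qed
      qed
      moreover have "(norm (y - x) * (e / C)) * (LINT y|lebesgue. \<bar>f y\<bar>) \<le> (norm (y - x) * (e / C)) * C"
        using C \<open>e > 0\<close> by (intro mult_left_mono) auto
      ultimately show ?thesis using C by (simp add: mult.commute)
    qed
    thus "\<exists>d>0. \<forall>y. norm (y - x) < d \<longrightarrow>
      norm (conv f r y - conv f r x - (\<chi> i. conv f (\<lambda>z. D z $ i) x) \<bullet> (y - x)) \<le> e * norm (y - x)"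
      using d(1) by blast
  qed (rule bounded_linear_inner_right)
qed

text \<open>The coinduction ranges over all kernels that vanish outside the ball of radius
  \<open>R\<close>, while \<open>f\<close> stays fixed: a partial derivative of
  \<open>conv f r\<close> is the convolution of the same \<open>f\<close> with a partial derivative
  of \<open>r\<close>.\<close>

lemma smooth_on_conv:
  fixes f r :: "real^'n \<Rightarrow> real"
  assumes f: "integrable lebesgue f" and r: "smooth_on UNIV r" and R: "\<And>x. norm x > R \<Longrightarrow> r x = 0"
  shows "smooth_on UNIV (conv f r)"
  using r R
proof (coinduction arbitrary: r rule: smooth_on.coinduct)
  case (smooth_on r)
  note g = smooth_on_has_grad[OF smooth_on(1)]
  let ?Df = "\<lambda>i. conv f (\<lambda>z. grad r z $ i)"
  have "has_grad (conv f r) (\<lambda>x. \<chi> i. ?Df i x)"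
    by (rule conv_has_grad[OF f g(1,2)]) (use smooth_on in auto)
  hence "\<forall>x. (conv f r has_derivative (\<lambda>h. \<Sum>i\<in>UNIV. h $ i * ?Df i x)) (at x)"
    using has_grad_components[of "conv f r" ?Df] by blast
  moreover have "\<exists>r'. ?Df i = conv f r' \<and> smooth_on UNIV r' \<and> (\<forall>x. R < norm x \<longrightarrow> r' x = 0)" for i
    using g(3)[of i] has_grad_eq_0_outside[OF g(1), of R] smooth_on(2)
    by (intro exI[of _ "\<lambda>z. grad r z $ i"]) auto
  ultimately show ?case
    by (intro exI[of _ UNIV] exI[of _ "conv f r"] exI[of _ ?Df]) metis
qed

lemma lborel_distr_reflect: "distr lborel borel (\<lambda>y. x - y) = (lborel :: (real^'n) measure)"
  using lborel_affine[of "-1" x] by (simp add: density_1)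

lemma integral_reflect:
  fixes g :: "real^'n \<Rightarrow> real"
  shows "g \<in> borel_measurable borel \<Longrightarrow> (LINT y|lborel. g (x - y)) = (LINT y|lborel. g y)"
  by (subst (2) lborel_distr_reflect[of x, symmetric]) (simp add: integral_distr)

lemma conv_commute:
  assumes f: "continuous_on UNIV f" and r: "continuous_on UNIV r"
  shows "conv f r = conv r f"
proof
  fix x
  have *: "(\<lambda>y. f y * r (x - y)) \<in> borel_measurable borel" "(\<lambda>y. r y * f (x - y)) \<in> borel_measurable borel"
    by (intro borel_measurable_continuous_onI continuous_intros f r
        continuous_on_compose2[OF r] continuous_on_compose2[OF f]; simp)+
  have "conv f r x = (LINT y|lborel. f y * r (x - y))"
    unfolding conv_def using * by (intro integral_completion) simp
  also have "\<dots> = (LINT y|lborel. f (x - y) * r (x - (x - y)))"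
    by (rule integral_reflect[symmetric, OF *(1)])
  also have "\<dots> = (LINT y|lborel. r y * f (x - y))" by (simp add: mult.commute)
  also have "\<dots> = conv r f x"
    unfolding conv_def using * by (intro integral_completion[symmetric]) simp
  finally show "conv f r x = conv r f x" .
qed

lemma integrable_lebesgue_compact_support:
  fixes r :: "real^'n \<Rightarrow> 'b::euclidean_space"
  assumes "continuous_on UNIV r" "\<And>x. norm x > R \<Longrightarrow> r x = 0"
  shows "integrable lebesgue r"
  using integrable_lborel_compact_support[OF assms] borel_measurable_continuous_onI[OF assms(1)]
  by (simp add: integrable_completion)

section \<open>Mollification of integrable functions\<close>

lemma integrable_indicator_cball: "integrable lebesgue (\<lambda>x. (c::real) * indicator (cball a r) (x::real^'n))"
proof -
  have "emeasure lborel (cball a r) < \<infinity>" by (rule emeasure_lborel_cball_finite)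
  hence "integrable lebesgue (indicator (cball a r) :: real^'n \<Rightarrow> real)"
    by (intro integrable_real_indicator) auto
  thus ?thesis by simp
qed

lemma mollifier_bounded: "h > 0 \<Longrightarrow> \<exists>B. \<forall>x::real^'n. \<bar>mollifier h x\<bar> \<le> B"
  using compact_support_bounded[OF continuous_on_mollifier, of h h] mollifier_eq_0[of h]
  by (metis less_imp_le real_norm_def)

lemma integrable_conv_mollifier:
  fixes f :: "real^'n \<Rightarrow> real"
  assumes "integrable lebesgue f" "h > 0"
  shows "integrable lebesgue (\<lambda>y. f y * mollifier h (x - y))"
proof -
  obtain B where "\<forall>x::real^'n. \<bar>mollifier h x\<bar> \<le> B" using mollifier_bounded assms by blast
  thus ?thesis using conv_integrable[OF assms(1) continuous_on_mollifier] by blast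
qed

lemma mollifier_shift_integral:
  fixes x :: "real^'n"
  assumes "h > 0"
  shows "integrable lebesgue (\<lambda>y. mollifier h (x - y))" "(LINT y|lebesgue. mollifier h (x - y)) = 1"
proof -
  have c: "continuous_on UNIV (\<lambda>y. mollifier h (x - y))"
    by (rule continuous_on_compose2[OF continuous_on_mollifier]) (auto intro!: continuous_intros)
  show "integrable lebesgue (\<lambda>y. mollifier h (x - y))"
  proof (rule integrable_lebesgue_compact_support[OF c, of "norm x + h"])
    fix y :: "real^'n" assume "norm y > norm x + h"
    hence "norm (x - y) \<ge> h" using norm_triangle_ineq2[of y x] by (simp add: norm_minus_commute)
    thus "mollifier h (x - y) = 0" using assms mollifier_eq_0 by blast
  qed
  show "(LINT y|lebesgue. mollifier h (x - y)) = 1"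
    using integral_reflect[OF borel_measurable_continuous_onI[OF continuous_on_mollifier], of h x]
      borel_measurable_continuous_onI[OF c] integral_mollifier[OF assms]
    by (simp add: integral_completion)
qed

lemma continuous_on_conv_mollifier:
  assumes "integrable lebesgue f" "h > 0"
  shows "continuous_on UNIV (conv f (mollifier h))"
  by (rule conv_continuous[OF assms(1) continuous_on_mollifier, of h]) (simp add: mollifier_eq_0[OF assms(2)])

lemma conv_mollifier_L1:
  fixes f :: "real^'n \<Rightarrow> real"
  assumes f: "integrable lebesgue f" and h: "h > 0"
  shows "integrable lebesgue (conv f (mollifier h))"
    "(LINT x|lebesgue. \<bar>conv f (mollifier h) x\<bar>) \<le> (LINT x|lebesgue. \<bar>f x\<bar>)"
proof -
  let ?g = "conv f (mollifier h)"
  have gm: "?g \<in> borel_measurable lebesgue"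
    by (rule borel_measurable_lebesgue_continuous[OF continuous_on_conv_mollifier[OF f h]])
  \<comment> \<open>\<open>f\<close> is only Lebesgue measurable, while Tonelli's theorem is applied
    to the product of Borel measures; hence the Borel representative.\<close>
  obtain f' where f': "f' \<in> borel_measurable lborel" "AE x in lborel. f x = f' x"
    using completion_ex_borel_measurable_real[OF borel_measurable_integrable[OF f]] by auto
  have [measurable]: "f' \<in> borel_measurable borel" using f' by simp
  have [measurable]: "(mollifier h :: real^'n \<Rightarrow> real) \<in> borel_measurable borel"
    by (rule borel_measurable_continuous_onI[OF continuous_on_mollifier])
  have "(\<integral>\<^sup>+x. ennreal \<bar>?g x\<bar> \<partial>lebesgue) \<le> (\<integral>\<^sup>+x. (\<integral>\<^sup>+y. ennreal (\<bar>f' y\<bar> * mollifier h (x - y)) \<partial>lborel) \<partial>lborel)"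
    unfolding nn_integral_completion
  proof (rule nn_integral_mono)
    fix x
    have i: "integrable lebesgue (\<lambda>y. \<bar>f y\<bar> * mollifier h (x - y))"
      by (rule integrable_conv_mollifier) (use f h in auto)
    have "\<bar>?g x\<bar> \<le> (LINT y|lebesgue. \<bar>f y * mollifier h (x - y)\<bar>)"
      unfolding conv_def using integral_norm_bound[of lebesgue "\<lambda>y. f y * mollifier h (x - y)"] by simp
    also have "\<dots> = (LINT y|lebesgue. \<bar>f y\<bar> * mollifier h (x - y))"
      by (simp add: abs_mult mollifier_nonneg[OF h])
    finally have "ennreal \<bar>?g x\<bar> \<le> ennreal (LINT y|lebesgue. \<bar>f y\<bar> * mollifier h (x - y))"
      by (rule ennreal_leI)
    also have "\<dots> = (\<integral>\<^sup>+y. ennreal (\<bar>f y\<bar> * mollifier h (x - y)) \<partial>lebesgue)"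
      by (rule nn_integral_eq_integral[symmetric, OF i]) (auto simp: mollifier_nonneg[OF h])
    also have "\<dots> = (\<integral>\<^sup>+y. ennreal (\<bar>f' y\<bar> * mollifier h (x - y)) \<partial>lborel)"
      unfolding nn_integral_completion
      by (rule nn_integral_cong_AE) (use f'(2) in \<open>auto elim!: eventually_mono\<close>)
    finally show "ennreal \<bar>?g x\<bar> \<le> (\<integral>\<^sup>+y. ennreal (\<bar>f' y\<bar> * mollifier h (x - y)) \<partial>lborel)" .
  qed
  also have "\<dots> = (\<integral>\<^sup>+y. (\<integral>\<^sup>+x. ennreal (\<bar>f' y\<bar> * mollifier h (x - y)) \<partial>lborel) \<partial>lborel)"
    by (rule lborel_pair.Fubini') measurable
  also have "\<dots> = (\<integral>\<^sup>+y. ennreal \<bar>f' y\<bar> \<partial>lborel)"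
  proof (rule nn_integral_cong)
    fix y :: "real^'n"
    have "(\<integral>\<^sup>+x. ennreal (\<bar>f' y\<bar> * mollifier h (x - y)) \<partial>lborel) =
      ennreal \<bar>f' y\<bar> * (\<integral>\<^sup>+x. ennreal (mollifier h (y - x)) \<partial>lborel)"
      unfolding mollifier_diff_commute[of h _ y]
      by (subst nn_integral_cmult[symmetric]) (auto simp: ennreal_mult' )
    also have "(\<integral>\<^sup>+x. ennreal (mollifier h (y - x)) \<partial>lborel) = (\<integral>\<^sup>+x. ennreal (mollifier h (y - x)) \<partial>lebesgue)"
      by (simp add: nn_integral_completion)
    also have "\<dots> = 1"
      using mollifier_shift_integral[OF h, of y] nn_integral_eq_integral[of lebesgue "\<lambda>x. mollifier h (y - x)"]
      by (simp add: mollifier_nonneg[OF h])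
    finally show "(\<integral>\<^sup>+x. ennreal (\<bar>f' y\<bar> * mollifier h (x - y)) \<partial>lborel) = ennreal \<bar>f' y\<bar>" by simp
  qed
  also have "\<dots> = (\<integral>\<^sup>+y. ennreal \<bar>f y\<bar> \<partial>lebesgue)"
    unfolding nn_integral_completion
    by (rule nn_integral_cong_AE) (use f'(2) in \<open>auto elim!: eventually_mono\<close>)
  also have "\<dots> = ennreal (LINT x|lebesgue. \<bar>f x\<bar>)"
    by (rule nn_integral_eq_integral) (use f in auto)
  finally have le: "(\<integral>\<^sup>+x. ennreal \<bar>?g x\<bar> \<partial>lebesgue) \<le> ennreal (LINT x|lebesgue. \<bar>f x\<bar>)" .
  show gi: "integrable lebesgue ?g"
    using le gm by (intro integrableI_bounded) (auto intro: le_less_trans[OF _ ennreal_less_top])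
  have "ennreal (LINT x|lebesgue. \<bar>?g x\<bar>) \<le> ennreal (LINT x|lebesgue. \<bar>f x\<bar>)"
    using le nn_integral_eq_integral[of lebesgue "\<lambda>x. \<bar>?g x\<bar>"] gi by simp
  thus "(LINT x|lebesgue. \<bar>?g x\<bar>) \<le> (LINT x|lebesgue. \<bar>f x\<bar>)"
    by (simp add: ennreal_le_iff)
qed

lemma conv_mollifier_close:
  fixes f :: "real^'n \<Rightarrow> real"
  assumes f: "integrable lebesgue f" and h: "h > 0"
    and e: "\<And>y. dist y x < h \<Longrightarrow> \<bar>f y - f x\<bar> \<le> e"
  shows "\<bar>conv f (mollifier h) x - f x\<bar> \<le> e"
proof -
  let ?m = "\<lambda>y. mollifier h (x - y)"
  note i = integrable_conv_mollifier[OF f h, of x] mollifier_shift_integral(1)[OF h, of x]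
  have "conv f (mollifier h) x - f x = (LINT y|lebesgue. f y * ?m y) - (LINT y|lebesgue. f x * ?m y)"
    using mollifier_shift_integral[OF h, of x] by (simp add: conv_def)
  also have "\<dots> = (LINT y|lebesgue. f y * ?m y - f x * ?m y)"
    by (rule Bochner_Integration.integral_diff[symmetric])
       (use i in auto)
  finally have "\<bar>conv f (mollifier h) x - f x\<bar> = \<bar>LINT y|lebesgue. f y * ?m y - f x * ?m y\<bar>" by simp
  also have "\<dots> \<le> (LINT y|lebesgue. \<bar>f y * ?m y - f x * ?m y\<bar>)"
    using integral_norm_bound[of lebesgue "\<lambda>y. f y * ?m y - f x * ?m y"] by simp
  also have "\<dots> \<le> (LINT y|lebesgue. e * ?m y)"
  proof (rule integral_mono)
    show "integrable lebesgue (\<lambda>y. \<bar>f y * ?m y - f x * ?m y\<bar>)"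
      using i by auto
    show "integrable lebesgue (\<lambda>y. e * ?m y)"
      using i by auto
    show "\<bar>f y * ?m y - f x * ?m y\<bar> \<le> e * ?m y" for y
    proof (cases "dist y x < h")
      case True
      thus ?thesis using e[OF True] mollifier_nonneg[OF h, of "x - y"] mult_right_mono[of "\<bar>f y - f x\<bar>" e "?m y"]
        by (simp add: left_diff_distrib[symmetric] abs_mult)
    next
      case False
      hence "?m y = 0" using mollifier_eq_0[OF h, of "x - y"] by (simp add: dist_norm norm_minus_commute)
      thus ?thesis by simp
    qed
  qed
  also have "\<dots> = e" using mollifier_shift_integral[OF h, of x] by simp
  finally show ?thesis .
qed

text \<open>A mean over the ball of radius \<open>h\<close> respects lower bounds. The hypothesis is
  an almost-everywhere one because the bounds known for \<open>u\<close> and \<open>v\<close> are;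
  the conclusion holds at the given point itself, which keeps mollified functions inside the
  quadrant where \<open>C1_quadrant\<close> gives information.\<close>

lemma conv_mollifier_ge:
  fixes f :: "real^'n \<Rightarrow> real"
  assumes f: "integrable lebesgue f" and h: "h > 0"
    and c: "AE y in lebesgue. y \<in> ball x h \<longrightarrow> c \<le> f y"
  shows "c \<le> conv f (mollifier h) x"
proof -
  let ?m = "\<lambda>y. mollifier h (x - y)"
  have "c = (LINT y|lebesgue. c * ?m y)" using mollifier_shift_integral[OF h, of x] by simp
  also have "\<dots> \<le> (LINT y|lebesgue. f y * ?m y)"
  proof (rule integral_mono_AE)
    show "integrable lebesgue (\<lambda>y. c * ?m y)" "integrable lebesgue (\<lambda>y. f y * ?m y)"
      using integrable_conv_mollifier[OF f h, of x] mollifier_shift_integral(1)[OF h, of x] by auto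
    show "AE y in lebesgue. c * ?m y \<le> f y * ?m y"
      using c
    proof eventually_elim
      case (elim y)
      show ?case
      proof (cases "y \<in> ball x h")
        case True thus ?thesis using elim mollifier_nonneg[OF h] by (auto intro: mult_right_mono)
      next
        case False
        hence "?m y = 0" using mollifier_eq_0[OF h, of "x - y"] by (simp add: dist_norm)
        thus ?thesis by simp
      qed
    qed
  qed
  finally show ?thesis by (simp add: conv_def)
qed

lemma conv_mollifier_eq_0:
  fixes f :: "real^'n \<Rightarrow> real"
  assumes h: "h > 0" and "\<And>y. dist y x < h \<Longrightarrow> f y = 0"
  shows "conv f (mollifier h) x = 0"
proof -
  have "f y * mollifier h (x - y) = 0" for y
    using assms(2)[of y] mollifier_eq_0[OF h, of "x - y"]
    by (cases "dist y x < h") (auto simp: dist_norm norm_minus_commute)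
  hence "(\<lambda>y. f y * mollifier h (x - y)) = (\<lambda>y. 0)" by blast
  thus ?thesis unfolding conv_def by (simp only:) simp
qed

lemma conv_mollifier_diff:
  fixes f g :: "real^'n \<Rightarrow> real"
  assumes "integrable lebesgue f" "integrable lebesgue g" "h > 0"
  shows "conv (\<lambda>x. f x - g x) (mollifier h) x = conv f (mollifier h) x - conv g (mollifier h) x"
  unfolding conv_def left_diff_distrib
  using integrable_conv_mollifier[OF assms(1,3)] integrable_conv_mollifier[OF assms(2,3)] by simp

text \<open>Truncating \<open>f\<close> in height and in space gives the bounded function
  \<open>F m\<close> of bounded support. Measurability supplies continuous functions that converge
  to it off a negligible set; clipping them at the same height and multiplying by the continuous
  factor \<open>cut\<close> provides a majorant and does not disturb the limit, since
  \<open>F m\<close> is unchanged by both operations.\<close>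

lemma L1_approx_continuous:
  fixes f :: "real^'n \<Rightarrow> real"
  assumes f: "integrable lebesgue f" and e: "e > 0"
  shows "\<exists>\<phi> R. continuous_on UNIV \<phi> \<and> (\<forall>x. norm x > R \<longrightarrow> \<phi> x = 0) \<and> (LINT x|lebesgue. \<bar>f x - \<phi> x\<bar>) < e"
proof -
  note fm[measurable] = borel_measurable_integrable[OF f]
  define cl where "cl m t = max (- real m) (min (real m) t)" for m :: nat and t :: real
  define F where "F m x = indicator (ball 0 (real m)) x * cl m (f x)" for m x
  have Fm[measurable]: "F m \<in> borel_measurable lebesgue" for m
    unfolding F_def cl_def
    by (intro borel_measurable_times borel_measurable_indicator borel_measurable_max borel_measurable_min
        borel_measurable_const fm) simp
  have "(\<lambda>m. LINT x|lebesgue. \<bar>f x - F m x\<bar>) \<longlonglongrightarrow> (LINT x::real^'n|lebesgue. 0)"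
  proof (rule integral_dominated_convergence[where w="\<lambda>x. \<bar>f x\<bar>"])
    show "AE x in lebesgue. (\<lambda>m. \<bar>f x - F m x\<bar>) \<longlonglongrightarrow> 0"
    proof (rule AE_I2, rule tendsto_eventually)
      fix x
      obtain N where N: "real N > max (norm x) \<bar>f x\<bar>" using reals_Archimedean2 by blast
      have "\<bar>f x - F m x\<bar> = 0" if "m \<ge> N" for m
      proof -
        have "real N \<le> real m" using that by simp
        thus ?thesis using N by (auto simp: F_def cl_def)
      qed
      thus "\<forall>\<^sub>F m in sequentially. \<bar>f x - F m x\<bar> = 0" using eventually_sequentially by blast
    qed
    show "AE x in lebesgue. norm \<bar>f x - F m x\<bar> \<le> \<bar>f x\<bar>" for m
      by (rule AE_I2) (auto simp: F_def cl_def indicator_def max_def min_def)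
  qed (use f in auto)
  hence "\<forall>\<^sub>F m in sequentially. (LINT x|lebesgue. \<bar>f x - F m x\<bar>) < e / 2"
    using e by (intro order_tendstoD) auto
  then obtain m where m: "(LINT x|lebesgue. \<bar>f x - F m x\<bar>) < e / 2"
    using eventually_happens'[OF sequentially_bot] by blast
  have Fi: "integrable lebesgue (F m)"
    by (rule Bochner_Integration.integrable_bound[OF f])
       (auto simp: F_def cl_def indicator_def max_def min_def intro!: AE_I2)
  have "F m measurable_on UNIV"
    by (rule lebesgue_measurable_imp_measurable_on) auto
  then obtain N g where N: "negligible N" and g: "\<And>n. continuous_on UNIV (g n)"
    and lim: "\<And>x. x \<notin> N \<Longrightarrow> (\<lambda>n. g n x) \<longlonglongrightarrow> F m x"
    unfolding measurable_on_def by auto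
  define cut where "cut x = max 0 (min 1 (real m + 1 - norm x))" for x :: "real^'n"
  define G where "G n x = cut x * cl m (g n x)" for n x
  have Gc: "continuous_on UNIV (G n)" for n
    unfolding G_def cl_def cut_def by (intro continuous_intros g)
  have G0: "norm x > real m + 1 \<Longrightarrow> G n x = 0" for n x by (simp add: G_def cut_def)
  have Gb: "\<bar>G n x\<bar> \<le> real m * indicator (cball 0 (real m + 1)) x" for n x
  proof -
    have *: "\<bar>cut x\<bar> \<le> 1" "\<bar>cl m t\<bar> \<le> real m" for t by (auto simp: cut_def cl_def)
    show ?thesis using mult_mono[OF * , of "g n x"] G0[of x n]
      by (cases "norm x \<le> real m + 1") (auto simp: G_def abs_mult)
  qed
  have Fb: "\<bar>F m x\<bar> \<le> real m * indicator (cball 0 (real m + 1)) x" for x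
    by (auto simp: F_def cl_def indicator_def)
  have ib: "integrable lebesgue (\<lambda>x. real m * indicator (cball 0 (real m + 1)) (x::real^'n))"
    by (rule integrable_indicator_cball)
  have "(\<lambda>n. LINT x|lebesgue. \<bar>F m x - G n x\<bar>) \<longlonglongrightarrow> (LINT x::real^'n|lebesgue. 0)"
  proof (rule integral_dominated_convergence[where w="\<lambda>x. 2 * (real m * indicator (cball 0 (real m + 1)) x)"])
    have "AE x in lebesgue. x \<notin> N"
      using N by (auto simp: negligible_iff_null_sets intro: AE_not_in)
    thus "AE x in lebesgue. (\<lambda>n. \<bar>F m x - G n x\<bar>) \<longlonglongrightarrow> 0"
    proof eventually_elim
      case (elim x)
      have "(\<lambda>n. \<bar>F m x - G n x\<bar>) \<longlonglongrightarrow> \<bar>F m x - cut x * cl m (F m x)\<bar>"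
        unfolding G_def cl_def by (intro tendsto_intros lim elim)
      moreover have "cut x * cl m (F m x) = F m x"
        by (auto simp: F_def cl_def cut_def indicator_def)
      ultimately show ?case by simp
    qed
    show "AE x in lebesgue. norm \<bar>F m x - G n x\<bar> \<le> 2 * (real m * indicator (cball 0 (real m + 1)) x)" for n
    proof (rule AE_I2)
      fix x show "norm \<bar>F m x - G n x\<bar> \<le> 2 * (real m * indicator (cball 0 (real m + 1)) x)"
        using Gb[of n x] Fb[of x] by simp
    qed
    have [measurable]: "G n \<in> borel_measurable lebesgue" for n
      by (rule borel_measurable_lebesgue_continuous[OF Gc])
    show "(\<lambda>x. \<bar>F m x - G n x\<bar>) \<in> borel_measurable lebesgue" for n by measurable
    show "integrable lebesgue (\<lambda>x. 2 * (real m * indicator (cball 0 (real m + 1)) (x::real^'n)))"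
      using ib by simp
  qed auto
  hence "\<forall>\<^sub>F n in sequentially. (LINT x|lebesgue. \<bar>F m x - G n x\<bar>) < e / 2"
    using e by (intro order_tendstoD) auto
  then obtain n where n: "(LINT x|lebesgue. \<bar>F m x - G n x\<bar>) < e / 2"
    using eventually_happens'[OF sequentially_bot] by blast
  have Gi: "integrable lebesgue (G n)" by (rule integrable_lebesgue_compact_support[OF Gc G0])
  have "(LINT x|lebesgue. \<bar>f x - G n x\<bar>) \<le> (LINT x|lebesgue. \<bar>f x - F m x\<bar> + \<bar>F m x - G n x\<bar>)"
    by (rule integral_mono) (use f Fi Gi in auto)
  also have "\<dots> < e" using m n f Fi Gi by (subst Bochner_Integration.integral_add) auto
  finally show ?thesis using Gc[of n] G0[of _ n] by blast
qed

text \<open>The error is split through a continuous \<open>\<phi>\<close> of compact support.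
  Mollification does not increase the \<open>L^1\<close> norm of \<open>f - \<phi>\<close>, and for
  \<open>\<phi>\<close> itself uniform continuity gives a uniform error supported in a ball of
  radius \<open>R + 1\<close>.\<close>

lemma conv_mollifier_tendsto_L1:
  fixes f :: "real^'n \<Rightarrow> real"
  assumes f: "integrable lebesgue f" and e: "e > 0"
  shows "\<exists>d>0. \<forall>h. 0 < h \<and> h < d \<longrightarrow> (LINT x|lebesgue. \<bar>conv f (mollifier h) x - f x\<bar>) < e"
proof -
  obtain \<phi> R where c: "continuous_on UNIV \<phi>" and R: "\<And>x. norm x > R \<Longrightarrow> \<phi> x = 0"
    and l: "(LINT x|lebesgue. \<bar>f x - \<phi> x\<bar>) < e / 3"
    using L1_approx_continuous[OF f, of "e/3"] e by auto
  have \<phi>i: "integrable lebesgue \<phi>" by (rule integrable_lebesgue_compact_support[OF c R])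
  let ?A = "cball 0 (R + 1) :: (real^'n) set"
  define C where "C = measure lebesgue ?A + 1"
  have C: "C > 0" "measure lebesgue ?A < C" unfolding C_def by (auto intro: add_nonneg_pos)
  have "uniformly_continuous_on UNIV \<phi>" by (rule compact_support_uniformly_continuous[OF c R])
  then obtain d where d: "d > 0" "\<And>x y. dist y x < d \<Longrightarrow> dist (\<phi> y) (\<phi> x) < e / (3 * C)"
    using e C(1) unfolding uniformly_continuous_on_def
    by (metis UNIV_I divide_pos_pos mult_pos_pos zero_less_numeral)
  have "(LINT x|lebesgue. \<bar>conv f (mollifier h) x - f x\<bar>) < e" if h: "0 < h" "h < min d 1" for h
  proof -
    let ?m = "mollifier h"
    note ci = conv_mollifier_L1[OF f h(1)] conv_mollifier_L1[OF \<phi>i h(1)]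
    have bd: "\<bar>conv \<phi> ?m x - \<phi> x\<bar> \<le> e / (3 * C) * indicator ?A x" for x
    proof (cases "norm x \<le> R + 1")
      case True
      have "\<bar>conv \<phi> ?m x - \<phi> x\<bar> \<le> e / (3 * C)"
        by (rule conv_mollifier_close[OF \<phi>i h(1)]) (use d(2)[of _ x] h in \<open>simp add: dist_real_def less_imp_le\<close>)
      thus ?thesis using True by simp
    next
      case False
      have "\<phi> y = 0" if "dist y x < h" for y
        using R[of y] that False h norm_triangle_sub[of x y] by (simp add: dist_norm norm_minus_commute)
      hence "conv \<phi> ?m x = 0" by (rule conv_mollifier_eq_0[OF h(1)])
      moreover have "\<phi> x = 0" using R False by simp
      ultimately show ?thesis using False by simp
    qed
    have iA: "integrable lebesgue (\<lambda>x. e / (3 * C) * indicator ?A x)"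
      by (rule integrable_indicator_cball)
    have "(LINT x|lebesgue. \<bar>conv f ?m x - f x\<bar>) \<le>
       (LINT x|lebesgue. \<bar>conv (\<lambda>x. f x - \<phi> x) ?m x\<bar> + \<bar>conv \<phi> ?m x - \<phi> x\<bar> + \<bar>f x - \<phi> x\<bar>)"
    proof (rule integral_mono)
      show "integrable lebesgue (\<lambda>x. \<bar>conv (\<lambda>x. f x - \<phi> x) ?m x\<bar> + \<bar>conv \<phi> ?m x - \<phi> x\<bar> + \<bar>f x - \<phi> x\<bar>)"
        using conv_mollifier_L1(1)[of "\<lambda>x. f x - \<phi> x" h] f \<phi>i ci h by simp
    qed (use f ci conv_mollifier_diff[OF f \<phi>i h(1)] in auto)
    also have "\<dots> = (LINT x|lebesgue. \<bar>conv (\<lambda>x. f x - \<phi> x) ?m x\<bar>) + (LINT x|lebesgue. \<bar>conv \<phi> ?m x - \<phi> x\<bar>) + (LINT x|lebesgue. \<bar>f x - \<phi> x\<bar>)"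
      using conv_mollifier_L1(1)[of "\<lambda>x. f x - \<phi> x" h] f \<phi>i ci h
      by (subst Bochner_Integration.integral_add; simp)+
    also have "(LINT x|lebesgue. \<bar>conv \<phi> ?m x - \<phi> x\<bar>) \<le> (LINT x|lebesgue. e / (3 * C) * indicator ?A x)"
      by (rule integral_mono) (use bd iA ci \<phi>i in auto)
    also have "\<dots> = e / (3 * C) * measure lebesgue ?A" by simp
    also have "\<dots> \<le> e / (3 * C) * C" using C e by (intro mult_left_mono) auto
    also have "\<dots> = e / 3" using C by simp
    also have "(LINT x|lebesgue. \<bar>conv (\<lambda>x. f x - \<phi> x) ?m x\<bar>) \<le> (LINT x|lebesgue. \<bar>f x - \<phi> x\<bar>)"
      by (rule conv_mollifier_L1(2)) (use f \<phi>i h in auto)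
    finally show ?thesis using l by simp
  qed
  thus ?thesis using d(1) by (intro exI[of _ "min d 1"]) auto
qed

text \<open>The Riesz-Fischer argument: the geometric bounds make the sum of all absolute values
  integrable. That sum is the majorant, and its finiteness almost everywhere forces the terms to
  0.\<close>

lemma L1_summable_dominated:
  fixes f :: "nat \<Rightarrow> 'a \<Rightarrow> real"
  assumes f: "\<And>k. integrable M (f k)" and le: "\<And>k. (LINT x|M. \<bar>f k x\<bar>) \<le> (1/2) ^ k"
  shows "AE x in M. (\<lambda>k. f k x) \<longlonglongrightarrow> 0"
    "\<exists>G. integrable M G \<and> (\<forall>x. 0 \<le> G x) \<and> (AE x in M. \<forall>k. \<bar>f k x\<bar> \<le> G x)"
proof -
  note [measurable] = borel_measurable_integrable[OF f]
  let ?S = "\<lambda>x. \<Sum>k. ennreal \<bar>f k x\<bar>"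
  have "(\<integral>\<^sup>+x. ?S x \<partial>M) = (\<Sum>k. \<integral>\<^sup>+x. ennreal \<bar>f k x\<bar> \<partial>M)"
    by (rule nn_integral_suminf) simp
  also have "\<dots> = (\<Sum>k. ennreal (LINT x|M. \<bar>f k x\<bar>))"
  proof (rule suminf_cong)
    fix k show "(\<integral>\<^sup>+x. ennreal \<bar>f k x\<bar> \<partial>M) = ennreal (LINT x|M. \<bar>f k x\<bar>)"
      by (rule nn_integral_eq_integral) (use f in simp_all)
  qed
  also have "\<dots> \<le> (\<Sum>k. ennreal ((1/2) ^ k))"
    by (rule suminf_le[OF ennreal_leI[OF le]]) simp_all
  also have "\<dots> < \<infinity>"
  proof -
    have "(\<Sum>k. ennreal ((1/2) ^ k)) = ennreal (\<Sum>k. (1/2) ^ k)"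
      by (rule suminf_ennreal2) (simp_all add: summable_geometric)
    thus ?thesis by (simp only: infinity_ennreal_def ennreal_less_top)
  qed
  finally have fin: "(\<integral>\<^sup>+x. ?S x \<partial>M) < \<infinity>" .
  have ae: "AE x in M. ?S x \<noteq> \<infinity>"
    by (rule nn_integral_PInf_AE) (use fin in auto)
  have sm: "summable (\<lambda>k. \<bar>f k x\<bar>)" if "?S x \<noteq> \<infinity>" for x
    by (rule summable_suminf_not_top) (use that in simp_all)
  show "AE x in M. (\<lambda>k. f k x) \<longlonglongrightarrow> 0"
    using ae
  proof eventually_elim
    case (elim x)
    have "(\<lambda>k. \<bar>f k x\<bar>) \<longlonglongrightarrow> 0" by (rule summable_LIMSEQ_zero[OF sm[OF elim]])
    thus ?case by (rule tendsto_rabs_zero_cancel)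
  qed
  have eq: "AE x in M. ennreal (enn2real (?S x)) = ?S x"
    using ae by eventually_elim (rule ennreal_enn2real, simp add: less_top)
  have Gi: "integrable M (\<lambda>x. enn2real (?S x))"
  proof (rule integrableI_bounded)
    have "(\<integral>\<^sup>+x. ennreal (norm (enn2real (?S x))) \<partial>M) = (\<integral>\<^sup>+x. ?S x \<partial>M)"
      by (rule nn_integral_cong_AE) (use eq in simp)
    thus "(\<integral>\<^sup>+x. ennreal (norm (enn2real (?S x))) \<partial>M) < \<infinity>" using fin by simp
  qed measurable
  have "AE x in M. \<forall>k. \<bar>f k x\<bar> \<le> enn2real (?S x)"
    using ae
  proof eventually_elim
    case (elim x)
    show ?case
    proof
      fix k
      have single: "sum a {k} = a k" for a :: "nat \<Rightarrow> ennreal" by simp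
      have "(\<Sum>k\<in>{k}. ennreal \<bar>f k x\<bar>) \<le> ?S x"
        by (rule sum_le_suminf) (rule summableI, rule finite.intros, rule finite.intros, rule zero_le)
      hence "ennreal \<bar>f k x\<bar> \<le> ?S x" by (simp only: single)
      hence "enn2real (ennreal \<bar>f k x\<bar>) \<le> enn2real (?S x)"
        using elim by (intro enn2real_mono) (auto simp: less_top)
      thus "\<bar>f k x\<bar> \<le> enn2real (?S x)" by simp
    qed
  qed
  thus "\<exists>G. integrable M G \<and> (\<forall>x. 0 \<le> G x) \<and> (AE x in M. \<forall>k. \<bar>f k x\<bar> \<le> G x)"
    using Gi by (intro exI[of _ "\<lambda>x. enn2real (?S x)"] conjI allI enn2real_nonneg)
qed

lemma L1_subseq_dominated:
  fixes f :: "nat \<Rightarrow> 'a \<Rightarrow> real"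
  assumes f: "\<And>k. integrable M (f k)" and lim: "(\<lambda>k. LINT x|M. \<bar>f k x\<bar>) \<longlonglongrightarrow> 0"
  obtains s G where "strict_mono s" "AE x in M. (\<lambda>k. f (s k) x) \<longlonglongrightarrow> 0"
    "integrable M G" "\<And>x. 0 \<le> G x" "AE x in M. \<forall>k. \<bar>f (s k) x\<bar> \<le> G x"
proof -
  have "\<exists>N. \<forall>n\<ge>N. (LINT x|M. \<bar>f n x\<bar>) \<le> (1/2) ^ k" for k
  proof -
    have "\<forall>\<^sub>F n in sequentially. (LINT x|M. \<bar>f n x\<bar>) < (1/2) ^ k"
      by (rule order_tendstoD[OF lim]) simp
    thus ?thesis by (auto simp: eventually_sequentially intro: less_imp_le)
  qed
  then obtain N where N: "\<And>k n. n \<ge> N k \<Longrightarrow> (LINT x|M. \<bar>f n x\<bar>) \<le> (1/2) ^ k" by metis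
  define s where "s = rec_nat (N 0) (\<lambda>k r. max (Suc r) (N (Suc k)))"
  have s: "strict_mono s" "\<And>k. s k \<ge> N k"
  proof -
    show "strict_mono s" by (rule strict_mono_Suc_iff[THEN iffD2]) (simp add: s_def max_def)
    show "s k \<ge> N k" for k by (cases k) (simp_all add: s_def)
  qed
  have "\<And>k. (LINT x|M. \<bar>f (s k) x\<bar>) \<le> (1/2) ^ k" using N s(2) by blast
  from L1_summable_dominated[OF f this] that s(1) show ?thesis by blast
qed

text \<open>The functions, the components of their gradients and the majorants meet in the same
  limit, so one sequence of radii has to serve all of them. Finiteness of \<open>F\<close> makes the
  smallest of the individual thresholds positive.\<close>

lemma mollifier_sequence:
  fixes F :: "(real^'n \<Rightarrow> real) set"
  assumes "finite F" "\<And>f. f \<in> F \<Longrightarrow> integrable lebesgue f" "d > 0"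
  obtains h where "\<And>k. 0 < h k" "\<And>k. h k < d"
    "\<And>f. f \<in> F \<Longrightarrow> AE x in lebesgue. (\<lambda>k. conv f (mollifier (h k)) x) \<longlonglongrightarrow> f x"
    "\<And>f. f \<in> F \<Longrightarrow> \<exists>G. integrable lebesgue G \<and> (\<forall>x. 0 \<le> G x) \<and>
        (AE x in lebesgue. \<forall>k. \<bar>conv f (mollifier (h k)) x\<bar> \<le> G x)"
proof -
  have "\<exists>h. 0 < h \<and> h < d \<and>
      (\<forall>f\<in>F. (LINT x|lebesgue. \<bar>conv f (mollifier h) x - f x\<bar>) \<le> (1/2) ^ k)" for k
  proof -
    have "\<forall>f\<in>F. \<exists>d>0. \<forall>h. 0 < h \<and> h < d \<longrightarrow> (LINT x|lebesgue. \<bar>conv f (mollifier h) x - f x\<bar>) < (1/2) ^ k"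
      using assms(2) by (intro ballI conv_mollifier_tendsto_L1) auto
    then obtain e where e: "\<And>f. f \<in> F \<Longrightarrow> e f > 0"
      "\<And>f h. f \<in> F \<Longrightarrow> 0 < h \<Longrightarrow> h < e f \<Longrightarrow> (LINT x|lebesgue. \<bar>conv f (mollifier h) x - f x\<bar>) < (1/2) ^ k"
      by metis
    define m where "m = Min (insert d (e ` F))"
    have m: "m > 0" unfolding m_def using assms e by (subst Min_gr_iff) auto
    have m2: "m \<le> d" "\<And>f. f \<in> F \<Longrightarrow> m \<le> e f"
      unfolding m_def by (rule Min_le; use assms(1) in simp)+
    show ?thesis
    proof (intro exI[of _ "m / 2"] conjI ballI)
      fix f assume f: "f \<in> F"
      show "(LINT x|lebesgue. \<bar>conv f (mollifier (m/2)) x - f x\<bar>) \<le> (1/2) ^ k"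
        using e(2)[OF f, of "m/2"] m m2(2)[OF f] by simp
    qed (use m m2 in auto)
  qed
  then obtain h where h: "\<And>k. 0 < h k" "\<And>k. h k < d"
    "\<And>k f. f \<in> F \<Longrightarrow> (LINT x|lebesgue. \<bar>conv f (mollifier (h k)) x - f x\<bar>) \<le> (1/2) ^ k"
    by metis
  show ?thesis
  proof (rule that[of h])
    fix f assume f: "f \<in> F"
    have i: "integrable lebesgue (\<lambda>x. conv f (mollifier (h k)) x - f x)" for k
      using conv_mollifier_L1(1)[OF assms(2)[OF f] h(1)] assms(2)[OF f] by auto
    note d = L1_summable_dominated[OF i h(3)[OF f]]
    from d(1) show "AE x in lebesgue. (\<lambda>k. conv f (mollifier (h k)) x) \<longlonglongrightarrow> f x"
      by eventually_elim (use LIM_zero_iff in blast)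
    from d(2) obtain G where G: "integrable lebesgue G" "\<And>x. 0 \<le> G x"
      "AE x in lebesgue. \<forall>k. \<bar>conv f (mollifier (h k)) x - f x\<bar> \<le> G x" by blast
    have "AE x in lebesgue. \<forall>k. \<bar>conv f (mollifier (h k)) x\<bar> \<le> G x + \<bar>f x\<bar>"
      using G(3)
    proof eventually_elim
      case (elim x)
      show ?case
      proof
        fix k show "\<bar>conv f (mollifier (h k)) x\<bar> \<le> G x + \<bar>f x\<bar>"
          using elim[rule_format, of k] by linarith
      qed
    qed
    thus "\<exists>G. integrable lebesgue G \<and> (\<forall>x. 0 \<le> G x) \<and>
        (AE x in lebesgue. \<forall>k. \<bar>conv f (mollifier (h k)) x\<bar> \<le> G x)"
      using G assms(2)[OF f] by (intro exI[of _ "\<lambda>x. G x + \<bar>f x\<bar>"]) auto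
  qed (use h in auto)
qed

lemma powr_above_tangent:
  fixes a m p :: real
  assumes "p \<ge> 1" "a \<ge> 0" "m > 0"
  shows "m powr p + p * m powr (p - 1) * (a - m) \<le> a powr p"
proof (cases "a = 0")
  \<comment> \<open>Here \<open>a\<close> lies outside the open half-line on which the tangent lemma
    is applied; the claim reduces to \<open>(1 - p) * m powr p \<le> 0\<close>.\<close>
  case True
  have "m powr p = m powr (p - 1) * m" using assms by (simp add: powr_diff)
  moreover have "0 \<le> (p - 1) * (m powr (p - 1) * m)" using assms by simp
  ultimately show ?thesis using True assms by (simp add: algebra_simps)
next
  case False
  have "(p * m powr (p - 1)) * (a - m) \<le> a powr p - m powr p"
  proof (rule convex_on_imp_above_tangent[OF powr_convex[OF assms(1)], of m a])
    show "((\<lambda>x. x powr p) has_real_derivative p * m powr (p - 1)) (at m within {0<..})"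
      by (rule has_field_derivative_at_within, rule has_real_derivative_powr) (use assms in simp)
  qed (use assms False in \<open>auto simp: interior_open\<close>)
  thus ?thesis by (simp add: algebra_simps)
qed

text \<open>Jensen's inequality for the probability density \<open>mollifier h (x - y)\<close>. The
  tangent of the power at the mean \<open>?m\<close> is integrated, and its linear part averages to
  zero.\<close>

lemma conv_mollifier_powr:
  fixes g :: "real^'n \<Rightarrow> real"
  assumes g: "integrable lebesgue g" "\<And>x. 0 \<le> g x" and gp: "integrable lebesgue (\<lambda>x. g x powr p)"
    and p: "p \<ge> 1" and h: "h > 0"
  shows "(conv g (mollifier h) x) powr p \<le> conv (\<lambda>x. g x powr p) (mollifier h) x"
proof -
  let ?m = "conv g (mollifier h) x"
  have m: "?m \<ge> 0" by (rule conv_mollifier_ge[OF g(1) h]) (use g in auto)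
  show ?thesis
  proof (cases "?m = 0")
    case True
    have "0 \<le> conv (\<lambda>x. g x powr p) (mollifier h) x" by (rule conv_mollifier_ge[OF gp h]) auto
    thus ?thesis using True by simp
  next
    case False
    hence m: "?m > 0" using m by simp
    let ?c = "p * ?m powr (p - 1)"
    let ?r = "\<lambda>y. mollifier h (x - y)"
    have "?m powr p = (?m powr p - ?c * ?m) * (LINT y|lebesgue. ?r y) + ?c * (LINT y|lebesgue. g y * ?r y)"
      using mollifier_shift_integral[OF h, of x] by (simp add: conv_def[symmetric])
    also have "\<dots> = (LINT y|lebesgue. (?m powr p - ?c * ?m) * ?r y + ?c * (g y * ?r y))"
      using mollifier_shift_integral(1)[OF h, of x] integrable_conv_mollifier[OF g(1) h, of x]
      by (subst Bochner_Integration.integral_add) auto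
    also have "\<dots> \<le> (LINT y|lebesgue. g y powr p * ?r y)"
    proof (rule integral_mono)
      show "integrable lebesgue (\<lambda>y. (?m powr p - ?c * ?m) * ?r y + ?c * (g y * ?r y))"
        using mollifier_shift_integral(1)[OF h, of x] integrable_conv_mollifier[OF g(1) h, of x] by auto
      show "integrable lebesgue (\<lambda>y. g y powr p * ?r y)" using integrable_conv_mollifier[OF gp h, of x] by simp
      show "(?m powr p - ?c * ?m) * ?r y + ?c * (g y * ?r y) \<le> g y powr p * ?r y" for y
        using mult_right_mono[OF powr_above_tangent[OF p g(2)[of y] m] mollifier_nonneg[OF h, of "x - y"]]
        by (simp add: algebra_simps)
    qed
    finally show ?thesis by (simp add: conv_def)
  qed
qed

lemma LINT_set_support:
  assumes "\<And>x. x \<notin> A \<Longrightarrow> f x = 0"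
  shows "(LINT x:A|M. f x) = (LINT x|M. f x)"
proof -
  have "(\<lambda>x. indicator A x *\<^sub>R f x) = f" using assms by (force simp: indicator_def)
  thus ?thesis by (simp add: set_lebesgue_integral_def)
qed

text \<open>By translation invariance every difference quotient has integral zero. The steps
  \<open>t n\<close> are at most 1, so all quotients are bounded by \<open>B\<close> on the ball of
  radius \<open>R + 1\<close> and vanish outside it.\<close>

lemma integral_partial_eq_0:
  fixes \<phi> :: "real^'n \<Rightarrow> real"
  assumes g: "has_grad \<phi> D" and D: "continuous_on UNIV D" and R: "\<And>x. norm x > R \<Longrightarrow> \<phi> x = 0"
  shows "(LINT x|lebesgue. D x $ i) = 0"
proof -
  define t where "t n = 1 / real (Suc n)" for n
  have t: "0 < t n" "t n \<le> 1" for n by (auto simp: t_def)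
  have t0: "t \<longlonglongrightarrow> 0" unfolding t_def by (rule lim_1_over_n[THEN LIMSEQ_Suc])
  let ?e = "axis i 1 :: real^'n"
  define Q where "Q n x = (\<phi> (t n *\<^sub>R ?e + x) - \<phi> x) / t n" for n x
  have \<phi>c: "continuous_on UNIV \<phi>" by (rule has_grad_continuous[OF g])
  have \<phi>i: "integrable lborel \<phi>" by (rule integrable_lborel_compact_support[OF \<phi>c R])
  have [measurable]: "\<phi> \<in> borel_measurable borel" by (rule borel_measurable_continuous_onI[OF \<phi>c])
  have DR: "norm x > R \<Longrightarrow> D x = 0" for x using has_grad_eq_0_outside[OF g R] by blast
  obtain B where B: "\<And>x. norm (D x) \<le> B" using compact_support_bounded[OF D, of R] DR by auto
  have tr: "integrable lborel (\<lambda>x. \<phi> (c + x))" "(LINT x|lborel. \<phi> (c + x)) = (LINT x|lborel. \<phi> x)" for c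
  proof -
    show "integrable lborel (\<lambda>x. \<phi> (c + x))"
      using \<phi>i by (subst (asm) lborel_distr_plus[of c, symmetric]) (simp add: integrable_distr_eq)
    show "(LINT x|lborel. \<phi> (c + x)) = (LINT x|lborel. \<phi> x)"
      by (subst (2) lborel_distr_plus[of c, symmetric]) (simp add: integral_distr)
  qed
  have Q0: "(LINT x|lborel. Q n x) = 0" for n
    unfolding Q_def using tr[of "t n *\<^sub>R ?e"] \<phi>i by simp
  have "(\<lambda>n. LINT x|lborel. Q n x) \<longlonglongrightarrow> (LINT x|lborel. D x $ i)"
  proof (rule integral_dominated_convergence[where w="\<lambda>x. B * indicator (cball 0 (R + 1)) x"])
    show "(\<lambda>x. D x $ i) \<in> borel_measurable lborel"
      using borel_measurable_continuous_onI[of "\<lambda>x. D x $ i"] by (auto intro!: continuous_intros D)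
    show "Q n \<in> borel_measurable lborel" for n unfolding Q_def by measurable
    show "integrable lborel (\<lambda>x. B * indicator (cball 0 (R + 1)) (x::real^'n))"
      using integrable_indicator_cball[of B 0 "R+1"]
      by (subst (asm) integrable_completion) (auto intro!: borel_measurable_times borel_measurable_indicator)
    show "AE x in lborel. (\<lambda>n. Q n x) \<longlonglongrightarrow> D x $ i"
    proof (rule AE_I2)
      fix x
      have "((\<lambda>s. \<phi> (s *\<^sub>R ?e + x)) has_derivative (\<lambda>s. D x \<bullet> (s *\<^sub>R ?e))) (at 0)"
        by (rule has_derivative_compose[of "\<lambda>s. s *\<^sub>R ?e + x" "\<lambda>s. s *\<^sub>R ?e" 0 UNIV \<phi>])
           (auto intro!: derivative_eq_intros has_gradD[OF g, simplified])
      hence "((\<lambda>s. \<phi> (s *\<^sub>R ?e + x)) has_real_derivative D x $ i) (at 0)"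
        unfolding has_field_derivative_def
        by (rule has_derivative_eq_rhs) (simp add: inner_axis mult.commute fun_eq_iff)
      hence "((\<lambda>s. (\<phi> (s *\<^sub>R ?e + x) - \<phi> x) / s) \<longlongrightarrow> D x $ i) (at 0)"
        by (simp add: DERIV_def)
      moreover have "filterlim t (at 0) sequentially"
        using t0 t(1) by (auto simp: filterlim_at intro!: always_eventually less_imp_neq[symmetric])
      ultimately show "(\<lambda>n. Q n x) \<longlonglongrightarrow> D x $ i"
        unfolding Q_def by (rule filterlim_compose)
    qed
    show "AE x in lborel. norm (Q n x) \<le> B * indicator (cball 0 (R + 1)) x" for n
    proof (rule AE_I2)
      fix x
      show "norm (Q n x) \<le> B * indicator (cball 0 (R + 1)) x"
      proof (cases "norm x \<le> R + 1")
        case True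
        have "norm (\<phi> (t n *\<^sub>R ?e + x) - \<phi> x) \<le> B * norm (t n *\<^sub>R ?e + x - x)"
        proof (rule differentiable_bound[of UNIV \<phi> "\<lambda>x h. D x \<bullet> h"])
          show "onorm ((\<bullet>) (D y)) \<le> B" for y
          proof (rule onorm_le)
            fix h show "norm (D y \<bullet> h) \<le> B * norm h"
              using Cauchy_Schwarz_ineq2[of "D y" h] mult_right_mono[OF B[of y] norm_ge_zero[of h]] by simp
          qed
        qed (use has_gradD[OF g] in auto)
        hence "norm (Q n x) \<le> B" using t[of n] by (simp add: Q_def field_simps)
        thus ?thesis using True by simp
      next
        case False
        have "norm x \<le> norm (t n *\<^sub>R ?e + x) + norm (t n *\<^sub>R ?e)"
          using norm_triangle_ineq4[of "t n *\<^sub>R ?e + x" "t n *\<^sub>R ?e"] by simp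
        hence "norm (t n *\<^sub>R ?e + x) > R" using t[of n] False by simp
        thus ?thesis using R[of x] R[of "t n *\<^sub>R ?e + x"] False by (simp add: Q_def)
      qed
    qed
  qed
  hence "(LINT x|lborel. D x $ i) = 0"
    unfolding Q0 using LIMSEQ_unique tendsto_const by blast
  moreover have "(\<lambda>x. D x $ i) \<in> borel_measurable lborel"
    using borel_measurable_continuous_onI[of "\<lambda>x. D x $ i"] by (auto intro!: continuous_intros D)
  ultimately show ?thesis by (simp add: integral_completion)
qed

section \<open>Mollifying weakly differentiable functions\<close>

text \<open>Local integrability is phrased with the plain product
  \<open>indicator K x * f x\<close>, because these truncated functions are the ones that get
  mollified over the whole space.\<close>

definition loc_int :: "(real^'n) set \<Rightarrow> (real^'n \<Rightarrow> real) \<Rightarrow> bool" where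
  "loc_int \<Omega> f \<longleftrightarrow> f \<in> borel_measurable lebesgue \<and>
     (\<forall>K. compact K \<and> K \<subseteq> \<Omega> \<longrightarrow> integrable lebesgue (\<lambda>x. indicator K x * f x))"

lemma loc_intD:
  "loc_int \<Omega> f \<Longrightarrow> compact K \<Longrightarrow> K \<subseteq> \<Omega> \<Longrightarrow> integrable lebesgue (\<lambda>x. indicator K x * f x)"
  "loc_int \<Omega> f \<Longrightarrow> f \<in> borel_measurable lebesgue"
  by (auto simp: loc_int_def)

lemma compact_sets_lebesgue: "compact K \<Longrightarrow> K \<in> sets lebesgue"
  by (simp add: borel_compact)

lemma integrable_compact_const:
  fixes K :: "(real^'n) set"
  assumes "compact K"
  shows "integrable lebesgue (\<lambda>x. indicator K x * (c::real))"
proof -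
  have "emeasure lebesgue K < \<infinity>" using emeasure_compact_finite[OF assms] assms
    by (simp add: borel_compact)
  thus ?thesis using compact_sets_lebesgue[OF assms] by simp
qed

lemma loc_int_bound_local:
  assumes g: "loc_int \<Omega> g" and f: "f \<in> borel_measurable lebesgue"
    and le: "\<And>K. compact K \<Longrightarrow> K \<subseteq> \<Omega> \<Longrightarrow> \<exists>C. AE x in lebesgue. x \<in> K \<longrightarrow> \<bar>f x\<bar> \<le> C * g x"
  shows "loc_int \<Omega> f"
  unfolding loc_int_def
proof (intro conjI allI impI f)
  fix K assume K: "compact K \<and> K \<subseteq> \<Omega>"
  then obtain C where C: "AE x in lebesgue. x \<in> K \<longrightarrow> \<bar>f x\<bar> \<le> C * g x" using le by blast
  show "integrable lebesgue (\<lambda>x. indicator K x * f x)"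
  proof (rule Bochner_Integration.integrable_bound)
    show "integrable lebesgue (\<lambda>x. C * (indicator K x * g x))"
      by (intro integrable_mult_right loc_intD(1)[OF g]) (use K in auto)
    show "AE x in lebesgue. norm (indicator K x * f x) \<le> norm (C * (indicator K x * g x))"
      using C by (auto simp: indicator_def elim!: eventually_mono)
    show "(\<lambda>x. indicator K x * f x) \<in> borel_measurable lebesgue"
      using K compact_sets_lebesgue[of K] by (intro borel_measurable_times f borel_measurable_indicator) auto
  qed
qed

lemma loc_int_bound:
  assumes "loc_int \<Omega> g" "f \<in> borel_measurable lebesgue"
    and "\<And>K. compact K \<Longrightarrow> K \<subseteq> \<Omega> \<Longrightarrow> AE x in lebesgue. x \<in> K \<longrightarrow> \<bar>f x\<bar> \<le> g x"
  shows "loc_int \<Omega> f"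
  by (rule loc_int_bound_local[OF assms(1,2)], rule exI[of _ 1]) (simp add: assms(3))

text \<open>Mollifications of a C1 function of compact support are smooth test functions. Together
  with their gradients they converge pointwise, under uniform bounds and with supports in one
  compact \<open>K\<close>, on which \<open>X\<close> and \<open>b\<close> are integrable.\<close>

lemma weak_ineq_C1:
  fixes X :: "real^'n \<Rightarrow> real^'n"
  assumes \<Omega>: "open \<Omega>" and X: "X \<in> borel_measurable lebesgue" "loc_int \<Omega> (\<lambda>x. norm (X x))" and b: "loc_int \<Omega> b"
    and ineq: "\<And>\<phi>. test_fun \<Omega> \<phi> \<Longrightarrow> (\<And>x. 0 \<le> \<phi> x) \<Longrightarrow>
       (LINT x:\<Omega>|lebesgue. X x \<bullet> grad \<phi> x) \<le> (LINT x:\<Omega>|lebesgue. b x * \<phi> x)"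
    and g: "has_grad \<phi> D" and D: "continuous_on UNIV D" and c: "compact (tsupp \<phi>)" "tsupp \<phi> \<subseteq> \<Omega>" and nn: "\<And>x. 0 \<le> \<phi> x"
  shows "(LINT x:\<Omega>|lebesgue. X x \<bullet> D x) \<le> (LINT x:\<Omega>|lebesgue. b x * \<phi> x)"
proof -
  obtain d where d: "d > 0" "(\<Union>x\<in>tsupp \<phi>. cball x d) \<subseteq> \<Omega>"
    using compact_subset_open_imp_cball_epsilon_subset[OF c(1) \<Omega> c(2)] by blast
  define K where "K = (\<Union>x\<in>tsupp \<phi>. cball x d)"
  have K: "compact K" "K \<subseteq> \<Omega>" unfolding K_def using compact_minkowski_sum_cball[OF c(1)] d(2) by auto
  note Km = compact_sets_lebesgue[OF K(1)]
  \<comment> \<open>Counting from 2 keeps the first radius strictly below \<open>d\<close>.\<close>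
  define h where "h n = d / real (Suc (Suc n))" for n
  have h: "0 < h n" "h n < d" for n using d(1) by (auto simp: h_def field_simps intro: add_pos_nonneg)
  have h0: "h \<longlonglongrightarrow> 0"
  proof -
    have "(\<lambda>n. d * (1 / real (Suc (Suc n)))) \<longlonglongrightarrow> d * 0"
      by (intro tendsto_intros LIMSEQ_Suc lim_1_over_n)
    thus ?thesis by (simp add: h_def[abs_def])
  qed
  obtain R where R: "\<And>x. norm x > R \<Longrightarrow> \<phi> x = 0" using c(1) compact_tsupp_iff by blast
  have DR: "norm x > R \<Longrightarrow> D x = 0" for x using has_grad_eq_0_outside[OF g R] by blast
  have \<phi>c: "continuous_on UNIV \<phi>" by (rule has_grad_continuous[OF g])
  have \<phi>i: "integrable lebesgue \<phi>" by (rule integrable_lebesgue_compact_support[OF \<phi>c R])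
  have Dci: "continuous_on UNIV (\<lambda>x. D x $ i)" for i by (intro continuous_intros D)
  have Dii: "integrable lebesgue (\<lambda>x. D x $ i)" for i
    by (rule integrable_lebesgue_compact_support[OF Dci, of R]) (simp add: DR)
  define P where "P n = conv \<phi> (mollifier (h n))" for n
  define G where "G n x = (\<chi> i. conv (\<lambda>x. D x $ i) (mollifier (h n)) x)" for n x
  \<comment> \<open>The factors are exchanged so that \<open>\<phi>\<close> is the differentiated
    one: the gradient of the mollification is then the mollification of \<open>D\<close>, and not a
    convolution with the gradient of the mollifier.\<close>
  have PG: "has_grad (P n) (G n)" for n
  proof -
    have "conv \<phi> (mollifier (h n)) = conv (mollifier (h n)) \<phi>"
      by (rule conv_commute[OF \<phi>c continuous_on_mollifier])
    moreover have "conv (\<lambda>x. D x $ i) (mollifier (h n)) = conv (mollifier (h n)) (\<lambda>x. D x $ i)" for i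
      by (rule conv_commute[OF Dci continuous_on_mollifier])
    moreover have "integrable lebesgue (mollifier (h n) :: real^'n \<Rightarrow> real)"
      by (rule integrable_lebesgue_compact_support[OF continuous_on_mollifier, of "h n"]) (simp add: mollifier_eq_0[OF h(1)])
    ultimately show ?thesis unfolding P_def G_def using conv_has_grad[OF _ g D R] by simp
  qed
  have off: "P n x = 0" "G n x = 0" if "x \<notin> K" for n x
  proof -
    have "y \<notin> tsupp \<phi>" if "dist y x < h n" for y
      using that \<open>x \<notin> K\<close> h(2)[of n] by (force simp: K_def)
    hence "dist y x < h n \<Longrightarrow> \<phi> y = 0" "dist y x < h n \<Longrightarrow> D y = 0" for y
      using tsupp_eq_0 has_grad_eq_0_tsupp[OF g] by blast+
    thus "P n x = 0" "G n x = 0" unfolding P_def G_def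
      by (auto intro!: conv_mollifier_eq_0[OF h(1)] simp: vec_eq_iff)
  qed
  have off0: "\<phi> x = 0" "D x = 0" if "x \<notin> K" for x
  proof -
    have "x \<notin> tsupp \<phi>" using that d(1) by (force simp: K_def)
    thus "\<phi> x = 0" "D x = 0" using tsupp_eq_0 has_grad_eq_0_tsupp[OF g] by blast+
  qed
  have test: "test_fun \<Omega> (P n)" for n
  proof -
    have "smooth_on UNIV (P n)" unfolding P_def
      by (rule smooth_on_conv[OF \<phi>i smooth_on_mollifier, of "h n"]) (simp add: mollifier_eq_0[OF h(1)])
    moreover have "tsupp (P n) \<subseteq> K"
      by (rule tsupp_subset_closed[OF compact_imp_closed[OF K(1)] off(1)])
    ultimately show ?thesis using K compact_tsupp_subset unfolding test_fun_def by blast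
  qed
  have Pnn: "0 \<le> P n x" for n x unfolding P_def
    by (rule conv_mollifier_ge[OF \<phi>i h(1)]) (use nn in auto)
  have le: "(LINT x|lebesgue. X x \<bullet> G n x) \<le> (LINT x|lebesgue. b x * P n x)" for n
  proof -
    have 1: "x \<notin> \<Omega> \<Longrightarrow> X x \<bullet> G n x = 0" "x \<notin> \<Omega> \<Longrightarrow> b x * P n x = 0" for x
      using off[of x n] K(2) by (metis inner_zero_right subsetD, metis mult_zero_right subsetD)
    show ?thesis using ineq[OF test Pnn, of n] has_grad_grad[OF PG[of n]] LINT_set_support[of \<Omega>, OF 1(1)] LINT_set_support[of \<Omega>, OF 1(2)]
      by simp
  qed
  obtain B where B: "\<And>x. \<bar>\<phi> x\<bar> \<le> B" using compact_support_bounded[OF \<phi>c, of R] R by auto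
  obtain B' where B': "\<And>x. norm (D x) \<le> B'" using compact_support_bounded[OF D, of R] DR by auto
  have conv_lim: "(\<lambda>n. conv f (mollifier (h n)) x) \<longlonglongrightarrow> f x"
    if f: "integrable lebesgue f" "continuous_on UNIV f" for f :: "real^'n \<Rightarrow> real" and x
  proof (rule LIMSEQ_I)
    fix r :: real assume r: "r > 0"
    have "isCont f x" using f(2) by (simp add: continuous_on_eq_continuous_at)
    then obtain e where e: "e > 0" "\<And>y. dist y x < e \<Longrightarrow> \<bar>f y - f x\<bar> < r / 2"
      using r unfolding continuous_at_eps_delta dist_real_def by (metis half_gt_zero)
    have "\<forall>\<^sub>F n in sequentially. h n < e" using order_tendstoD(2)[OF h0 e(1)] .
    then obtain N where N: "\<And>n. n \<ge> N \<Longrightarrow> h n < e" by (auto simp: eventually_sequentially)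
    have "norm (conv f (mollifier (h n)) x - f x) < r" if "n \<ge> N" for n
    proof -
      have "\<bar>conv f (mollifier (h n)) x - f x\<bar> \<le> r / 2"
        by (rule conv_mollifier_close[OF f(1) h(1)])
           (use N[OF that] e(2) in \<open>meson less_imp_le less_trans\<close>)
      thus ?thesis using r by simp
    qed
    thus "\<exists>no. \<forall>n\<ge>no. norm (conv f (mollifier (h n)) x - f x) < r" by blast
  qed
  have conv_bd: "\<bar>conv f (mollifier (h n)) x\<bar> \<le> B"
    if f: "integrable lebesgue f" "\<And>x. \<bar>f x\<bar> \<le> B" for f :: "real^'n \<Rightarrow> real" and x B n
  proof -
    have "-B \<le> conv f (mollifier (h n)) x"
      by (rule conv_mollifier_ge[OF f(1) h(1)]) (use f(2) in \<open>auto intro!: AE_I2 simp: abs_le_iff minus_le_iff\<close>)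
    moreover have "-B \<le> conv (\<lambda>x. - f x) (mollifier (h n)) x"
      by (rule conv_mollifier_ge[OF _ h(1)]) (use f in \<open>auto intro!: AE_I2 simp: abs_le_iff minus_le_iff\<close>)
    moreover have "conv (\<lambda>x. - f x) (mollifier (h n)) x = - conv f (mollifier (h n)) x"
      by (simp add: conv_def)
    ultimately show ?thesis by simp
  qed
  have Gb: "norm (G n x) \<le> real CARD('n) * B'" for n x
  proof -
    have "norm (G n x) \<le> (\<Sum>i\<in>UNIV. \<bar>G n x $ i\<bar>)" by (rule norm_le_l1_cart)
    also have "\<dots> \<le> (\<Sum>i\<in>(UNIV::'n set). B')"
    proof (rule sum_mono)
      fix i show "\<bar>G n x $ i\<bar> \<le> B'" unfolding G_def vec_lambda_beta
        by (rule conv_bd[OF Dii]) (use component_le_norm_cart B' order_trans in blast)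
    qed
    finally show ?thesis by simp
  qed
  have Gm: "G n \<in> borel_measurable lebesgue" for n
    by (rule borel_measurable_lebesgue_continuous)
       (auto simp: G_def intro!: continuous_on_vec_lambda continuous_on_conv_mollifier[OF Dii h(1)])
  have Pm: "P n \<in> borel_measurable lebesgue" for n
    by (rule borel_measurable_lebesgue_continuous[OF has_grad_continuous[OF PG]])
  note Dm = borel_measurable_lebesgue_continuous[OF D]
  note \<phi>m = borel_measurable_lebesgue_continuous[OF \<phi>c]
  note bm = loc_intD(2)[OF b]
  have l1: "(\<lambda>n. LINT x|lebesgue. X x \<bullet> G n x) \<longlonglongrightarrow> (LINT x|lebesgue. X x \<bullet> D x)"
  proof (rule integral_dominated_convergence[where w="\<lambda>x. (indicator K x * norm (X x)) * (real CARD('n) * B')"])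
    show "AE x in lebesgue. (\<lambda>n. X x \<bullet> G n x) \<longlonglongrightarrow> X x \<bullet> D x"
    proof (rule AE_I2, intro tendsto_intros)
      fix x show "(\<lambda>n. G n x) \<longlonglongrightarrow> D x"
        by (rule vec_tendstoI) (simp add: G_def conv_lim[OF Dii Dci])
    qed
    show "AE x in lebesgue. norm (X x \<bullet> G n x) \<le> (indicator K x * norm (X x)) * (real CARD('n) * B')" for n
    proof (rule AE_I2)
      fix x show "norm (X x \<bullet> G n x) \<le> (indicator K x * norm (X x)) * (real CARD('n) * B')"
        using off[of x n] Cauchy_Schwarz_ineq2[of "X x" "G n x"] mult_left_mono[OF Gb[of n x] norm_ge_zero[of "X x"]]
        by (cases "x \<in> K") auto
    qed
    show "integrable lebesgue (\<lambda>x. (indicator K x * norm (X x)) * (real CARD('n) * B'))"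
      using loc_intD(1)[OF X(2) K] by simp
  qed (use X(1) Gm Dm in measurable)
  have l2: "(\<lambda>n. LINT x|lebesgue. b x * P n x) \<longlonglongrightarrow> (LINT x|lebesgue. b x * \<phi> x)"
  proof (rule integral_dominated_convergence[where w="\<lambda>x. \<bar>indicator K x * b x\<bar> * B"])
    show "AE x in lebesgue. (\<lambda>n. b x * P n x) \<longlonglongrightarrow> b x * \<phi> x"
      by (rule AE_I2, intro tendsto_intros) (simp add: P_def conv_lim[OF \<phi>i \<phi>c])
    show "AE x in lebesgue. norm (b x * P n x) \<le> \<bar>indicator K x * b x\<bar> * B" for n
    proof (rule AE_I2)
      fix x
      have "\<bar>P n x\<bar> \<le> B" unfolding P_def by (rule conv_bd[OF \<phi>i B])
      thus "norm (b x * P n x) \<le> \<bar>indicator K x * b x\<bar> * B"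
        using off[of x n] by (cases "x \<in> K") (auto simp: abs_mult intro: mult_left_mono)
    qed
    show "integrable lebesgue (\<lambda>x. \<bar>indicator K x * b x\<bar> * B)"
      using loc_intD(1)[OF b K] by simp
  qed (use bm Pm \<phi>m in measurable)
  have "(LINT x|lebesgue. X x \<bullet> D x) \<le> (LINT x|lebesgue. b x * \<phi> x)"
    by (rule LIMSEQ_le[OF l1 l2]) (use le in auto)
  moreover have "x \<notin> \<Omega> \<Longrightarrow> X x \<bullet> D x = 0" "x \<notin> \<Omega> \<Longrightarrow> b x * \<phi> x = 0" for x
    using off0[of x] K(2) by (metis inner_zero_right subsetD, metis mult_zero_right subsetD)
  ultimately show ?thesis by (subst (1 2) LINT_set_support) auto
qed

text \<open>
  The functions whose mollifications have to converge and to be dominated along a common sequence of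
  radii.  The member \<open>norm (g x) powr p\<close> dominates the \<open>p\<close>-th powers of the mollified gradients by
  Jensen's inequality.
\<close>

definition loc_family :: "(real^'n) set \<Rightarrow> (real^'n \<Rightarrow> real) \<Rightarrow> (real^'n \<Rightarrow> real^'n) \<Rightarrow> real \<Rightarrow> (real^'n \<Rightarrow> real) set" where
  "loc_family K u g p = {\<lambda>x. indicator K x * u x, \<lambda>x. indicator K x * norm (g x) powr p} \<union>
     range (\<lambda>i x. indicator K x * g x $ i)"

lemma finite_loc_family: "finite (loc_family K u g p)"
  by (simp add: loc_family_def)

lemma test_fun_mollifier_shift:
  fixes x :: "real^'n"
  assumes h: "h > 0"
  shows "y \<notin> cball x h \<Longrightarrow> mollifier h (y - x) = 0"
    and "cball x h \<subseteq> \<Omega> \<Longrightarrow> test_fun \<Omega> (\<lambda>y. mollifier h (y - x))"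
    and "y \<notin> cball x h \<Longrightarrow> grad (\<lambda>y. mollifier h (y - x)) y = 0"
proof -
  show z: "mollifier h (y - x) = 0" if "y \<notin> cball x h" for y
    using that mollifier_eq_0[OF h, of "y - x"] by (simp add: dist_norm norm_minus_commute)
  have ts: "tsupp (\<lambda>y. mollifier h (y - x)) \<subseteq> cball x h" by (rule tsupp_subset_closed[OF closed_cball z])
  show "test_fun \<Omega> (\<lambda>y. mollifier h (y - x))" if "cball x h \<subseteq> \<Omega>"
    using that ts compact_tsupp_subset[OF compact_cball ts] smooth_on_mollifier_shift[of h x]
    unfolding test_fun_def by blast
  show "y \<notin> cball x h \<Longrightarrow> grad (\<lambda>y. mollifier h (y - x)) y = 0"
    using has_grad_eq_0_tsupp[OF smooth_on_has_grad(1)[OF smooth_on_mollifier_shift]] ts by blast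
qed

text \<open>The weak identity is tested with the mollifier centred at \<open>x\<close>. The minus
  sign of integration by parts cancels against the oddness of the gradient of the even mollifier,
  and the ball condition makes the factor \<open>indicator K\<close> invisible.\<close>

lemma weak_grad_conv:
  fixes u :: "real^'n \<Rightarrow> real"
  assumes wg: "weak_grad \<Omega> u g" and K: "compact K" "K \<subseteq> \<Omega>" and x: "cball x h \<subseteq> K" and h: "h > 0"
  shows "conv (\<lambda>x. indicator K x * u x) (\<lambda>y. grad (mollifier h) y $ i) x = conv (\<lambda>x. indicator K x * g x $ i) (mollifier h) x"
proof -
  let ?\<phi> = "\<lambda>y. mollifier h (y - x)"
  have test: "test_fun \<Omega> ?\<phi>" by (rule test_fun_mollifier_shift(2)[OF h]) (use x K in blast)
  note gm = smooth_on_has_grad[OF smooth_on_mollifier, of h]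
  have "has_grad ?\<phi> (\<lambda>y. grad (mollifier h) (y - x))"
    unfolding has_grad_def
  proof
    fix y show "(?\<phi> has_derivative (\<bullet>) (grad (mollifier h) (y - x))) (at y)"
      using has_derivative_compose[of "\<lambda>y. y - x" "\<lambda>h. h" y UNIV "mollifier h" "(\<bullet>) (grad (mollifier h) (y - x))"]
        has_gradD[OF gm(1), of "y - x"]
        has_derivative_diff[OF has_derivative_ident has_derivative_const, of x "at y"]
      by simp
  qed
  from has_grad_grad[OF this] have gr: "grad ?\<phi> y = grad (mollifier h) (y - x)" for y by metis
  have odd: "grad (mollifier h) (- y) = - grad (mollifier h) y" for y :: "real^'n"
  proof -
    have "has_grad (\<lambda>y::real^'n. mollifier h (- y)) (\<lambda>y. - grad (mollifier h) (- y))"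
      unfolding has_grad_def
    proof
      fix y :: "real^'n"
      have "((\<lambda>y. mollifier h (- y)) has_derivative (\<lambda>k. grad (mollifier h) (- y) \<bullet> (- k))) (at y)"
        by (rule has_derivative_compose[OF has_derivative_minus[OF has_derivative_ident]])
           (rule has_gradD[OF gm(1)])
      moreover have "(\<lambda>k. grad (mollifier h) (- y) \<bullet> (- k)) = (\<bullet>) (- grad (mollifier h) (- y))"
        by (simp add: fun_eq_iff)
      ultimately show "((\<lambda>y. mollifier h (- y)) has_derivative (\<bullet>) (- grad (mollifier h) (- y))) (at y)"
        by simp
    qed
    hence "(\<lambda>y::real^'n. - grad (mollifier h) (- y)) = grad (mollifier h)"
      unfolding mollifier_minus
      by (rule has_grad_unique) (rule smooth_on_has_grad(1)[OF smooth_on_mollifier])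
    thus ?thesis by (metis minus_equation_iff)
  qed
  have zK: "y \<notin> K \<Longrightarrow> ?\<phi> y = 0" "y \<notin> K \<Longrightarrow> grad ?\<phi> y = 0" for y
    using test_fun_mollifier_shift(1,3)[OF h, of y x] x by blast+
  have z\<Omega>: "u y * grad ?\<phi> y $ i = 0" "g y $ i * ?\<phi> y = 0" if "y \<notin> \<Omega>" for y
  proof -
    have "y \<notin> K" using that K by blast
    from zK[OF this] show "u y * grad ?\<phi> y $ i = 0" "g y $ i * ?\<phi> y = 0" by simp_all
  qed
  have "(LINT y:\<Omega>|lebesgue. u y * grad ?\<phi> y $ i) = - (LINT y:\<Omega>|lebesgue. g y $ i * ?\<phi> y)"
    using wg test unfolding weak_grad_def by blast
  also have "(LINT y:\<Omega>|lebesgue. u y * grad ?\<phi> y $ i) = (LINT y|lebesgue. u y * grad ?\<phi> y $ i)"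
    by (rule LINT_set_support[OF z\<Omega>(1)])
  also have "\<dots> = - conv (\<lambda>x. indicator K x * u x) (\<lambda>y. grad (mollifier h) y $ i) x"
  proof -
    have "indicator K y * u y * grad (mollifier h) (x - y) $ i = - (u y * grad ?\<phi> y $ i)" for y
      using odd[of "y - x"] gr[of y] zK(2)[of y] by (cases "y \<in> K") auto
    thus ?thesis unfolding conv_def by simp
  qed
  also have "(LINT y:\<Omega>|lebesgue. g y $ i * ?\<phi> y) = (LINT y|lebesgue. g y $ i * ?\<phi> y)"
    by (rule LINT_set_support[OF z\<Omega>(2)])
  also have "\<dots> = conv (\<lambda>x. indicator K x * g x $ i) (mollifier h) x"
  proof -
    have "indicator K y * g y $ i * mollifier h (x - y) = g y $ i * ?\<phi> y" for y
      using mollifier_diff_commute[of h x y] zK(1)[of y] by (cases "y \<in> K") auto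
    thus ?thesis unfolding conv_def by (intro Bochner_Integration.integral_cong refl) (simp only:)
  qed
  finally show ?thesis by simp
qed

lemma borel_measurable_vec_nth_comp:
  fixes g :: "'a \<Rightarrow> real^'n"
  assumes "g \<in> borel_measurable M"
  shows "(\<lambda>x. g x $ i) \<in> borel_measurable M"
  by (rule measurable_compose[OF assms])
     (intro borel_measurable_continuous_onI continuous_intros)

lemma weak_grad_loc_int:
  assumes "weak_grad \<Omega> u g"
  shows "loc_int \<Omega> u" "loc_int \<Omega> (\<lambda>x. g x $ i)" "g \<in> borel_measurable lebesgue"
  using assms unfolding weak_grad_def loc_int_def set_integrable_def
  by (auto intro: borel_measurable_vec_nth_comp)

lemma loc_int_norm:
  fixes g :: "real^'n \<Rightarrow> real^'n"
  assumes "g \<in> borel_measurable lebesgue" "\<And>i. loc_int \<Omega> (\<lambda>x. g x $ i)"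
  shows "loc_int \<Omega> (\<lambda>x. norm (g x))"
proof (rule loc_int_bound)
  show "(\<lambda>x. norm (g x)) \<in> borel_measurable lebesgue" using assms(1) by measurable
  show "loc_int \<Omega> (\<lambda>x. \<Sum>i\<in>UNIV. \<bar>g x $ i\<bar>)"
    unfolding loc_int_def
  proof (intro conjI allI impI)
    show "(\<lambda>x. \<Sum>i\<in>UNIV. \<bar>g x $ i\<bar>) \<in> borel_measurable lebesgue"
      using borel_measurable_vec_nth_comp[OF assms(1)] by (intro borel_measurable_sum borel_measurable_abs)
    fix K assume K: "compact K \<and> K \<subseteq> \<Omega>"
    have "integrable lebesgue (\<lambda>x. \<Sum>i\<in>UNIV. \<bar>indicator K x * g x $ i\<bar>)"
      using K assms(2) by (intro Bochner_Integration.integrable_sum integrable_abs loc_intD) auto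
    thus "integrable lebesgue (\<lambda>x. indicator K x * (\<Sum>i\<in>UNIV. \<bar>g x $ i\<bar>))"
      by (simp add: abs_mult sum_distrib_left)
  qed
  show "AE x in lebesgue. x \<in> K \<longrightarrow> \<bar>norm (g x)\<bar> \<le> (\<Sum>i\<in>UNIV. \<bar>g x $ i\<bar>)" for K
    by (rule AE_I2) (simp add: norm_le_l1_cart)
qed

text \<open>Truncation by \<open>indicator K\<close> creates a jump at the edge of \<open>K\<close>.
  Every point of \<open>A\<close> has its ball of radius \<open>h k\<close> inside \<open>K\<close>,
  so at such points the gradient of the mollification is the mollification of \<open>g\<close>. This
  is why limits, lower bounds and majorants are asserted on \<open>A\<close> only.\<close>

lemma weak_grad_approx:
  fixes u :: "real^'n \<Rightarrow> real"
  assumes wg: "weak_grad \<Omega> u g" and K: "compact K" "K \<subseteq> \<Omega>"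
    and p: "p \<ge> 1" and gp: "loc_int \<Omega> (\<lambda>x. norm (g x) powr p)"
    and h': "\<forall>k. 0 < h k" and A': "\<forall>x\<in>A. \<forall>k. cball x (h k) \<subseteq> K" and AK: "A \<subseteq> K"
    and lim': "\<forall>f\<in>loc_family K u g p. AE x in lebesgue. (\<lambda>k. conv f (mollifier (h k)) x) \<longlonglongrightarrow> f x"
    and dom': "\<forall>f\<in>loc_family K u g p. \<exists>G. integrable lebesgue G \<and> (\<forall>x. 0 \<le> G x) \<and>
        (AE x in lebesgue. \<forall>k. \<bar>conv f (mollifier (h k)) x\<bar> \<le> G x)"
    and c: "AE x in lebesgue. x \<in> K \<longrightarrow> c \<le> u x"
  shows "\<exists>U D G. (\<forall>k. has_grad (U k) (D k)) \<and> (\<forall>k. continuous_on UNIV (D k)) \<and>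
     (AE x in lebesgue. x \<in> A \<longrightarrow> (\<lambda>k. U k x) \<longlonglongrightarrow> u x \<and> (\<lambda>k. D k x) \<longlonglongrightarrow> g x) \<and>
     (\<forall>k x. x \<in> A \<longrightarrow> c \<le> U k x) \<and> integrable lebesgue G \<and>
     (AE x in lebesgue. x \<in> A \<longrightarrow> (\<forall>k. norm (D k x) powr p \<le> G x))"
proof -
  let ?u = "\<lambda>x. indicator K x * u x"
  let ?g = "\<lambda>i x. indicator K x * g x $ i"
  let ?n = "\<lambda>x. indicator K x * norm (g x)"
  let ?np = "\<lambda>x. indicator K x * norm (g x) powr p"
  note h = h'[rule_format] and A = A'[rule_format] and lim = bspec[OF lim'] and dom = bspec[OF dom']
  define U where "U k = conv ?u (mollifier (h k))" for k
  define D where "D k x = (\<chi> i. conv ?u (\<lambda>y. grad (mollifier (h k)) y $ i) x)" for k x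
  note gm = weak_grad_loc_int(3)[OF wg]
  have ui: "integrable lebesgue ?u" by (rule loc_intD(1)[OF weak_grad_loc_int(1)[OF wg] K])
  have gi: "integrable lebesgue (?g i)" for i by (rule loc_intD(1)[OF weak_grad_loc_int(2)[OF wg] K])
  have ni: "integrable lebesgue ?n"
    by (rule loc_intD(1)[OF loc_int_norm[OF gm weak_grad_loc_int(2)[OF wg]] K])
  have npi: "integrable lebesgue ?np" by (rule loc_intD(1)[OF gp K])
  note s = smooth_on_has_grad[OF smooth_on_mollifier]
  have m0: "norm x > h k \<Longrightarrow> mollifier (h k) x = 0" for k and x :: "real^'n"
    using mollifier_eq_0[OF h[of k], of x] by simp
  have gm0: "norm x > h k \<Longrightarrow> grad (mollifier (h k)) x = 0" for k and x :: "real^'n"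
    using has_grad_eq_0_outside[OF s(1) m0] by blast
  have gi_c: "continuous_on UNIV (\<lambda>y::real^'n. grad (mollifier (h k)) y $ i)" for k i
    by (intro continuous_intros s(2))
  have grad: "has_grad (U k) (D k)" for k
    unfolding U_def D_def by (rule conv_has_grad[OF ui s(1,2), of "h k"]) (use m0 in auto)
  have cont: "continuous_on UNIV (D k)" for k
    unfolding D_def
    by (intro continuous_on_vec_lambda conv_continuous[OF ui gi_c, of "h k"]) (use gm0 in auto)
  have Deq: "D k x $ i = conv (?g i) (mollifier (h k)) x" if "x \<in> A" for k x i
    unfolding D_def vec_lambda_beta by (rule weak_grad_conv[OF wg K A[OF that] h])
  have limU: "AE x in lebesgue. (\<lambda>k. U k x) \<longlonglongrightarrow> ?u x"
    unfolding U_def by (rule lim) (simp add: loc_family_def)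
  have "AE x in lebesgue. \<forall>i. (\<lambda>k. conv (?g i) (mollifier (h k)) x) \<longlonglongrightarrow> ?g i x"
    by (subst AE_all_countable, intro allI lim) (auto simp: loc_family_def)
  hence limits: "AE x in lebesgue. x \<in> A \<longrightarrow> (\<lambda>k. U k x) \<longlonglongrightarrow> u x \<and> (\<lambda>k. D k x) \<longlonglongrightarrow> g x"
    using limU
  proof eventually_elim
    case (elim x)
    show ?case
    proof (intro impI conjI)
      assume x: "x \<in> A"
      hence xK: "x \<in> K" using AK by blast
      show "(\<lambda>k. U k x) \<longlonglongrightarrow> u x" using elim(2) xK by simp
      show "(\<lambda>k. D k x) \<longlonglongrightarrow> g x"
        by (rule vec_tendstoI) (use elim(1) xK Deq[OF x] in auto)
    qed
  qed
  have lower: "c \<le> U k x" if "x \<in> A" for k x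
    unfolding U_def
  proof (rule conv_mollifier_ge[OF ui h])
    show "AE y in lebesgue. y \<in> ball x (h k) \<longrightarrow> c \<le> ?u y"
      using c
    proof eventually_elim
      case (elim y)
      have "y \<in> ball x (h k) \<Longrightarrow> y \<in> K" using A[OF that, of k] by auto
      thus ?case using elim by auto
    qed
  qed
  obtain G where G: "integrable lebesgue G" "\<And>x. 0 \<le> G x" "AE x in lebesgue. \<forall>k. \<bar>conv ?np (mollifier (h k)) x\<bar> \<le> G x"
    using dom[of ?np] by (auto simp: loc_family_def)
  \<comment> \<open>The norm of a vector is at most the sum of its components, hence the factor
    \<open>CARD('n)\<close>; Jensen's inequality is then applied to the single scalar function
    \<open>norm (g x)\<close>.\<close>
  let ?N = "real CARD('n)"
  have Dn: "norm (D k x) \<le> ?N * conv ?n (mollifier (h k)) x" if x: "x \<in> A" for k x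
  proof -
    have "norm (D k x) \<le> (\<Sum>i\<in>UNIV. \<bar>D k x $ i\<bar>)" by (rule norm_le_l1_cart)
    also have "\<dots> \<le> (\<Sum>i\<in>(UNIV::'n set). conv ?n (mollifier (h k)) x)"
    proof (rule sum_mono)
      fix i
      have "\<bar>D k x $ i\<bar> \<le> (LINT y|lebesgue. \<bar>?g i y * mollifier (h k) (x - y)\<bar>)"
        unfolding Deq[OF x] conv_def using integral_norm_bound[of lebesgue "\<lambda>y. ?g i y * mollifier (h k) (x - y)"] by simp
      also have "\<dots> \<le> conv ?n (mollifier (h k)) x"
        unfolding conv_def
      proof (rule integral_mono)
        show "integrable lebesgue (\<lambda>y. \<bar>?g i y * mollifier (h k) (x - y)\<bar>)"
          using integrable_conv_mollifier[OF gi h] by (intro integrable_abs)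
        show "integrable lebesgue (\<lambda>y. ?n y * mollifier (h k) (x - y))"
          by (rule integrable_conv_mollifier[OF ni h])
        show "\<bar>?g i y * mollifier (h k) (x - y)\<bar> \<le> ?n y * mollifier (h k) (x - y)" for y
          using mult_right_mono[OF component_le_norm_cart[of "g y" i] mollifier_nonneg[OF h[of k], of "x - y"]]
          by (auto simp: abs_mult mollifier_nonneg[OF h] indicator_def)
      qed
      finally show "\<bar>D k x $ i\<bar> \<le> conv ?n (mollifier (h k)) x" .
    qed
    finally show ?thesis by simp
  qed
  have bound: "AE x in lebesgue. x \<in> A \<longrightarrow> (\<forall>k. norm (D k x) powr p \<le> ?N powr p * G x)"
    using G(3)
  proof eventually_elim
    case (elim x)
    show ?case
    proof (intro impI allI)
      fix k assume x: "x \<in> A"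
      have c0: "0 \<le> conv ?n (mollifier (h k)) x" by (rule conv_mollifier_ge[OF ni h]) auto
      have "norm (D k x) powr p \<le> (?N * conv ?n (mollifier (h k)) x) powr p"
        using Dn[OF x, of k] p by (intro powr_mono2) auto
      also have "\<dots> = ?N powr p * (conv ?n (mollifier (h k)) x) powr p"
        using c0 by (intro powr_mult)
      also have "(conv ?n (mollifier (h k)) x) powr p \<le> conv (\<lambda>x. ?n x powr p) (mollifier (h k)) x"
      proof (rule conv_mollifier_powr[OF ni _ _ p h])
        have "(\<lambda>x. ?n x powr p) = ?np" using p by (auto simp: indicator_def)
        thus "integrable lebesgue (\<lambda>x. ?n x powr p)" using npi by simp
      qed auto
      also have "(\<lambda>x. ?n x powr p) = ?np" using p by (auto simp: indicator_def)
      also have "conv ?np (mollifier (h k)) x \<le> G x" using elim by (meson abs_le_D1)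
      finally show "norm (D k x) powr p \<le> ?N powr p * G x" by (simp add: mult_left_mono)
    qed
  qed
  have "integrable lebesgue (\<lambda>x. ?N powr p * G x)" using G(1) by simp
  thus ?thesis using grad cont limits lower bound by blast
qed

section \<open>Composite test functions\<close>

text \<open>
  Off the open quadrant \<open>T\<close> is arbitrary.  Measurability is required globally because \<open>u\<close> and \<open>v\<close>
  are positive only almost everywhere.
\<close>

definition C1_quadrant :: "(real \<Rightarrow> real \<Rightarrow> real) \<Rightarrow> (real \<Rightarrow> real \<Rightarrow> real) \<Rightarrow> (real \<Rightarrow> real \<Rightarrow> real) \<Rightarrow> bool" where
  "C1_quadrant T T1 T2 \<longleftrightarrow>
     (\<forall>s>0. \<forall>t>0. ((\<lambda>z. T (fst z) (snd z)) has_derivative (\<lambda>z. T1 s t * fst z + T2 s t * snd z)) (at (s, t))) \<and>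
     continuous_on ({0<..} \<times> {0<..}) (\<lambda>z. T1 (fst z) (snd z)) \<and>
     continuous_on ({0<..} \<times> {0<..}) (\<lambda>z. T2 (fst z) (snd z)) \<and>
     (\<lambda>z. T (fst z) (snd z)) \<in> borel_measurable borel \<and>
     (\<lambda>z. T1 (fst z) (snd z)) \<in> borel_measurable borel \<and>
     (\<lambda>z. T2 (fst z) (snd z)) \<in> borel_measurable borel"

lemma open_quadrant: "open ({0<..} \<times> {0<..} :: (real \<times> real) set)"
  by (intro open_Times) auto

lemma isCont_quadrant:
  assumes "continuous_on ({0<..} \<times> {0<..}) (\<lambda>z. S (fst z) (snd z))" "s > (0::real)" "t > (0::real)"
  shows "isCont (\<lambda>z. S (fst z) (snd z)) (s, t)"
  using assms continuous_on_eq_continuous_at[OF open_quadrant] by auto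

lemma C1_quadrant_isCont:
  assumes "C1_quadrant T T1 T2" "s > 0" "t > 0"
  shows "isCont (\<lambda>z. T (fst z) (snd z)) (s, t)" "isCont (\<lambda>z. T1 (fst z) (snd z)) (s, t)"
    "isCont (\<lambda>z. T2 (fst z) (snd z)) (s, t)"
proof -
  show "isCont (\<lambda>z. T (fst z) (snd z)) (s, t)"
    using assms unfolding C1_quadrant_def by (blast intro: has_derivative_continuous)
qed (use assms isCont_quadrant in \<open>auto simp: C1_quadrant_def\<close>)

lemma isCont_pair_compose:
  fixes U V :: "real^'n \<Rightarrow> real"
  assumes "isCont (\<lambda>z. S (fst z) (snd z)) (U x, V x)" "isCont U x" "isCont V x"
  shows "isCont (\<lambda>x. S (U x) (V x)) x"
  using isCont_o2[of x "\<lambda>x. (U x, V x)" "\<lambda>z. S (fst z) (snd z)"] assms by (simp add: isCont_Pair)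

text \<open>The chain rule applies on the support of \<open>\<eta>\<close>, where the pair
  \<open>(U, V)\<close> stays in the quadrant. Off the support the product vanishes on an open set,
  so other values of \<open>T\<close> never enter.\<close>

lemma composite_has_grad:
  fixes \<eta> U V :: "real^'n \<Rightarrow> real"
  assumes \<eta>: "has_grad \<eta> D\<eta>" "continuous_on UNIV D\<eta>" and U: "has_grad U DU" "continuous_on UNIV DU"
    and V: "has_grad V DV" "continuous_on UNIV DV" and pos: "\<And>x. x \<in> tsupp \<eta> \<Longrightarrow> 0 < U x \<and> 0 < V x"
    and T: "C1_quadrant T T1 T2"
  defines "D \<equiv> \<lambda>x. T (U x) (V x) *\<^sub>R D\<eta> x + \<eta> x *\<^sub>R (T1 (U x) (V x) *\<^sub>R DU x + T2 (U x) (V x) *\<^sub>R DV x)"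
  shows "has_grad (\<lambda>x. \<eta> x * T (U x) (V x)) D" "continuous_on UNIV D"
proof -
  have out: "\<eta> x = 0" "D x = 0" if "x \<notin> tsupp \<eta>" for x
    using tsupp_eq_0[OF that] has_grad_eq_0_tsupp[OF \<eta>(1) that] by (simp_all add: D_def)
  have op: "open (- tsupp \<eta>)" by (simp add: tsupp_def open_Compl)
  show "has_grad (\<lambda>x. \<eta> x * T (U x) (V x)) D"
    unfolding has_grad_def
  proof
    fix x show "((\<lambda>x. \<eta> x * T (U x) (V x)) has_derivative (\<bullet>) (D x)) (at x)"
    proof (cases "x \<in> tsupp \<eta>")
      case True
      hence "0 < U x" "0 < V x" using pos by auto
      hence d: "((\<lambda>z. T (fst z) (snd z)) has_derivative (\<lambda>z. T1 (U x) (V x) * fst z + T2 (U x) (V x) * snd z)) (at (U x, V x))"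
        using T unfolding C1_quadrant_def by blast
      have "((\<lambda>x. T (fst (U x, V x)) (snd (U x, V x))) has_derivative
         (\<lambda>h. T1 (U x) (V x) * fst (DU x \<bullet> h, DV x \<bullet> h) + T2 (U x) (V x) * snd (DU x \<bullet> h, DV x \<bullet> h))) (at x)"
        by (rule has_derivative_compose[where f="\<lambda>x. (U x, V x)", OF has_derivative_Pair[OF has_gradD[OF U(1)] has_gradD[OF V(1)]] d])
      hence "((\<lambda>x. T (U x) (V x)) has_derivative (\<lambda>h. T1 (U x) (V x) * (DU x \<bullet> h) + T2 (U x) (V x) * (DV x \<bullet> h))) (at x)"
        by simp
      from has_derivative_mult[OF has_gradD[OF \<eta>(1)] this] show ?thesis
        by (rule has_derivative_eq_rhs) (auto simp: D_def fun_eq_iff algebra_simps inner_simps)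
    next
      case False
      have "((\<lambda>x. 0) has_derivative (\<bullet>) (D x)) (at x)"
        using out(2)[OF False] by (auto simp: fun_eq_iff intro: has_derivative_eq_rhs[OF has_derivative_const])
      thus ?thesis
        by (rule has_derivative_transform_within_open[OF _ op]) (use False out(1) in auto)
    qed
  qed
  have "isCont D x" for x
  proof (cases "x \<in> tsupp \<eta>")
    case True
    hence p: "0 < U x" "0 < V x" using pos by auto
    have c: "isCont U x" "isCont V x" "isCont \<eta> x" "isCont DU x" "isCont DV x" "isCont D\<eta> x"
      using has_grad_continuous[OF U(1)] has_grad_continuous[OF V(1)] has_grad_continuous[OF \<eta>(1)] U(2) V(2) \<eta>(2)
      by (auto simp: continuous_on_eq_continuous_at)
    note k = isCont_pair_compose[OF C1_quadrant_isCont(1)[OF T p] c(1,2)]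
      isCont_pair_compose[OF C1_quadrant_isCont(2)[OF T p] c(1,2)]
      isCont_pair_compose[OF C1_quadrant_isCont(3)[OF T p] c(1,2)]
    show ?thesis unfolding D_def
      by (intro continuous_add continuous_scaleR c k)
  next
    case False
    have "\<forall>\<^sub>F y in nhds x. D y = 0"
      using eventually_nhds_in_open[OF op, of x] False by (auto elim!: eventually_mono intro: out(2))
    hence "isCont D x \<longleftrightarrow> isCont (\<lambda>_. 0::real^'n) x" by (rule isCont_cong)
    thus ?thesis by simp
  qed
  thus "continuous_on UNIV D" by (simp add: continuous_at_imp_continuous_on)
qed

lemma le_one_plus_powr: "a \<ge> 0 \<Longrightarrow> r \<ge> 1 \<Longrightarrow> a \<le> 1 + a powr (r::real)"
  by (cases "a \<le> 1") (use powr_mono[of 1 r a] in \<open>auto intro: order_trans[of a 1]\<close>)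

lemma young_conj:
  fixes a b p :: real
  assumes "p > 1" "a \<ge> 0" "b \<ge> 0"
  shows "a * b \<le> a powr (p / (p - 1)) + b powr p"
proof -
  have "a * b \<le> a powr (p / (p - 1)) / (p / (p - 1)) + b powr p / p"
    by (rule Youngs_inequality) (use assms in \<open>auto simp: field_simps\<close>)
  also have "a powr (p / (p - 1)) / (p / (p - 1)) \<le> a powr (p / (p - 1)) / 1"
    by (rule divide_left_mono) (use assms in \<open>auto simp: field_simps\<close>)
  also have "b powr p / p \<le> b powr p / 1"
    by (rule divide_left_mono) (use assms in auto)
  finally show ?thesis by simp
qed

definition loc_bdd_below :: "(real^'n) set \<Rightarrow> (real^'n \<Rightarrow> real) \<Rightarrow> bool" where
  "loc_bdd_below \<Omega> u \<longleftrightarrow> (\<forall>K. compact K \<and> K \<subseteq> \<Omega> \<longrightarrow> (\<exists>C>0. AE x in lebesgue. x \<in> K \<longrightarrow> C \<le> u x))"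

lemma integrable_loc_family:
  assumes "weak_grad \<Omega> u g" "loc_int \<Omega> (\<lambda>x. norm (g x) powr p)" "compact K" "K \<subseteq> \<Omega>" "f \<in> loc_family K u g p"
  shows "integrable lebesgue f"
  using assms(5) unfolding loc_family_def
  using loc_intD(1)[OF weak_grad_loc_int(1)[OF assms(1)] assms(3,4)]
    loc_intD(1)[OF weak_grad_loc_int(2)[OF assms(1)] assms(3,4)] loc_intD(1)[OF assms(2-4)] by blast

lemma measurable_pair_compose:
  fixes u v :: "'a \<Rightarrow> real"
  assumes "(\<lambda>z. S (fst z) (snd z)) \<in> borel_measurable borel" "u \<in> borel_measurable M" "v \<in> borel_measurable M"
  shows "(\<lambda>x. S (u x) (v x)) \<in> borel_measurable M"
proof -
  have "(\<lambda>x. (u x, v x)) \<in> M \<rightarrow>\<^sub>M borel" using assms(2,3) by (rule borel_measurable_Pair)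
  from measurable_compose[OF this assms(1)] show ?thesis by simp
qed

text \<open>
  Mollifying \<open>u\<close> and \<open>v\<close> turns \<open>\<eta> T(u, v)\<close> into a continuously differentiable function, so no chain
  or product rule for weak derivatives is needed.
\<close>

lemma weak_ineq_composite:
  fixes X :: "real^'n \<Rightarrow> real^'n" and u v \<eta> :: "real^'n \<Rightarrow> real"
  assumes \<Omega>: "open \<Omega>" and p: "p > 1" and X: "X \<in> borel_measurable lebesgue" "loc_int \<Omega> (\<lambda>x. norm (X x) powr (p / (p - 1)))"
    and b: "loc_int \<Omega> b"
    and ineq: "\<And>\<phi>. test_fun \<Omega> \<phi> \<Longrightarrow> (\<And>x. 0 \<le> \<phi> x) \<Longrightarrow>
       (LINT x:\<Omega>|lebesgue. X x \<bullet> grad \<phi> x) \<le> (LINT x:\<Omega>|lebesgue. b x * \<phi> x)"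
    and u: "weak_grad \<Omega> u gu" "loc_int \<Omega> (\<lambda>x. norm (gu x) powr p)" "loc_bdd_below \<Omega> u"
    and v: "weak_grad \<Omega> v gv" "loc_int \<Omega> (\<lambda>x. norm (gv x) powr p)" "loc_bdd_below \<Omega> v"
    and \<eta>: "has_grad \<eta> D\<eta>" "continuous_on UNIV D\<eta>" "compact (tsupp \<eta>)" "tsupp \<eta> \<subseteq> \<Omega>" "\<And>x. 0 \<le> \<eta> x"
    and T: "C1_quadrant T T1 T2" and T0: "\<And>s t. 0 < s \<Longrightarrow> 0 < t \<Longrightarrow> 0 \<le> T s t \<and> T s t \<le> B0"
    and TB: "\<And>c. 0 < c \<Longrightarrow> \<exists>B. \<forall>s\<ge>c. \<forall>t\<ge>c. \<bar>T1 s t\<bar> \<le> B \<and> \<bar>T2 s t\<bar> \<le> B"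
  shows "(LINT x|lebesgue. X x \<bullet> (T (u x) (v x) *\<^sub>R D\<eta> x + \<eta> x *\<^sub>R (T1 (u x) (v x) *\<^sub>R gu x + T2 (u x) (v x) *\<^sub>R gv x)))
     \<le> (LINT x|lebesgue. b x * (\<eta> x * T (u x) (v x)))"
proof -
  define A where "A = tsupp \<eta>"
  have A: "compact A" "A \<subseteq> \<Omega>" using \<eta> by (auto simp: A_def)
  obtain d where d: "d > 0" "(\<Union>x\<in>A. cball x d) \<subseteq> \<Omega>"
    using compact_subset_open_imp_cball_epsilon_subset[OF A(1) \<Omega> A(2)] by blast
  define K where "K = (\<Union>x\<in>A. cball x d)"
  have K: "compact K" "K \<subseteq> \<Omega>" unfolding K_def using compact_minkowski_sum_cball[OF A(1)] d(2) by auto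
  have AK: "A \<subseteq> K" using d(1) by (force simp: K_def)
  note fin = finite_UnI[OF finite_loc_family[of K u gu p] finite_loc_family[of K v gv p]]
  have fi: "integrable lebesgue f" if "f \<in> loc_family K u gu p \<union> loc_family K v gv p" for f
    using that integrable_loc_family[OF u(1,2) K] integrable_loc_family[OF v(1,2) K] by blast
  let ?F = "loc_family K u gu p \<union> loc_family K v gv p"
  have "\<exists>h. (\<forall>k. 0 < h k) \<and> (\<forall>k. h k < d) \<and>
      (\<forall>f\<in>?F. AE x in lebesgue. (\<lambda>k. conv f (mollifier (h k)) x) \<longlonglongrightarrow> f x) \<and>
      (\<forall>f\<in>?F. \<exists>G. integrable lebesgue G \<and> (\<forall>x. 0 \<le> G x) \<and>
        (AE x in lebesgue. \<forall>k. \<bar>conv f (mollifier (h k)) x\<bar> \<le> G x))"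
    by (rule mollifier_sequence[OF fin fi d(1)], assumption, rule exI, intro conjI allI ballI)
  then obtain h where h': "\<forall>k. 0 < h k" "\<forall>k. h k < d"
    "\<forall>f\<in>?F. AE x in lebesgue. (\<lambda>k. conv f (mollifier (h k)) x) \<longlonglongrightarrow> f x"
    "\<forall>f\<in>?F. \<exists>G. integrable lebesgue G \<and> (\<forall>x. 0 \<le> G x) \<and>
        (AE x in lebesgue. \<forall>k. \<bar>conv f (mollifier (h k)) x\<bar> \<le> G x)"
    by (elim exE conjE) (rule that)
  note h = h'(1)[rule_format] and hd = h'(2)[rule_format] and lim = bspec[OF h'(3)] and dom = bspec[OF h'(4)]
  have lim1: "\<forall>f\<in>loc_family K u gu p. AE x in lebesgue. (\<lambda>k. conv f (mollifier (h k)) x) \<longlonglongrightarrow> f x"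
    and lim2: "\<forall>f\<in>loc_family K v gv p. AE x in lebesgue. (\<lambda>k. conv f (mollifier (h k)) x) \<longlonglongrightarrow> f x"
    using lim by blast+
  have dom1: "\<forall>f\<in>loc_family K u gu p. \<exists>G. integrable lebesgue G \<and> (\<forall>x. 0 \<le> G x) \<and>
        (AE x in lebesgue. \<forall>k. \<bar>conv f (mollifier (h k)) x\<bar> \<le> G x)"
    and dom2: "\<forall>f\<in>loc_family K v gv p. \<exists>G. integrable lebesgue G \<and> (\<forall>x. 0 \<le> G x) \<and>
        (AE x in lebesgue. \<forall>k. \<bar>conv f (mollifier (h k)) x\<bar> \<le> G x)"
    using h'(4) by (meson UnI1, meson UnI2)
  have hA: "\<forall>x\<in>A. \<forall>k. cball x (h k) \<subseteq> K"
  proof (intro ballI allI)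
    fix x k assume "x \<in> A"
    thus "cball x (h k) \<subseteq> K" using hd[of k] by (force simp: K_def)
  qed
  obtain cu where cu: "cu > 0" "AE x in lebesgue. x \<in> K \<longrightarrow> cu \<le> u x" using u(3) K unfolding loc_bdd_below_def by blast
  obtain cv where cv: "cv > 0" "AE x in lebesgue. x \<in> K \<longrightarrow> cv \<le> v x" using v(3) K unfolding loc_bdd_below_def by blast
  define c where "c = min cu cv"
  have c: "c > 0" "AE x in lebesgue. x \<in> K \<longrightarrow> c \<le> u x" "AE x in lebesgue. x \<in> K \<longrightarrow> c \<le> v x"
    using cu(1) cv(1) eventually_mono[OF cu(2)] eventually_mono[OF cv(2)] by (auto simp: c_def min.coboundedI1 min.coboundedI2)
  have p1: "p \<ge> 1" using p by simp
  obtain U DU GU where U': "\<forall>k. has_grad (U k) (DU k)" "\<forall>k. continuous_on UNIV (DU k)"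
    "AE x in lebesgue. x \<in> A \<longrightarrow> (\<lambda>k. U k x) \<longlonglongrightarrow> u x \<and> (\<lambda>k. DU k x) \<longlonglongrightarrow> gu x"
    "\<forall>k x. x \<in> A \<longrightarrow> c \<le> U k x" "integrable lebesgue GU" "AE x in lebesgue. x \<in> A \<longrightarrow> (\<forall>k. norm (DU k x) powr p \<le> GU x)"
    using weak_grad_approx[OF u(1) K p1 u(2) h'(1) hA AK lim1 dom1 c(2)]
    by (elim exE conjE) (rule that)
  note U = U'(1,2)[rule_format] U'(3) U'(4)[rule_format] U'(5,6)
  obtain V DV GV where V': "\<forall>k. has_grad (V k) (DV k)" "\<forall>k. continuous_on UNIV (DV k)"
    "AE x in lebesgue. x \<in> A \<longrightarrow> (\<lambda>k. V k x) \<longlonglongrightarrow> v x \<and> (\<lambda>k. DV k x) \<longlonglongrightarrow> gv x"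
    "\<forall>k x. x \<in> A \<longrightarrow> c \<le> V k x" "integrable lebesgue GV" "AE x in lebesgue. x \<in> A \<longrightarrow> (\<forall>k. norm (DV k x) powr p \<le> GV x)"
    using weak_grad_approx[OF v(1) K p1 v(2) h'(1) hA AK lim2 dom2 c(3)]
    by (elim exE conjE) (rule that)
  note V = V'(1,2)[rule_format] V'(3) V'(4)[rule_format] V'(5,6)
  obtain B where B: "\<And>s t. c \<le> s \<Longrightarrow> c \<le> t \<Longrightarrow> \<bar>T1 s t\<bar> \<le> B \<and> \<bar>T2 s t\<bar> \<le> B" using TB[OF c(1)] by blast
  have B_nn: "B \<ge> 0" using B[of c c] by force
  have B0_nn: "B0 \<ge> 0" using T0[of 1 1] by force
  obtain R where R: "\<And>x. norm x > R \<Longrightarrow> \<eta> x = 0" using \<eta>(3) compact_tsupp_iff by blast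
  have DR: "norm x > R \<Longrightarrow> D\<eta> x = 0" for x using has_grad_eq_0_outside[OF \<eta>(1) R] by blast
  have \<eta>c: "continuous_on UNIV \<eta>" by (rule has_grad_continuous[OF \<eta>(1)])
  obtain N where N: "N > 0" "\<And>x. \<bar>\<eta> x\<bar> \<le> N" using compact_support_bounded[OF \<eta>c, of R] R by auto
  obtain M where M: "M > 0" "\<And>x. norm (D\<eta> x) \<le> M" using compact_support_bounded[OF \<eta>(2), of R] DR by auto
  define P where "P k x = \<eta> x * T (U k x) (V k x)" for k x
  define D where "D k x = T (U k x) (V k x) *\<^sub>R D\<eta> x + \<eta> x *\<^sub>R (T1 (U k x) (V k x) *\<^sub>R DU k x + T2 (U k x) (V k x) *\<^sub>R DV k x)" for k x
  define D' where "D' x = T (u x) (v x) *\<^sub>R D\<eta> x + \<eta> x *\<^sub>R (T1 (u x) (v x) *\<^sub>R gu x + T2 (u x) (v x) *\<^sub>R gv x)" for x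
  have pos: "0 < U k x \<and> 0 < V k x" if "x \<in> A" for x k using U(4)[OF that, of k] V(4)[OF that, of k] c(1) by auto
  have PD: "has_grad (P k) (D k)" "continuous_on UNIV (D k)" for k
    using composite_has_grad[OF \<eta>(1,2) U(1)[of k] U(2)[of k] V(1)[of k] V(2)[of k] _ T] pos[of _ k]
    unfolding P_def D_def A_def by auto
  have out: "\<eta> x = 0" "D\<eta> x = 0" if "x \<notin> A" for x
    using tsupp_eq_0 has_grad_eq_0_tsupp[OF \<eta>(1)] that unfolding A_def by auto
  have supp: "tsupp (P k) \<subseteq> A" for k
    by (rule tsupp_subset_closed[OF compact_imp_closed[OF A(1)]]) (simp add: P_def out)
  note suppc = compact_tsupp_subset[OF A(1) supp]
  have Pnn: "0 \<le> P k x" for k x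
    using pos[of x k] T0[of "U k x" "V k x"] \<eta>(5)[of x] out(1)[of x] by (cases "x \<in> A") (auto simp: P_def)
  have Xloc: "loc_int \<Omega> (\<lambda>x. norm (X x))"
  proof (rule loc_int_bound)
    show "loc_int \<Omega> (\<lambda>x. 1 + norm (X x) powr (p / (p - 1)))"
      unfolding loc_int_def
    proof (intro conjI allI impI)
      show "(\<lambda>x. 1 + norm (X x) powr (p / (p - 1))) \<in> borel_measurable lebesgue" using X(1) by measurable
      fix K assume K: "compact K \<and> K \<subseteq> \<Omega>"
      have "integrable lebesgue (\<lambda>x. indicator K x * 1 + indicator K x * norm (X x) powr (p / (p - 1)))"
        using K integrable_compact_const[of K 1] loc_intD(1)[OF X(2), of K] by (intro Bochner_Integration.integrable_add) auto
      thus "integrable lebesgue (\<lambda>x. indicator K x * (1 + norm (X x) powr (p / (p - 1))))" by (simp add: distrib_left)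
    qed
    show "(\<lambda>x. norm (X x)) \<in> borel_measurable lebesgue" using X(1) by measurable
    show "AE x in lebesgue. x \<in> K \<longrightarrow> \<bar>norm (X x)\<bar> \<le> 1 + norm (X x) powr (p / (p - 1))" for K
      using p le_one_plus_powr[of "norm (X _)" "p / (p - 1)"] by (intro AE_I2) (auto simp: field_simps)
  qed
  have le: "(LINT x|lebesgue. X x \<bullet> D k x) \<le> (LINT x|lebesgue. b x * P k x)" for k
  proof -
    have 1: "X x \<bullet> D k x = 0" "b x * P k x = 0" if "x \<notin> \<Omega>" for x
    proof -
      have "x \<notin> A" using that A by blast
      thus "X x \<bullet> D k x = 0" "b x * P k x = 0" using out[of x] by (auto simp: D_def P_def)
    qed
    have "(LINT x:\<Omega>|lebesgue. X x \<bullet> D k x) \<le> (LINT x:\<Omega>|lebesgue. b x * P k x)"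
      by (rule weak_ineq_C1[OF \<Omega> X(1) Xloc b ineq PD suppc order_trans[OF supp A(2)] Pnn])
    thus ?thesis using LINT_set_support[of \<Omega>, OF 1(1)] LINT_set_support[of \<Omega>, OF 1(2)] by simp
  qed
  have lims: "AE x in lebesgue. x \<in> A \<longrightarrow> (\<lambda>k. P k x) \<longlonglongrightarrow> \<eta> x * T (u x) (v x) \<and> (\<lambda>k. D k x) \<longlonglongrightarrow> D' x"
    using U(3) V(3)
  proof eventually_elim
    case (elim x)
    show ?case
    proof
      assume x: "x \<in> A"
      hence l: "(\<lambda>k. U k x) \<longlonglongrightarrow> u x" "(\<lambda>k. DU k x) \<longlonglongrightarrow> gu x" "(\<lambda>k. V k x) \<longlonglongrightarrow> v x" "(\<lambda>k. DV k x) \<longlonglongrightarrow> gv x"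
        using elim by auto
      have "c \<le> u x" by (rule LIMSEQ_le_const[OF l(1)]) (use U(4)[OF x] in auto)
      moreover have "c \<le> v x" by (rule LIMSEQ_le_const[OF l(3)]) (use V(4)[OF x] in auto)
      ultimately have uv: "u x > 0" "v x > 0" using c(1) by auto
      have S: "(\<lambda>k. S (U k x) (V k x)) \<longlonglongrightarrow> S (u x) (v x)"
        if "isCont (\<lambda>z. S (fst z) (snd z)) (u x, v x)" for S :: "real \<Rightarrow> real \<Rightarrow> real"
        using isCont_tendsto_compose[OF that tendsto_Pair[OF l(1,3)]] by simp
      note S' = S[OF C1_quadrant_isCont(1)[OF T uv]] S[OF C1_quadrant_isCont(2)[OF T uv]] S[OF C1_quadrant_isCont(3)[OF T uv]]
      show "(\<lambda>k. P k x) \<longlonglongrightarrow> \<eta> x * T (u x) (v x) \<and> (\<lambda>k. D k x) \<longlonglongrightarrow> D' x"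
        unfolding P_def D_def D'_def by (intro conjI tendsto_intros S' l)
    qed
  qed
  note m = weak_grad_loc_int(3)[OF u(1)] weak_grad_loc_int(3)[OF v(1)]
    loc_intD(2)[OF weak_grad_loc_int(1)[OF u(1)]] loc_intD(2)[OF weak_grad_loc_int(1)[OF v(1)]]
    borel_measurable_lebesgue_continuous[OF \<eta>(2)] borel_measurable_lebesgue_continuous[OF \<eta>c] X(1) loc_intD(2)[OF b]
    borel_measurable_lebesgue_continuous[OF PD(2)] borel_measurable_lebesgue_continuous[OF has_grad_continuous[OF PD(1)]]
  have Tm: "(\<lambda>x. T (u x) (v x)) \<in> borel_measurable lebesgue" "(\<lambda>x. T1 (u x) (v x)) \<in> borel_measurable lebesgue"
    "(\<lambda>x. T2 (u x) (v x)) \<in> borel_measurable lebesgue"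
    using T measurable_pair_compose[OF _ m(3,4)] unfolding C1_quadrant_def by blast+
  have D'm: "D' \<in> borel_measurable lebesgue" unfolding D'_def
    by (intro borel_measurable_add borel_measurable_scaleR Tm m)
  let ?Y = "\<lambda>x. norm (X x) powr (p / (p - 1))"
  define C where "C = B0 * M + N * B"
  have Dbd: "norm (D k x) \<le> C * (1 + norm (DU k x) + norm (DV k x))" if x: "x \<in> A" for k x
  proof -
    have "norm (D k x) \<le> \<bar>T (U k x) (V k x)\<bar> * norm (D\<eta> x) + \<bar>\<eta> x\<bar> * (\<bar>T1 (U k x) (V k x)\<bar> * norm (DU k x) + \<bar>T2 (U k x) (V k x)\<bar> * norm (DV k x))"
      unfolding D_def by (intro norm_triangle_le add_mono) (auto intro!: mult_left_mono norm_triangle_le)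
    also have "\<dots> \<le> B0 * M + N * (B * norm (DU k x) + B * norm (DV k x))"
      using T0[of "U k x" "V k x"] pos[OF x, of k] M(2)[of x] N B[OF U(4)[OF x] V(4)[OF x], of k] B_nn B0_nn
      by (intro add_mono mult_mono) auto
    also have "\<dots> \<le> C * (1 + norm (DU k x) + norm (DV k x))"
      unfolding C_def using B_nn B0_nn M N by (simp add: algebra_simps)
    finally show ?thesis .
  qed
  have C_nn: "C \<ge> 0" unfolding C_def using B_nn B0_nn M N by simp
  \<comment> \<open>Young's inequality pairs \<open>norm (X x) powr (p / (p - 1))\<close> with the
    \<open>p\<close>-th powers of the mollified gradients. It occurs three times: once for the term
    without a gradient and once for each of \<open>DU\<close> and \<open>DV\<close>.\<close>
  have l1: "(\<lambda>k. LINT x|lebesgue. X x \<bullet> D k x) \<longlonglongrightarrow> (LINT x|lebesgue. X x \<bullet> D' x)"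
  proof (rule integral_dominated_convergence[where w="\<lambda>x. indicator A x * (C * 1) + C * 3 * (indicator A x * ?Y x) + C * (indicator A x *\<^sub>R GU x) + C * (indicator A x *\<^sub>R GV x)"])
    show "AE x in lebesgue. (\<lambda>k. X x \<bullet> D k x) \<longlonglongrightarrow> X x \<bullet> D' x"
      using lims
    proof eventually_elim
      case (elim x)
      show ?case
      proof (cases "x \<in> A")
        case True thus ?thesis using elim by (intro tendsto_intros) auto
      next
        case False thus ?thesis using out[OF False] by (simp add: D_def D'_def)
      qed
    qed
    show "AE x in lebesgue. norm (X x \<bullet> D k x) \<le> indicator A x * (C * 1) + C * 3 * (indicator A x * ?Y x) + C * (indicator A x *\<^sub>R GU x) + C * (indicator A x *\<^sub>R GV x)" for k
      using U(6) V(6)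
    proof eventually_elim
      case (elim x)
      show ?case
      proof (cases "x \<in> A")
        case True
        have "norm (X x \<bullet> D k x) \<le> norm (X x) * (C * (1 + norm (DU k x) + norm (DV k x)))"
          using Cauchy_Schwarz_ineq2[of "X x" "D k x"] mult_left_mono[OF Dbd[OF True, of k] norm_ge_zero[of "X x"]] by simp
        also have "\<dots> = C * (norm (X x) + norm (X x) * norm (DU k x) + norm (X x) * norm (DV k x))"
          by (simp add: algebra_simps)
        also have "\<dots> \<le> C * ((1 + ?Y x) + (?Y x + norm (DU k x) powr p) + (?Y x + norm (DV k x) powr p))"
          using p C_nn by (intro mult_left_mono add_mono le_one_plus_powr young_conj) (auto simp: field_simps)
        also have "\<dots> \<le> C * ((1 + ?Y x) + (?Y x + GU x) + (?Y x + GV x))"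
          using C_nn elim True by (intro mult_left_mono add_mono) auto
        finally show ?thesis using True by (simp add: algebra_simps)
      next
        case False thus ?thesis using out[OF False] by (simp add: D_def)
      qed
    qed
    show "integrable lebesgue (\<lambda>x. indicator A x * (C * 1) + C * 3 * (indicator A x * ?Y x) + C * (indicator A x *\<^sub>R GU x) + C * (indicator A x *\<^sub>R GV x))"
      by (intro Bochner_Integration.integrable_add integrable_compact_const[OF A(1)] integrable_mult_right
          loc_intD(1)[OF X(2) A] integrable_mult_indicator U(5) V(5) compact_sets_lebesgue[OF A(1)])
  qed (intro borel_measurable_inner m D'm)+
  have l2: "(\<lambda>k. LINT x|lebesgue. b x * P k x) \<longlonglongrightarrow> (LINT x|lebesgue. b x * (\<eta> x * T (u x) (v x)))"
  proof (rule integral_dominated_convergence[where w="\<lambda>x. \<bar>indicator A x * b x\<bar> * (N * B0)"])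
    show "AE x in lebesgue. (\<lambda>k. b x * P k x) \<longlonglongrightarrow> b x * (\<eta> x * T (u x) (v x))"
      using lims
    proof eventually_elim
      case (elim x)
      show ?case
      proof (cases "x \<in> A")
        case True thus ?thesis using elim by (intro tendsto_intros) auto
      next
        case False thus ?thesis using out[OF False] by (simp add: P_def)
      qed
    qed
    show "AE x in lebesgue. norm (b x * P k x) \<le> \<bar>indicator A x * b x\<bar> * (N * B0)" for k
    proof (rule AE_I2)
      fix x
      show "norm (b x * P k x) \<le> \<bar>indicator A x * b x\<bar> * (N * B0)"
      proof (cases "x \<in> A")
        case True
        have "\<bar>P k x\<bar> \<le> N * B0" unfolding P_def abs_mult
          using N T0[of "U k x" "V k x"] pos[OF True, of k] by (intro mult_mono) auto
        thus ?thesis using True by (simp add: abs_mult mult_left_mono)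
      next
        case False thus ?thesis using out[OF False] by (simp add: P_def)
      qed
    qed
    show "integrable lebesgue (\<lambda>x. \<bar>indicator A x * b x\<bar> * (N * B0))"
      using loc_intD(1)[OF b A] by simp
  qed (intro borel_measurable_times m Tm)+
  show ?thesis using LIMSEQ_le[OF l1 l2] le unfolding D'_def by blast
qed

section \<open>Almost-everywhere conclusions on open sets\<close>

lemma AE_compact_exhaust:
  fixes \<Omega> :: "(real^'n) set"
  assumes "open \<Omega>" "\<And>K. compact K \<Longrightarrow> K \<subseteq> \<Omega> \<Longrightarrow> AE x in lebesgue. x \<in> K \<longrightarrow> Q x"
  shows "AE x in lebesgue. x \<in> \<Omega> \<longrightarrow> Q x"
proof (rule open_Union_compact_subsets[OF assms(1)])
  fix C :: "nat \<Rightarrow> (real^'n) set"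
  assume C: "\<And>n. compact (C n)" "\<And>n. C n \<subseteq> \<Omega>" "\<Union>(range C) = \<Omega>"
  have "AE x in lebesgue. \<forall>n. x \<in> C n \<longrightarrow> Q x"
    by (subst AE_all_countable) (use C assms(2) in blast)
  thus ?thesis by eventually_elim (use C(3) in blast)
qed

lemma loc_bdd_below_pos:
  assumes "open \<Omega>" "loc_bdd_below \<Omega> u" shows "AE x in lebesgue. x \<in> \<Omega> \<longrightarrow> 0 < u x"
proof (rule AE_compact_exhaust[OF assms(1)])
  fix K assume "compact K" "K \<subseteq> \<Omega>"
  then obtain c where c: "c > 0" "AE x in lebesgue. x \<in> K \<longrightarrow> c \<le> u x" using assms(2) unfolding loc_bdd_below_def by blast
  show "AE x in lebesgue. x \<in> K \<longrightarrow> 0 < u x" using c(2) by eventually_elim (use c(1) in auto)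
qed

text \<open>Mollifiers centred at the points of a compact set are nonnegative test functions, so the
  mollifications of \<open>z\<close> vanish there, and they converge to \<open>z\<close> almost
  everywhere.\<close>

lemma fundamental_lemma:
  fixes z :: "real^'n \<Rightarrow> real"
  assumes \<Omega>: "open \<Omega>" and z: "loc_int \<Omega> z"
    and 0: "\<And>\<phi>. test_fun \<Omega> \<phi> \<Longrightarrow> (\<And>x. 0 \<le> \<phi> x) \<Longrightarrow> (LINT x|lebesgue. z x * \<phi> x) = 0"
  shows "AE x in lebesgue. x \<in> \<Omega> \<longrightarrow> z x = 0"
proof (rule AE_compact_exhaust[OF \<Omega>])
  fix A assume A: "compact A" "A \<subseteq> \<Omega>"
  obtain d where d: "d > 0" "(\<Union>x\<in>A. cball x d) \<subseteq> \<Omega>"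
    using compact_subset_open_imp_cball_epsilon_subset[OF A(1) \<Omega> A(2)] by blast
  define K where "K = (\<Union>x\<in>A. cball x d)"
  have K: "compact K" "K \<subseteq> \<Omega>" unfolding K_def using compact_minkowski_sum_cball[OF A(1)] d(2) by auto
  let ?f = "\<lambda>x. indicator K x * z x"
  have fi: "integrable lebesgue ?f" by (rule loc_intD(1)[OF z K])
  obtain h where h: "\<And>k. 0 < h k" "\<And>k. h k < d"
    and lim: "AE x in lebesgue. (\<lambda>k. conv ?f (mollifier (h k)) x) \<longlonglongrightarrow> ?f x"
    by (rule mollifier_sequence[of "{?f}" d]) (use fi d(1) in auto)
  have c0: "conv ?f (mollifier (h k)) x = 0" if x: "x \<in> A" for x k
  proof -
    let ?\<phi> = "\<lambda>y. mollifier (h k) (y - x)"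
    have hK: "cball x (h k) \<subseteq> K" using x h(2)[of k] by (force simp: K_def)
    have test: "test_fun \<Omega> ?\<phi>" by (rule test_fun_mollifier_shift(2)[OF h(1)]) (use hK K in blast)
    have "(LINT y|lebesgue. z y * ?\<phi> y) = 0" by (rule 0[OF test]) (simp add: mollifier_nonneg[OF h(1)])
    moreover have "z y * ?\<phi> y = ?f y * mollifier (h k) (x - y)" for y
    proof (cases "y \<in> K")
      case False
      hence "?\<phi> y = 0" using test_fun_mollifier_shift(1)[OF h(1)] hK by blast
      thus ?thesis using False by simp
    qed (simp add: mollifier_diff_commute)
    ultimately show ?thesis unfolding conv_def by (simp only:)
  qed
  show "AE x in lebesgue. x \<in> A \<longrightarrow> z x = 0"
    using lim
  proof eventually_elim
    case (elim x)
    show ?case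
    proof
      assume x: "x \<in> A"
      hence "x \<in> K" using d(1) by (force simp: K_def)
      thus "z x = 0" using elim c0[OF x] LIMSEQ_unique[OF tendsto_const] by fastforce
    qed
  qed
qed

section \<open>The flux and scalar auxiliary functions\<close>

text \<open>At \<open>a = 0\<close> the value is 0, which for exponents above 1 is the continuous
  extension of the field even when \<open>norm a powr (p - 2)\<close> is singular.\<close>

definition flux :: "real \<Rightarrow> real \<Rightarrow> 'a::real_inner \<Rightarrow> 'a" where
  "flux p q a = (norm a powr (p - 2) + norm a powr (q - 2)) *\<^sub>R a"

lemma powr_minus2_mult_norm: "norm a powr (r - 2) * norm a = norm a powr (r - 1)" if "r > 1"
  for a :: "'a::real_normed_vector"
proof (cases "a = 0")
  case False
  have "norm a powr (r - 1) = norm a powr ((r - 2) + 1)" by simp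
  also have "\<dots> = norm a powr (r - 2) * norm a powr 1" by (rule powr_add)
  finally show ?thesis using False by simp
qed (use that in simp)

lemma norm_powr_mult_norm: "norm a powr (r - 1) * norm a = norm a powr r" if "r > 1"
  for a :: "'a::real_normed_vector"
proof (cases "a = 0")
  case False
  have "norm a powr r = norm a powr ((r - 1) + 1)" by simp
  also have "\<dots> = norm a powr (r - 1) * norm a powr 1" by (rule powr_add)
  finally show ?thesis using False by simp
qed (use that in simp)

lemma norm_flux: "p > 1 \<Longrightarrow> q > 1 \<Longrightarrow> norm (flux p q a) = norm a powr (p - 1) + norm a powr (q - 1)"
  by (simp add: flux_def distrib_right powr_minus2_mult_norm)

lemma flux_inner_self:
  assumes "p > 1" "q > 1" shows "flux p q a \<bullet> a = norm a powr p + norm a powr q"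
proof -
  have "norm a powr (r - 2) * (a \<bullet> a) = norm a powr r" if "r > 1" for r
    using powr_minus2_mult_norm[OF that, of a] norm_powr_mult_norm[OF that, of a]
    by (metis mult.assoc dot_square_norm power2_eq_square)
  thus ?thesis using assms by (simp add: flux_def distrib_right)
qed

text \<open>The product is the sum of \<open>(|a|^(r-1) - |b|^(r-1)) (|a| - |b|)\<close>, which
  compares lengths, and \<open>(|a|^(r-2) + |b|^(r-2)) (|a| |b| - a \<bullet> b)\<close>, which
  compares directions. Both are nonnegative. If the sum vanishes, the first forces equal lengths and
  the second equality in Cauchy-Schwarz.\<close>

lemma plap_monotone:
  fixes a b :: "'a::real_inner"
  assumes r: "r > 1"
  shows "0 \<le> (norm a powr (r - 2) *\<^sub>R a - norm b powr (r - 2) *\<^sub>R b) \<bullet> (a - b)"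
    and "(norm a powr (r - 2) *\<^sub>R a - norm b powr (r - 2) *\<^sub>R b) \<bullet> (a - b) = 0 \<Longrightarrow> a = b"
proof -
  let ?A = "norm a powr (r - 2)" and ?B = "norm b powr (r - 2)"
  let ?E = "(?A *\<^sub>R a - ?B *\<^sub>R b) \<bullet> (a - b)"
  have "?E = ?A * (a \<bullet> a) + ?B * (b \<bullet> b) - (?A + ?B) * (a \<bullet> b)"
    by (simp add: inner_diff_left inner_diff_right inner_commute algebra_simps)
  also have "\<dots> = (?A * norm a - ?B * norm b) * (norm a - norm b) + (?A + ?B) * (norm a * norm b - a \<bullet> b)"
    by (simp add: dot_square_norm power2_eq_square algebra_simps)
  finally have E: "?E = (norm a powr (r - 1) - norm b powr (r - 1)) * (norm a - norm b) + (?A + ?B) * (norm a * norm b - a \<bullet> b)"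
    by (simp add: powr_minus2_mult_norm[OF r])
  have 1: "0 \<le> (norm a powr (r - 1) - norm b powr (r - 1)) * (norm a - norm b)"
  proof (cases "norm a \<le> norm b")
    case True
    thus ?thesis using r by (intro mult_nonpos_nonpos) (auto intro: powr_mono2)
  next
    case False
    thus ?thesis using r by (intro mult_nonneg_nonneg) (auto intro: powr_mono2)
  qed
  have 2: "0 \<le> (?A + ?B) * (norm a * norm b - a \<bullet> b)"
    by (intro mult_nonneg_nonneg) (use norm_cauchy_schwarz[of a b] in auto)
  show "0 \<le> ?E" unfolding E using 1 2 by linarith
  show "a = b" if "?E = 0"
  proof -
    have z: "(norm a powr (r - 1) - norm b powr (r - 1)) * (norm a - norm b) = 0" "(?A + ?B) * (norm a * norm b - a \<bullet> b) = 0"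
      using that 1 2 unfolding E by linarith+
    have n: "norm a = norm b"
    proof (rule ccontr)
      assume "norm a \<noteq> norm b"
      moreover from this have "norm a powr (r - 1) \<noteq> norm b powr (r - 1)"
        using r powr_less_mono2[of "r - 1" "norm a" "norm b"] powr_less_mono2[of "r - 1" "norm b" "norm a"]
        by (cases "norm a" "norm b" rule: linorder_cases) auto
      ultimately show False using z(1) by simp
    qed
    show ?thesis
    proof (cases "norm a = 0")
      case False
      hence "?A > 0" by simp
      hence "?A + ?B > 0" by (simp add: add_pos_nonneg)
      hence "a \<bullet> b = norm a * norm b" using z(2) by simp
      moreover have "(a - b) \<bullet> (a - b) = a \<bullet> a + b \<bullet> b - 2 * (a \<bullet> b)"
        by (simp add: inner_diff_left inner_diff_right inner_commute)
      ultimately have "(a - b) \<bullet> (a - b) = 0"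
        using n by (simp only: dot_square_norm power2_eq_square)
      thus ?thesis by simp
    qed (use n in auto)
  qed
qed

lemma flux_monotone:
  assumes "p > 1" "q > 1"
  shows "0 \<le> (flux p q a - flux p q b) \<bullet> (a - b)"
    and "(flux p q a - flux p q b) \<bullet> (a - b) = 0 \<Longrightarrow> a = b"
proof -
  let ?E = "\<lambda>r. (norm a powr (r - 2) *\<^sub>R a - norm b powr (r - 2) *\<^sub>R b) \<bullet> (a - b)"
  have E: "(flux p q a - flux p q b) \<bullet> (a - b) = ?E p + ?E q"
    by (simp add: flux_def scaleR_add_left inner_diff_left inner_add_left)
  note m = plap_monotone[OF assms(1), of a b] plap_monotone[OF assms(2), of a b]
  show "0 \<le> (flux p q a - flux p q b) \<bullet> (a - b)" unfolding E using m by simp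
  show "a = b" if "(flux p q a - flux p q b) \<bullet> (a - b) = 0"
    by (rule m(2)) (use that m(1,3) in \<open>unfold E, linarith\<close>)
qed

lemma powr_add_le:
  fixes a b r :: real
  assumes "a \<ge> 0" "b \<ge> 0" "r \<ge> 0"
  shows "(a + b) powr r \<le> 2 powr r * (a powr r + b powr r)"
proof -
  have "(a + b) powr r \<le> (2 * max a b) powr r" using assms by (intro powr_mono2) auto
  also have "\<dots> = 2 powr r * (max a b) powr r" using assms by (simp add: powr_mult)
  also have "(max a b) powr r \<le> a powr r + b powr r" by (auto simp: max_def)
  finally show ?thesis by simp
qed

lemma powr_le_one_plus:
  fixes a r s :: real
  assumes "a \<ge> 0" "0 \<le> r" "r \<le> s"
  shows "a powr r \<le> 1 + a powr s"
proof (cases "a \<le> 1")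
  case True
  have "a powr r \<le> 1" using assms True by (cases "a = 0") (auto intro: powr_le1)
  thus ?thesis by (simp add: add_increasing2)
next
  case False
  hence "a powr r \<le> a powr s" using assms by (intro powr_mono) auto
  thus ?thesis by simp
qed

text \<open>\<open>p / (p - 1)\<close> is the conjugate exponent and turns growth of order
  \<open>p - 1\<close> into order \<open>p\<close>. The \<open>q\<close> part is dominated by the
  \<open>p\<close> part for large gradients and by 1 for small ones. The constants 2 and 3 are not
  sharp.\<close>

lemma norm_flux_powr_le:
  assumes "1 < q" "q < p"
  shows "norm (flux p q a) powr (p / (p - 1)) \<le> 2 powr (p / (p - 1)) * (3 powr (p / (p - 1)) * (1 + norm a powr p))"
proof -
  let ?r = "p / (p - 1)"
  have r: "?r > 0" using assms by simp
  have e: "(norm a powr (p - 1)) powr ?r = norm a powr p" using assms by (simp add: powr_powr)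
  have "norm (flux p q a) \<le> norm a powr (p - 1) + (1 + norm a powr (p - 1))"
    using powr_le_one_plus[of "norm a" "q - 1" "p - 1"] assms by (simp add: norm_flux)
  also have "\<dots> \<le> 2 * (1 + norm a powr (p - 1))" by simp
  finally have "norm (flux p q a) powr ?r \<le> (2 * (1 + norm a powr (p - 1))) powr ?r"
    using r by (intro powr_mono2) auto
  also have "\<dots> = 2 powr ?r * (1 + norm a powr (p - 1)) powr ?r"
    by (rule powr_mult)
  also have "(1 + norm a powr (p - 1)) powr ?r \<le> 3 powr ?r * (1 + norm a powr p)"
  proof -
    have "(1 + norm a powr (p - 1)) powr ?r \<le> 2 powr ?r * (1 powr ?r + (norm a powr (p - 1)) powr ?r)"
      using r by (intro powr_add_le) auto
    also have "\<dots> = 2 powr ?r * (1 + norm a powr p)" by (simp add: e)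
    also have "\<dots> \<le> 3 powr ?r * (1 + norm a powr p)"
      using r by (intro mult_right_mono powr_mono2) auto
    finally show ?thesis .
  qed
  finally show ?thesis by simp
qed

lemma norm_flux_diff_powr_le:
  assumes "1 < q" "q < p"
  shows "norm (flux p q a - flux p q b) powr (p / (p - 1)) \<le>
    (2 * 2 * 3) powr (p / (p - 1)) * (2 + norm a powr p + norm b powr p)"
proof -
  let ?r = "p / (p - 1)"
  have "norm (flux p q a - flux p q b) powr ?r \<le> (norm (flux p q a) + norm (flux p q b)) powr ?r"
    using assms by (intro powr_mono2 norm_triangle_ineq4) auto
  also have "\<dots> \<le> 2 powr ?r * (norm (flux p q a) powr ?r + norm (flux p q b) powr ?r)"
    using assms by (intro powr_add_le) auto
  also have "\<dots> \<le> 2 powr ?r * (2 powr ?r * (3 powr ?r * (1 + norm a powr p)) + 2 powr ?r * (3 powr ?r * (1 + norm b powr p)))"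
    by (intro mult_left_mono add_mono norm_flux_powr_le assms) auto
  also have "\<dots> = (2 * 2 * 3) powr ?r * (2 + norm a powr p + norm b powr p)"
    by (simp only: powr_mult) (simp add: algebra_simps)
  finally show ?thesis .
qed

text \<open>This handles the cross term of the Caccioppoli argument. The coefficient
  \<open>1 / (2 * M)\<close> is half of the \<open>1 / M\<close> that the exponential weight
  supplies, so the first summand can be absorbed.\<close>

lemma powr_cutoff_young:
  fixes \<eta> a d r M :: real
  assumes \<eta>: "0 \<le> \<eta>" "\<eta> \<le> 1" and a: "0 \<le> a" and d: "0 \<le> d" and r: "1 < r" "r \<le> real m" and M: "M > 0"
  shows "real m * \<eta> ^ (m - 1) * d * a powr (r - 1) \<le>
     \<eta> ^ m * a powr r / (2 * M) + real m * (2 * real m * M) powr (r - 1) * d powr r"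
proof -
  have m: "m > 0" "real (m - 1) = real m - 1" using r by (auto simp: of_nat_diff)
  have pow: "\<eta> ^ m = \<eta> * \<eta> ^ (m - 1)" using m by (metis power_eq_if less_not_refl)
  have a': "a powr r = a * a powr (r - 1)"
    using norm_powr_mult_norm[OF r(1), of a] a by (simp add: mult.commute)
  have d': "d powr r = d * d powr (r - 1)"
    using norm_powr_mult_norm[OF r(1), of d] d by (simp add: mult.commute)
  \<comment> \<open>either \<open>d\<close> is small compared with \<open>\<eta> a\<close> and is absorbed, or \<open>\<eta> a\<close> is bounded by \<open>d\<close>\<close>
  show ?thesis
  proof (cases "real m * d \<le> \<eta> * a / (2 * M)")
    case True
    have "real m * \<eta> ^ (m - 1) * d * a powr (r - 1) = (real m * d) * (\<eta> ^ (m - 1) * a powr (r - 1))" by simp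
    also have "\<dots> \<le> (\<eta> * a / (2 * M)) * (\<eta> ^ (m - 1) * a powr (r - 1))"
      using True \<eta> by (intro mult_right_mono) auto
    also have "\<dots> = \<eta> ^ m * a powr r / (2 * M)" by (simp add: pow a')
    moreover have "0 \<le> real m * (2 * real m * M) powr (r - 1) * d powr r" by simp
    ultimately show ?thesis by linarith
  next
    case False
    hence lt: "\<eta> * a \<le> 2 * real m * M * d" using M by (simp add: field_simps)
    \<comment> \<open>Here \<open>r \<le> real m\<close> and \<open>\<eta> \<le> 1\<close> enter. At
      \<open>\<eta> = 0\<close> it matters that \<open>m - 1\<close> is positive, since
      \<open>0 ^ 0\<close> would be 1.\<close>
    have "\<eta> ^ (m - 1) \<le> \<eta> powr (r - 1)"
    proof (cases "\<eta> = 0")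
      case True
      have "m - 1 > 0" using r m by linarith
      thus ?thesis using True by (simp only: zero_power powr_ge_zero)
    next
      case False
      hence "\<eta> ^ (m - 1) = \<eta> powr (real m - 1)" using \<eta> m by (metis powr_realpow less_eq_real_def)
      thus ?thesis using \<eta> r False by (simp add: powr_mono')
    qed
    hence "\<eta> ^ (m - 1) * a powr (r - 1) \<le> \<eta> powr (r - 1) * a powr (r - 1)" by (intro mult_right_mono) auto
    also have "\<dots> = (\<eta> * a) powr (r - 1)" using \<eta> a by (simp add: powr_mult)
    also have "\<dots> \<le> (2 * real m * M * d) powr (r - 1)" using lt \<eta> a r by (intro powr_mono2) auto
    also have "\<dots> = (2 * real m * M) powr (r - 1) * d powr (r - 1)" using M d by (simp add: powr_mult)
    finally have "real m * d * (\<eta> ^ (m - 1) * a powr (r - 1)) \<le> real m * d * ((2 * real m * M) powr (r - 1) * d powr (r - 1))"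
      using d by (intro mult_left_mono) auto
    moreover have "0 \<le> \<eta> ^ m * a powr r / (2 * M)" using \<eta> M by simp
    ultimately show ?thesis unfolding d' by (simp add: algebra_simps)
  qed
qed

section \<open>Continuously differentiable scalar profiles\<close>

definition pos_sq :: "real \<Rightarrow> real" where "pos_sq x = (max 0 x)\<^sup>2"

lemma pos_sq_deriv: "(pos_sq has_real_derivative 2 * max 0 x) (at x)"
proof (cases x "0::real" rule: linorder_cases)
  case less
  have "((\<lambda>_. 0) has_real_derivative 0) (at x)" by simp
  hence "(pos_sq has_real_derivative 0) (at x)"
    by (rule has_field_derivative_transform_within_open[of _ _ _ "{..<0}"]) (use less in \<open>auto simp: pos_sq_def\<close>)
  thus ?thesis using less by simp
next
  case greater
  have "((\<lambda>x. x\<^sup>2) has_real_derivative 2 * x) (at x)" by (auto intro!: derivative_eq_intros)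
  hence "(pos_sq has_real_derivative 2 * x) (at x)"
    by (rule has_field_derivative_transform_within_open[of _ _ _ "{0<..}"]) (use greater in \<open>auto simp: pos_sq_def\<close>)
  thus ?thesis using greater by simp
next
  case equal
  have "((\<lambda>h. (pos_sq h - pos_sq 0) / h) \<longlongrightarrow> 0) (at 0)"
  proof (rule Lim_null_comparison)
    show "\<forall>\<^sub>F h in at 0. norm ((pos_sq h - pos_sq 0) / h) \<le> \<bar>h\<bar>"
      by (rule always_eventually) (auto simp: pos_sq_def max_def power2_eq_square)
    show "((\<lambda>h::real. \<bar>h\<bar>) \<longlongrightarrow> 0) (at 0)" by (intro tendsto_rabs_zero tendsto_ident_at)
  qed
  thus ?thesis using equal by (simp add: DERIV_def)
qed

lemma continuous_on_pos_sq: "continuous_on UNIV pos_sq"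
  unfolding pos_sq_def by (intro continuous_intros)

text \<open>Two nested squared positive parts: the inner one leaves 0 at \<open>s = 1\<close> with
  zero slope, the outer one reaches the value 1 at \<open>s = 2\<close> with zero slope. C1
  regularity is enough, because the cut-offs are differentiated only once.\<close>

definition step_fun :: "real \<Rightarrow> real" where
  "step_fun s = 1 - pos_sq (1 - pos_sq (s - 1))"

definition step_fun' :: "real \<Rightarrow> real" where
  "step_fun' s = 4 * max 0 (1 - pos_sq (s - 1)) * max 0 (s - 1)"

lemma step_fun_deriv: "(step_fun has_real_derivative step_fun' s) (at s)"
  unfolding step_fun_def step_fun'_def
  by (rule derivative_eq_intros DERIV_chain2[OF pos_sq_deriv] refl)+ simp

lemma continuous_on_step_fun': "continuous_on UNIV step_fun'"
  unfolding step_fun'_def pos_sq_def by (intro continuous_intros)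

lemma step_fun_bounds: "0 \<le> step_fun s" "step_fun s \<le> 1"
proof -
  have "(max 0 (1 - pos_sq (s - 1)))\<^sup>2 \<le> 1\<^sup>2" by (intro power_mono) (auto simp: pos_sq_def)
  thus "0 \<le> step_fun s" "step_fun s \<le> 1" by (auto simp: step_fun_def pos_sq_def[of "1 - _"])
qed

lemma step_fun_eq_0: "s \<le> 1 \<Longrightarrow> step_fun s = 0"
  by (simp add: step_fun_def pos_sq_def)

lemma step_fun_eq_1:
  assumes "2 \<le> s" shows "step_fun s = 1" "step_fun' s = 0"
proof -
  have "1\<^sup>2 \<le> (s - 1)\<^sup>2" using assms by (intro power_mono) auto
  hence "1 \<le> pos_sq (s - 1)" using assms by (simp add: pos_sq_def)
  thus "step_fun s = 1" "step_fun' s = 0" by (simp_all add: step_fun_def step_fun'_def pos_sq_def[of "1 - _"])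
qed

lemma step_fun'_bounds: "0 \<le> step_fun' s" "step_fun' s \<le> 4" "step_fun' s \<noteq> 0 \<Longrightarrow> 1 < s \<and> s < 2"
proof -
  show s: "step_fun' s \<noteq> 0 \<Longrightarrow> 1 < s \<and> s < 2"
    using step_fun_eq_1(2)[of s] by (auto simp: step_fun'_def max_def not_le[symmetric] split: if_splits)
  show "0 \<le> step_fun' s" by (simp add: step_fun'_def)
  show "step_fun' s \<le> 4"
  proof (cases "step_fun' s = 0")
    case False
    hence "1 < s" "s < 2" using s by auto
    hence "max 0 (1 - pos_sq (s - 1)) * max 0 (s - 1) \<le> 1 * 1"
      by (intro mult_mono) (auto simp: pos_sq_def)
    thus ?thesis by (simp add: step_fun'_def)
  qed simp
qed

text \<open>The function \<open>H\<close> of the overview. It is bounded, as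
  \<open>admissible\<close> demands, and its derivative is positive exactly on the positive
  half-line, which lets gradients be compared on the whole set where
  \<open>u - v > 2 * \<epsilon>\<close>.\<close>

definition sat_fun :: "real \<Rightarrow> real" where "sat_fun r = pos_sq r / (1 + pos_sq r)"

definition sat_fun' :: "real \<Rightarrow> real" where "sat_fun' r = 2 * max 0 r / (1 + pos_sq r)\<^sup>2"

lemma one_plus_pos_sq: "1 + pos_sq r > 0" "1 + pos_sq r \<noteq> 0"
proof -
  show "1 + pos_sq r > 0" by (simp add: pos_sq_def add_pos_nonneg)
  thus "1 + pos_sq r \<noteq> 0" by simp
qed

lemma sat_fun_deriv: "(sat_fun has_real_derivative sat_fun' r) (at r)"
  unfolding sat_fun_def sat_fun'_def
  by (rule derivative_eq_intros pos_sq_deriv refl one_plus_pos_sq)+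
     (use one_plus_pos_sq[of r] in \<open>simp add: power2_eq_square field_simps\<close>)

lemma continuous_on_sat_fun': "continuous_on UNIV sat_fun'"
  unfolding sat_fun'_def by (intro continuous_intros continuous_on_pos_sq) (use one_plus_pos_sq in auto)

lemma sat_fun_bounds: "0 \<le> sat_fun r" "sat_fun r \<le> 1" "r \<le> 0 \<Longrightarrow> sat_fun r = 0" "0 < r \<Longrightarrow> 0 < sat_fun r"
  using one_plus_pos_sq[of r] by (auto simp: sat_fun_def pos_sq_def divide_le_eq_1)

lemma sat_fun'_bounds: "0 \<le> sat_fun' r" "sat_fun' r \<le> 1" "r \<le> 0 \<Longrightarrow> sat_fun' r = 0" "0 < r \<Longrightarrow> 0 < sat_fun' r"
proof -
  show "0 \<le> sat_fun' r" by (simp add: sat_fun'_def)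
  show "r \<le> 0 \<Longrightarrow> sat_fun' r = 0" by (simp add: sat_fun'_def)
  show "0 < r \<Longrightarrow> 0 < sat_fun' r" using one_plus_pos_sq(1)[of r] by (simp add: sat_fun'_def)
  have "2 * max 0 r \<le> 1 + pos_sq r" using sum_squares_bound[of 1 "max 0 r"] by (simp add: pos_sq_def)
  also have "\<dots> \<le> (1 + pos_sq r)\<^sup>2" using one_plus_pos_sq(1)[of r] by (intro self_le_power) (auto simp: pos_sq_def)
  finally show "sat_fun' r \<le> 1" using one_plus_pos_sq(1)[of r] by (simp add: sat_fun'_def divide_le_eq_1)
qed

text \<open>
  For positive \<open>s\<close> this is \<open>s\<close> up to \<open>M\<close> and \<open>2M - M\<^sup>2 / s\<close> beyond; it is meaningless at \<open>s = 0\<close>.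
\<close>

definition trunc :: "real \<Rightarrow> real \<Rightarrow> real" where
  "trunc M s = s - pos_sq (s - M) / s"

definition trunc' :: "real \<Rightarrow> real \<Rightarrow> real" where
  "trunc' M s = (min s M / s)\<^sup>2"

lemma pos_sq_diff_min: "pos_sq (s - M) = (s - min s M)\<^sup>2"
  by (simp add: pos_sq_def min_def max_def)

lemma trunc_deriv:
  assumes "s > 0" shows "(trunc M has_real_derivative trunc' M s) (at s)"
proof -
  have m: "max 0 (s - M) = s - min s M" by (simp add: min_def max_def)
  have "(trunc M has_real_derivative 1 - (2 * max 0 (s - M) * s - pos_sq (s - M)) / (s * s)) (at s)"
    unfolding trunc_def
    by (rule derivative_eq_intros DERIV_chain2[OF pos_sq_deriv] refl)+ (use assms in auto)
  moreover have "1 - (2 * max 0 (s - M) * s - pos_sq (s - M)) / (s * s) = trunc' M s"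
    unfolding trunc'_def pos_sq_diff_min m using assms by (simp add: power2_eq_square field_simps)
  ultimately show ?thesis by simp
qed

lemma trunc_bounds:
  assumes "M > 0" "s > 0"
  shows "trunc M s \<le> s" "trunc M s \<le> 2 * M" "0 \<le> trunc' M s" "trunc' M s \<le> 1"
    "s \<le> M \<Longrightarrow> trunc M s = s" "s \<le> M \<Longrightarrow> trunc' M s = 1"
proof -
  show "trunc M s \<le> s" using assms by (simp add: trunc_def pos_sq_def)
  \<comment> \<open>Expanding the square gives one formula for both branches, from which the ceiling
    \<open>2 * M\<close> is visible.\<close>
  have "trunc M s = 2 * min s M - (min s M)\<^sup>2 / s"
    using assms unfolding trunc_def pos_sq_diff_min by (simp add: power2_eq_square field_simps)
  also have "\<dots> \<le> 2 * min s M" using assms by simp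
  finally show "trunc M s \<le> 2 * M" by simp
  show "0 \<le> trunc' M s" by (simp add: trunc'_def)
  have "(min s M / s)\<^sup>2 \<le> 1\<^sup>2" using assms by (intro power_mono) auto
  thus "trunc' M s \<le> 1" by (simp add: trunc'_def)
  show "s \<le> M \<Longrightarrow> trunc M s = s" by (simp add: trunc_def pos_sq_def)
  show "s \<le> M \<Longrightarrow> trunc' M s = 1" using assms by (simp add: trunc'_def)
qed

lemma continuous_on_trunc: "continuous_on {0<..} (trunc M)" "continuous_on {0<..} (trunc' M)"
  unfolding trunc_def trunc'_def pos_sq_def by (intro continuous_intros; simp)+

section \<open>Local integrability: algebra and pairing with test functions\<close>

lemma loc_int_const: "loc_int \<Omega> (\<lambda>x. c)"
  unfolding loc_int_def using integrable_compact_const by auto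

lemma loc_int_add: "loc_int \<Omega> f \<Longrightarrow> loc_int \<Omega> g \<Longrightarrow> loc_int \<Omega> (\<lambda>x. f x + g x)"
  unfolding loc_int_def by (auto simp: distrib_left intro!: Bochner_Integration.integrable_add)

lemma loc_int_cmult: "loc_int \<Omega> f \<Longrightarrow> loc_int \<Omega> (\<lambda>x. c * f x)"
  unfolding loc_int_def by (auto simp: mult.left_commute[of _ c] intro!: integrable_mult_right)

lemma loc_int_diff: "loc_int \<Omega> f \<Longrightarrow> loc_int \<Omega> g \<Longrightarrow> loc_int \<Omega> (\<lambda>x. f x - g x)"
  using loc_int_add[of \<Omega> f "\<lambda>x. (-1) * g x"] loc_int_cmult[of \<Omega> g "-1"] by simp

lemma integrable_loc_int_mult:
  fixes f r :: "real^'n \<Rightarrow> real"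
  assumes f: "loc_int \<Omega> f" and r: "continuous_on UNIV r" and K: "compact K" "K \<subseteq> \<Omega>" and 0: "\<And>x. x \<notin> K \<Longrightarrow> r x = 0"
  shows "integrable lebesgue (\<lambda>x. f x * r x)"
proof -
  obtain R where "\<And>x. x \<in> K \<Longrightarrow> norm x \<le> R" using compact_imp_bounded[OF K(1)] bounded_iff by blast
  hence "\<And>x. norm x > R \<Longrightarrow> r x = 0" using 0 by fastforce
  then obtain B where B: "\<And>x. \<bar>r x\<bar> \<le> B" using compact_support_bounded[OF r, of R] by auto
  have "integrable lebesgue (\<lambda>x. (indicator K x * f x) * r x)"
    by (rule integrable_mult_bounded_continuous[OF loc_intD(1)[OF f K] r B])
  moreover have "(indicator K x * f x) * r x = f x * r x" for x using 0[of x] by (cases "x \<in> K") auto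
  ultimately show ?thesis by simp
qed

lemma loc_int_component:
  fixes X :: "real^'n \<Rightarrow> real^'n"
  assumes "X \<in> borel_measurable lebesgue" "loc_int \<Omega> (\<lambda>x. norm (X x))"
  shows "loc_int \<Omega> (\<lambda>x. X x $ i)"
  by (rule loc_int_bound[OF assms(2) borel_measurable_vec_nth_comp[OF assms(1)]])
     (auto intro!: AE_I2 component_le_norm_cart)

lemma test_fun_integrable:
  fixes X :: "real^'n \<Rightarrow> real^'n"
  assumes t: "test_fun \<Omega> \<phi>"
  shows "loc_int \<Omega> b \<Longrightarrow> integrable lebesgue (\<lambda>x. b x * \<phi> x)"
    "X \<in> borel_measurable lebesgue \<Longrightarrow> loc_int \<Omega> (\<lambda>x. norm (X x)) \<Longrightarrow> integrable lebesgue (\<lambda>x. X x \<bullet> grad \<phi> x)"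
    "x \<notin> \<Omega> \<Longrightarrow> \<phi> x = 0" "x \<notin> \<Omega> \<Longrightarrow> grad \<phi> x = 0"
proof -
  have s: "smooth_on UNIV \<phi>" and K: "compact (tsupp \<phi>)" "tsupp \<phi> \<subseteq> \<Omega>" using t by (auto simp: test_fun_def)
  note g = smooth_on_has_grad[OF s]
  show "loc_int \<Omega> b \<Longrightarrow> integrable lebesgue (\<lambda>x. b x * \<phi> x)"
    by (rule integrable_loc_int_mult[OF _ continuous_on_smooth[OF s] K]) (auto intro: tsupp_eq_0)
  show "integrable lebesgue (\<lambda>x. X x \<bullet> grad \<phi> x)" if "X \<in> borel_measurable lebesgue" "loc_int \<Omega> (\<lambda>x. norm (X x))"
    unfolding inner_vec_def inner_real_def
    by (intro Bochner_Integration.integrable_sum integrable_loc_int_mult[OF loc_int_component[OF that] _ K])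
       (use g has_grad_eq_0_tsupp[OF g(1)] in \<open>auto intro!: continuous_intros\<close>)
  show "x \<notin> \<Omega> \<Longrightarrow> \<phi> x = 0" using K tsupp_eq_0 by blast
  show "x \<notin> \<Omega> \<Longrightarrow> grad \<phi> x = 0" using K has_grad_eq_0_tsupp[OF g(1)] by blast
qed

lemma loc_int_of_powr:
  fixes X :: "real^'n \<Rightarrow> real^'n"
  assumes "X \<in> borel_measurable lebesgue" "loc_int \<Omega> (\<lambda>x. norm (X x) powr r)" "r \<ge> 1"
  shows "loc_int \<Omega> (\<lambda>x. norm (X x))"
proof (rule loc_int_bound[OF loc_int_add[OF loc_int_const[of \<Omega> 1] assms(2)]])
  show "(\<lambda>x. norm (X x)) \<in> borel_measurable lebesgue" using assms(1) by measurable
qed (use assms(3) in \<open>auto intro!: AE_I2 le_one_plus_powr\<close>)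

lemma LINT_lebesgue_on:
  "\<Omega> \<in> sets lebesgue \<Longrightarrow> (LINT x:\<Omega>|lebesgue. (f x::real)) = (LINT x|lebesgue_on \<Omega>. f x)"
  by (simp add: set_lebesgue_integral_def integral_restrict_space)

text \<open>Cut-offs are only C1, because the step function from which they are made is only C1;
  \<open>weak_ineq_C1\<close> bridges the gap to smooth test functions.\<close>

definition cutoff :: "(real^'n) set \<Rightarrow> (real^'n \<Rightarrow> real) \<Rightarrow> (real^'n \<Rightarrow> real^'n) \<Rightarrow> bool" where
  "cutoff \<Omega> \<eta> D \<longleftrightarrow> has_grad \<eta> D \<and> continuous_on UNIV D \<and> compact (tsupp \<eta>) \<and> tsupp \<eta> \<subseteq> \<Omega> \<and> (\<forall>x. 0 \<le> \<eta> x)"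

text \<open>Derivative bounds are asked only away from the axes: for \<open>\<gamma> > 1\<close> the
  derivative of \<open>t powr (1 / \<gamma>)\<close> is unbounded near 0, but on compact sets the
  functions inserted are bounded below.\<close>

definition admissible :: "(real \<Rightarrow> real \<Rightarrow> real) \<Rightarrow> (real \<Rightarrow> real \<Rightarrow> real) \<Rightarrow> (real \<Rightarrow> real \<Rightarrow> real) \<Rightarrow> bool" where
  "admissible T T1 T2 \<longleftrightarrow> C1_quadrant T T1 T2 \<and> (\<exists>B. \<forall>s>0. \<forall>t>0. 0 \<le> T s t \<and> T s t \<le> B) \<and>
     (\<forall>c>0. \<exists>B. \<forall>s\<ge>c. \<forall>t\<ge>c. \<bar>T1 s t\<bar> \<le> B \<and> \<bar>T2 s t\<bar> \<le> B)"

text \<open>All nonlinearities tested have the form \<open>F (a s + b t)\<close>, so two-variable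
  differentiability reduces to one-variable derivatives once and for all.\<close>

lemma C1_quadrant_sum:
  assumes a: "\<And>s. s > 0 \<Longrightarrow> (a has_real_derivative a' s) (at s)" "continuous_on {0<..} a'"
      "a \<in> borel_measurable borel" "a' \<in> borel_measurable borel"
    and b: "\<And>s. s > 0 \<Longrightarrow> (b has_real_derivative b' s) (at s)" "continuous_on {0<..} b'"
      "b \<in> borel_measurable borel" "b' \<in> borel_measurable borel"
    and F: "\<And>s. (F has_real_derivative F' s) (at s)" "continuous_on UNIV F'"
  shows "C1_quadrant (\<lambda>s t. F (a s + b t)) (\<lambda>s t. F' (a s + b t) * a' s) (\<lambda>s t. F' (a s + b t) * b' t)"
proof -
  have Fc: "continuous_on UNIV F" by (meson DERIV_isCont F(1) continuous_at_imp_continuous_on)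
  note [measurable] = a(3,4) b(3,4) borel_measurable_continuous_onI[OF F(2)] borel_measurable_continuous_onI[OF Fc]
  have fs[measurable]: "fst \<in> borel_measurable (borel :: (real \<times> real) measure)" "snd \<in> borel_measurable (borel :: (real \<times> real) measure)"
    by (intro borel_measurable_continuous_onI continuous_intros)+
  have ac: "continuous_on {0<..} a" "continuous_on {0<..} b"
    using a(1) b(1) by (auto intro!: continuous_at_imp_continuous_on DERIV_isCont)
  show ?thesis unfolding C1_quadrant_def
  proof (intro conjI allI impI)
    fix s t :: real assume s: "s > 0" "t > 0"
    have "((\<lambda>z. a (fst z) + b (snd z)) has_derivative (\<lambda>z. a' s * fst z + b' t * snd z)) (at (s, t))"
    proof (intro has_derivative_add)
      show "((\<lambda>z. a (fst z)) has_derivative (\<lambda>z. a' s * fst z)) (at (s, t))"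
        by (rule has_derivative_compose[where f=fst, OF has_derivative_fst[OF has_derivative_ident]])
           (use a(1)[OF s(1)] in \<open>simp add: has_field_derivative_def\<close>)
      show "((\<lambda>z. b (snd z)) has_derivative (\<lambda>z. b' t * snd z)) (at (s, t))"
        by (rule has_derivative_compose[where f=snd, OF has_derivative_snd[OF has_derivative_ident]])
           (use b(1)[OF s(2)] in \<open>simp add: has_field_derivative_def\<close>)
    qed
    hence "((\<lambda>z. F (a (fst z) + b (snd z))) has_derivative (\<lambda>z. F' (a s + b t) * (a' s * fst z + b' t * snd z))) (at (s, t))"
      by (rule has_derivative_compose) (use F(1)[of "a s + b t"] in \<open>simp add: has_field_derivative_def\<close>)
    thus "((\<lambda>z. F (a (fst z) + b (snd z))) has_derivative
         (\<lambda>z. F' (a s + b t) * a' s * fst z + F' (a s + b t) * b' t * snd z)) (at (s, t))"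
      by (simp add: distrib_left mult.assoc)
  next
    show "continuous_on ({0<..} \<times> {0<..}) (\<lambda>z. F' (a (fst z) + b (snd z)) * a' (fst z))"
      "continuous_on ({0<..} \<times> {0<..}) (\<lambda>z. F' (a (fst z) + b (snd z)) * b' (snd z))"
      by (intro continuous_on_mult continuous_on_compose2[OF F(2)] continuous_on_add
          continuous_on_compose2[OF ac(1)] continuous_on_compose2[OF ac(2)]
          continuous_on_compose2[OF a(2)] continuous_on_compose2[OF b(2)] continuous_intros; auto)+
  qed measurable
qed

section \<open>The comparison argument\<close>

text \<open>The right-hand sides are abstracted to \<open>bu\<close> and \<open>bv\<close>. What
  survives of the singular source is local integrability, the sign of \<open>bv\<close>, and
  \<open>bu \<le> bv\<close> where \<open>v < u\<close>. \<open>G\<close> is the weak gradient of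
  \<open>u powr \<gamma>\<close>, and \<open>\<psi>\<close> are the test functions that realise its
  zero boundary values.\<close>

locale sub_super_pair =
  fixes \<Omega> :: "(real^'n) set" and p q \<gamma> :: real and u v :: "real^'n \<Rightarrow> real" and gu gv G :: "real^'n \<Rightarrow> real^'n"
    and bu bv :: "real^'n \<Rightarrow> real" and \<psi> :: "nat \<Rightarrow> real^'n \<Rightarrow> real"
  assumes open_\<Omega>: "open \<Omega>" and bounded_\<Omega>: "bounded \<Omega>" and q1: "1 < q" and qp: "q < p" and \<gamma>1: "1 \<le> \<gamma>"
    and u: "weak_grad \<Omega> u gu" "loc_int \<Omega> (\<lambda>x. norm (gu x) powr p)" "loc_bdd_below \<Omega> u"
    and v: "weak_grad \<Omega> v gv" "loc_int \<Omega> (\<lambda>x. norm (gv x) powr p)" "loc_bdd_below \<Omega> v"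
    and bu: "loc_int \<Omega> bu" and bv: "loc_int \<Omega> bv"
    and rhs: "AE x in lebesgue_on \<Omega>. 0 \<le> bv x \<and> (v x < u x \<longrightarrow> bu x \<le> bv x)"
    and sub: "\<And>\<phi>. test_fun \<Omega> \<phi> \<Longrightarrow> (\<And>x. 0 \<le> \<phi> x) \<Longrightarrow>
       (LINT x:\<Omega>|lebesgue. flux p q (gu x) \<bullet> grad \<phi> x) \<le> (LINT x:\<Omega>|lebesgue. bu x * \<phi> x)"
    and super: "\<And>\<phi>. test_fun \<Omega> \<phi> \<Longrightarrow> (\<And>x. 0 \<le> \<phi> x) \<Longrightarrow>
       (LINT x:\<Omega>|lebesgue. bv x * \<phi> x) \<le> (LINT x:\<Omega>|lebesgue. flux p q (gv x) \<bullet> grad \<phi> x)"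
    and w: "weak_grad \<Omega> (\<lambda>x. u x powr \<gamma>) G"
    and wp: "integrable (lebesgue_on \<Omega>) (\<lambda>x. \<bar>u x powr \<gamma>\<bar> powr p)" "integrable (lebesgue_on \<Omega>) (\<lambda>x. norm (G x) powr p)"
    and \<psi>: "\<And>k. test_fun \<Omega> (\<psi> k)"
    and \<psi>_lim: "(\<lambda>k. LINT x|lebesgue_on \<Omega>. \<bar>\<psi> k x - u x powr \<gamma>\<bar> powr p) \<longlonglongrightarrow> 0"
      "(\<lambda>k. LINT x|lebesgue_on \<Omega>. norm (grad (\<psi> k) x - G x) powr p) \<longlonglongrightarrow> 0"
begin

abbreviation "L \<equiv> lebesgue_on \<Omega>"

lemma p1: "1 < p" using q1 qp by simp

lemma sets_\<Omega>[simp]: "\<Omega> \<in> sets lebesgue"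
  using open_\<Omega> by simp

lemma space_L[simp]: "space L = \<Omega>" by (simp add: space_restrict_space)

lemma AE_L: "(AE x in L. Q x) \<longleftrightarrow> (AE x in lebesgue. x \<in> \<Omega> \<longrightarrow> Q x)"
  by (simp add: AE_restrict_space_iff)

lemma measurable_L: "f \<in> borel_measurable lebesgue \<Longrightarrow> f \<in> borel_measurable L"
  by (rule measurable_restrict_space1)

lemma finite_L: "finite_measure L"
proof
  have "emeasure lborel \<Omega> < \<infinity>" by (rule emeasure_bounded_finite[OF bounded_\<Omega>])
  thus "emeasure L (space L) \<noteq> \<infinity>" using open_\<Omega> by (simp add: emeasure_restrict_space)
qed

lemma integrable_const_L: "integrable L (\<lambda>x. c::real)"
proof -
  interpret finite_measure L by (rule finite_L)
  show ?thesis by simp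
qed

lemma gu_m: "gu \<in> borel_measurable lebesgue" and gv_m: "gv \<in> borel_measurable lebesgue"
  and u_m: "u \<in> borel_measurable lebesgue" and v_m: "v \<in> borel_measurable lebesgue" and G_m: "G \<in> borel_measurable lebesgue"
  using weak_grad_loc_int(3)[OF u(1)] weak_grad_loc_int(3)[OF v(1)] weak_grad_loc_int(3)[OF w]
    loc_intD(2)[OF weak_grad_loc_int(1)[OF u(1)]] loc_intD(2)[OF weak_grad_loc_int(1)[OF v(1)]] by auto

lemma flux_m:
  assumes [measurable]: "g \<in> borel_measurable M"
  shows "(\<lambda>x. flux p q (g x :: real^'n)) \<in> borel_measurable M"
  unfolding flux_def by measurable

lemmas L_measurable[measurable] = measurable_L[OF gu_m] measurable_L[OF gv_m] measurable_L[OF u_m] measurable_L[OF v_m]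
  measurable_L[OF G_m] flux_m[OF measurable_L[OF gu_m]] flux_m[OF measurable_L[OF gv_m]]

lemma positive: "AE x in L. 0 < u x \<and> 0 < v x"
  using loc_bdd_below_pos[OF open_\<Omega> u(3)] loc_bdd_below_pos[OF open_\<Omega> v(3)]
  unfolding AE_L by eventually_elim simp

section \<open>Integral inequalities for nonlinear test functions\<close>

lemma flux_loc_int:
  assumes "g \<in> borel_measurable lebesgue" "loc_int \<Omega> (\<lambda>x. norm (g x) powr p)"
  shows "loc_int \<Omega> (\<lambda>x. norm (flux p q (g x :: real^'n)) powr (p / (p - 1)))"
proof (rule loc_int_bound[OF loc_int_cmult[OF loc_int_cmult[OF loc_int_add[OF loc_int_const assms(2)]]]])
  note [measurable] = flux_m[OF assms(1)]
  show "(\<lambda>x. norm (flux p q (g x)) powr (p / (p - 1))) \<in> borel_measurable lebesgue" by measurable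
  show "AE x in lebesgue. x \<in> K \<longrightarrow> \<bar>norm (flux p q (g x)) powr (p / (p - 1))\<bar>
     \<le> 2 powr (p / (p - 1)) * (3 powr (p / (p - 1)) * (1 + norm (g x) powr p))" for K
    by (intro AE_I2 impI, subst abs_of_nonneg[OF powr_ge_zero], rule norm_flux_powr_le[OF q1 qp])
qed

lemma flux_norm_loc_int:
  assumes "g \<in> borel_measurable lebesgue" "loc_int \<Omega> (\<lambda>x. norm (g x) powr p)"
  shows "loc_int \<Omega> (\<lambda>x. norm (flux p q (g x :: real^'n)))"
  by (rule loc_int_of_powr[OF flux_m[OF assms(1)] flux_loc_int[OF assms]]) (use p1 in \<open>simp add: field_simps\<close>)

text \<open>The first argument of \<open>T\<close> is always \<open>u\<close>; the second function
  \<open>z\<close> is left open because it is \<open>v\<close> in the comparison and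
  \<open>u powr \<gamma>\<close> in the identification of the weak gradient.\<close>

lemma composite_ineq:
  fixes X :: "real^'n \<Rightarrow> real^'n"
  assumes X: "X \<in> borel_measurable lebesgue" "loc_int \<Omega> (\<lambda>x. norm (X x) powr (p / (p - 1)))" and b: "loc_int \<Omega> b"
    and ineq: "\<And>\<phi>. test_fun \<Omega> \<phi> \<Longrightarrow> (\<And>x. 0 \<le> \<phi> x) \<Longrightarrow>
       (LINT x:\<Omega>|lebesgue. X x \<bullet> grad \<phi> x) \<le> (LINT x:\<Omega>|lebesgue. b x * \<phi> x)"
    and z: "weak_grad \<Omega> z gz" "loc_int \<Omega> (\<lambda>x. norm (gz x) powr p)" "loc_bdd_below \<Omega> z"
    and \<eta>: "cutoff \<Omega> \<eta> D" and T: "admissible T T1 T2"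
  shows "(LINT x|L. X x \<bullet> (T (u x) (z x) *\<^sub>R D x + \<eta> x *\<^sub>R (T1 (u x) (z x) *\<^sub>R gu x + T2 (u x) (z x) *\<^sub>R gz x)))
     \<le> (LINT x|L. b x * (\<eta> x * T (u x) (z x)))"
proof -
  obtain B where B: "\<And>s t. 0 < s \<Longrightarrow> 0 < t \<Longrightarrow> 0 \<le> T s t \<and> T s t \<le> B"
    using T unfolding admissible_def by blast
  have TC: "C1_quadrant T T1 T2" "\<And>c. 0 < c \<Longrightarrow> \<exists>B. \<forall>s\<ge>c. \<forall>t\<ge>c. \<bar>T1 s t\<bar> \<le> B \<and> \<bar>T2 s t\<bar> \<le> B"
    using T unfolding admissible_def by blast+
  have c: "has_grad \<eta> D" "continuous_on UNIV D" "compact (tsupp \<eta>)" "tsupp \<eta> \<subseteq> \<Omega>" "\<And>x. 0 \<le> \<eta> x"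
    using \<eta> unfolding cutoff_def by blast+
  have out: "\<eta> x = 0" "D x = 0" if "x \<notin> \<Omega>" for x
    using that c(4) tsupp_eq_0 has_grad_eq_0_tsupp[OF c(1)] by blast+
  note main = weak_ineq_composite[OF open_\<Omega> p1 X b ineq u z c TC(1) B TC(2)]
  show ?thesis unfolding LINT_lebesgue_on[OF sets_\<Omega>, symmetric]
    by (subst (1 2) LINT_set_support) (use main out in auto)
qed

text \<open>The two weak inequalities are subtracted. Where the test function does not vanish,
  \<open>v < u\<close>, so the right-hand sides compare with the favourable sign and drop
  out.\<close>

lemma comparison_ineq:
  assumes \<eta>: "cutoff \<Omega> \<eta> D" and T: "admissible T T1 T2"
    and supp: "\<And>s t. 0 < s \<Longrightarrow> 0 < t \<Longrightarrow> s \<le> t \<Longrightarrow> T s t = 0"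
  shows "(LINT x|L. (flux p q (gu x) - flux p q (gv x)) \<bullet>
     (T (u x) (v x) *\<^sub>R D x + \<eta> x *\<^sub>R (T1 (u x) (v x) *\<^sub>R gu x + T2 (u x) (v x) *\<^sub>R gv x))) \<le> 0"
proof -
  let ?X = "\<lambda>x. flux p q (gu x) - flux p q (gv x)"
  have Xm: "?X \<in> borel_measurable lebesgue"
    by (intro borel_measurable_diff flux_m gu_m gv_m)
  have Xl: "loc_int \<Omega> (\<lambda>x. norm (?X x) powr (p / (p - 1)))"
  proof (rule loc_int_bound[OF loc_int_cmult[OF loc_int_add[OF loc_int_add[OF loc_int_const u(2)] v(2)]]])
    show "(\<lambda>x. norm (?X x) powr (p / (p - 1))) \<in> borel_measurable lebesgue" using Xm by measurable
    show "AE x in lebesgue. x \<in> K \<longrightarrow> \<bar>norm (?X x) powr (p / (p - 1))\<bar> \<le>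
        (2 * 2 * 3) powr (p / (p - 1)) * (2 + norm (gu x) powr p + norm (gv x) powr p)" for K
      by (intro AE_I2 impI, subst abs_of_nonneg[OF powr_ge_zero], rule norm_flux_diff_powr_le[OF q1 qp])
  qed
  have "(LINT x|L. ?X x \<bullet> (T (u x) (v x) *\<^sub>R D x + \<eta> x *\<^sub>R (T1 (u x) (v x) *\<^sub>R gu x + T2 (u x) (v x) *\<^sub>R gv x)))
     \<le> (LINT x|L. (bu x - bv x) * (\<eta> x * T (u x) (v x)))"
  proof (rule composite_ineq[OF Xm Xl loc_int_diff[OF bu bv] _ v \<eta> T])
    fix \<phi> assume t: "test_fun \<Omega> \<phi>" and nn: "\<And>x. 0 \<le> \<phi> x"
    note ti = test_fun_integrable[OF t]
    have b: "integrable lebesgue (\<lambda>x. bu x * \<phi> x)" "integrable lebesgue (\<lambda>x. bv x * \<phi> x)"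
      by (intro ti bu bv)+
    have f: "integrable lebesgue (\<lambda>x. flux p q (gu x) \<bullet> grad \<phi> x)" "integrable lebesgue (\<lambda>x. flux p q (gv x) \<bullet> grad \<phi> x)"
      by (intro ti flux_m gu_m gv_m flux_norm_loc_int u(2) v(2))+
    have su: "(LINT x|lebesgue. flux p q (gu x) \<bullet> grad \<phi> x) \<le> (LINT x|lebesgue. bu x * \<phi> x)"
      using sub[OF t nn] by (subst (asm) (1 2) LINT_set_support) (simp_all add: ti)
    have sv: "(LINT x|lebesgue. bv x * \<phi> x) \<le> (LINT x|lebesgue. flux p q (gv x) \<bullet> grad \<phi> x)"
      using super[OF t nn] by (subst (asm) (1 2) LINT_set_support) (simp_all add: ti)
    have "(LINT x|lebesgue. ?X x \<bullet> grad \<phi> x) \<le> (LINT x|lebesgue. (bu x - bv x) * \<phi> x)"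
      unfolding inner_diff_left left_diff_distrib using b f su sv by simp
    thus "(LINT x:\<Omega>|lebesgue. ?X x \<bullet> grad \<phi> x) \<le> (LINT x:\<Omega>|lebesgue. (bu x - bv x) * \<phi> x)"
      by (subst (1 2) LINT_set_support) (simp_all add: ti)
  qed
  \<comment> \<open>The sign is read off from the negated integrand: a pointwise sign passes to the
    integral in any case, since a non-integrable function has integral 0 by convention.\<close>
  also have "(LINT x|L. (bu x - bv x) * (\<eta> x * T (u x) (v x))) \<le> 0"
  proof -
    have "AE x in L. 0 \<le> (bv x - bu x) * (\<eta> x * T (u x) (v x))"
      using rhs positive
    proof eventually_elim
      case (elim x)
      obtain B where "0 \<le> T (u x) (v x)" using elim T unfolding admissible_def by blast
      moreover have "0 \<le> \<eta> x" using \<eta> by (simp add: cutoff_def)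
      ultimately show ?case using elim supp[of "u x" "v x"] by (cases "u x \<le> v x") auto
    qed
    hence "0 \<le> (LINT x|L. (bv x - bu x) * (\<eta> x * T (u x) (v x)))" by (rule integral_nonneg_AE)
    also have "\<dots> = (LINT x|L. - ((bu x - bv x) * (\<eta> x * T (u x) (v x))))"
      by (intro Bochner_Integration.integral_cong) (simp_all add: algebra_simps)
    finally show ?thesis by simp
  qed
  finally show ?thesis .
qed

text \<open>The source term of \<open>v\<close> is nonnegative, so it can be discarded for every
  nonnegative nonlinearity \<open>T\<close>.\<close>

lemma super_ineq:
  assumes \<eta>: "cutoff \<Omega> \<eta> D" and T: "admissible T T1 T2"
  shows "0 \<le> (LINT x|L. flux p q (gv x) \<bullet>
     (T (u x) (v x) *\<^sub>R D x + \<eta> x *\<^sub>R (T1 (u x) (v x) *\<^sub>R gu x + T2 (u x) (v x) *\<^sub>R gv x)))"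
proof -
  let ?X = "\<lambda>x. - flux p q (gv x)"
  have Xm: "?X \<in> borel_measurable lebesgue"
    by (intro borel_measurable_uminus flux_m gv_m)
  have Xl: "loc_int \<Omega> (\<lambda>x. norm (?X x) powr (p / (p - 1)))"
    using flux_loc_int[OF gv_m v(2)] by simp
  have "(LINT x|L. ?X x \<bullet> (T (u x) (v x) *\<^sub>R D x + \<eta> x *\<^sub>R (T1 (u x) (v x) *\<^sub>R gu x + T2 (u x) (v x) *\<^sub>R gv x)))
     \<le> (LINT x|L. (- 1 * bv x) * (\<eta> x * T (u x) (v x)))"
  proof (rule composite_ineq[OF Xm Xl loc_int_cmult[OF bv] _ v \<eta> T])
    fix \<phi> assume t: "test_fun \<Omega> \<phi>" and nn: "\<And>x. 0 \<le> \<phi> x"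
    note ti = test_fun_integrable[OF t]
    have "(LINT x|lebesgue. bv x * \<phi> x) \<le> (LINT x|lebesgue. flux p q (gv x) \<bullet> grad \<phi> x)"
      using super[OF t nn] by (subst (asm) (1 2) LINT_set_support) (simp_all add: ti)
    thus "(LINT x:\<Omega>|lebesgue. ?X x \<bullet> grad \<phi> x) \<le> (LINT x:\<Omega>|lebesgue. (- 1 * bv x) * \<phi> x)"
      by (subst (1 2) LINT_set_support) (simp_all add: ti)
  qed
  moreover have "0 \<le> (LINT x|L. bv x * (\<eta> x * T (u x) (v x)))"
  proof (rule integral_nonneg_AE)
    show "AE x in L. 0 \<le> bv x * (\<eta> x * T (u x) (v x))"
      using rhs positive
    proof eventually_elim
      case (elim x)
      have "0 \<le> T (u x) (v x)" using elim T unfolding admissible_def by blast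
      moreover have "0 \<le> \<eta> x" using \<eta> by (simp add: cutoff_def)
      ultimately show ?case using elim by auto
    qed
  qed
  ultimately show ?thesis by simp
qed

text \<open>The field \<open>x $ i *\<^sub>R axis i 1\<close> has divergence 1.\<close>

lemma divergence_ineq:
  assumes \<eta>: "cutoff \<Omega> \<eta> D" and T: "admissible T T1 T2"
  shows "(LINT x|L. \<eta> x * T (u x) (v x)) \<le> - (LINT x|L. x $ i *
     (T (u x) (v x) *\<^sub>R D x + \<eta> x *\<^sub>R (T1 (u x) (v x) *\<^sub>R gu x + T2 (u x) (v x) *\<^sub>R gv x)) $ i)"
proof -
  let ?X = "\<lambda>x::real^'n. x $ i *\<^sub>R axis i (1::real)"
  have Xc: "continuous_on UNIV ?X" by (intro continuous_intros)
  have Xm: "?X \<in> borel_measurable lebesgue" by (rule borel_measurable_lebesgue_continuous[OF Xc])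
  have Xl: "loc_int \<Omega> (\<lambda>x. norm (?X x) powr (p / (p - 1)))"
  proof -
    obtain B where B: "\<And>x. x \<in> \<Omega> \<Longrightarrow> norm x \<le> B" using bounded_\<Omega> bounded_iff by blast
    show ?thesis
    proof (rule loc_int_bound[OF loc_int_const[of \<Omega> "B powr (p / (p - 1))"]])
      show "(\<lambda>x. norm (?X x) powr (p / (p - 1))) \<in> borel_measurable lebesgue" using Xm by measurable
      show "AE x in lebesgue. x \<in> K \<longrightarrow> \<bar>norm (?X x) powr (p / (p - 1))\<bar> \<le> B powr (p / (p - 1))" if "K \<subseteq> \<Omega>" for K
      proof (intro AE_I2 impI)
        fix x assume "x \<in> K"
        hence "\<bar>x $ i\<bar> \<le> B" using B[of x] component_le_norm_cart[of x i] that by fastforce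
        thus "\<bar>norm (?X x) powr (p / (p - 1))\<bar> \<le> B powr (p / (p - 1))"
          using p1 by (simp add: powr_mono2)
      qed
    qed
  qed
  have "(LINT x|L. ?X x \<bullet> (T (u x) (v x) *\<^sub>R D x + \<eta> x *\<^sub>R (T1 (u x) (v x) *\<^sub>R gu x + T2 (u x) (v x) *\<^sub>R gv x)))
     \<le> (LINT x|L. (- 1) * (\<eta> x * T (u x) (v x)))"
  proof (rule composite_ineq[OF Xm Xl loc_int_const _ v \<eta> T])
    fix \<phi> assume t: "test_fun \<Omega> \<phi>"
    note ti = test_fun_integrable[OF t]
    have s: "smooth_on UNIV \<phi>" and K: "compact (tsupp \<phi>)" using t by (auto simp: test_fun_def)
    note g = smooth_on_has_grad[OF s]
    obtain R where R: "\<And>x. norm x > R \<Longrightarrow> \<phi> x = 0" using K compact_tsupp_iff by blast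
    \<comment> \<open>For this field the weak inequality is an identity: the partial derivative of
      \<open>x $ i * \<phi> x\<close> in direction \<open>i\<close> is
      \<open>?X x \<bullet> grad \<phi> x + \<phi> x\<close>, and its integral vanishes.\<close>
    let ?D = "\<lambda>x. x $ i *\<^sub>R grad \<phi> x + \<phi> x *\<^sub>R axis i 1"
    have hg: "has_grad (\<lambda>x. x $ i * \<phi> x) ?D"
      unfolding has_grad_def
    proof
      fix x :: "real^'n"
      have "((\<lambda>x. x $ i) has_derivative (\<lambda>h. h $ i)) (at x)"
        by (intro bounded_linear_imp_has_derivative bounded_linear_vec_nth)
      from has_derivative_mult[OF this has_gradD[OF g(1)]]
      show "((\<lambda>x. x $ i * \<phi> x) has_derivative (\<bullet>) (?D x)) (at x)"
        by (rule has_derivative_eq_rhs) (simp add: fun_eq_iff inner_add_left inner_axis' mult.commute)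
    qed
    have c: "continuous_on UNIV ?D" by (intro continuous_intros g continuous_on_smooth[OF s])
    have "(LINT x|lebesgue. ?D x $ i) = 0"
      by (rule integral_partial_eq_0[OF hg c, of R]) (simp add: R)
    moreover have "?D x $ i = ?X x \<bullet> grad \<phi> x + 1 * \<phi> x" for x
      by (simp add: inner_axis')
    moreover have "integrable lebesgue (\<lambda>x. ?X x \<bullet> grad \<phi> x)"
      by (rule ti(2)[OF Xm loc_int_of_powr[OF Xm Xl]]) (use p1 in \<open>simp add: field_simps\<close>)
    moreover have "integrable lebesgue (\<lambda>x. 1 * \<phi> x)" by (rule ti(1)[OF loc_int_const])
    ultimately have "(LINT x|lebesgue. ?X x \<bullet> grad \<phi> x) + (LINT x|lebesgue. 1 * \<phi> x) = 0"
      by (simp only: Bochner_Integration.integral_add)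
    hence "(LINT x|lebesgue. ?X x \<bullet> grad \<phi> x) \<le> (LINT x|lebesgue. (- 1) * \<phi> x)" by simp
    thus "(LINT x:\<Omega>|lebesgue. ?X x \<bullet> grad \<phi> x) \<le> (LINT x:\<Omega>|lebesgue. (- 1) * \<phi> x)"
      by (subst (1 2) LINT_set_support) (simp_all add: ti)
  qed
  thus ?thesis by (simp add: inner_axis')
qed

section \<open>The weak gradient of \<open>u powr \<gamma>\<close>\<close>

lemma loc_bdd_below_w: "loc_bdd_below \<Omega> (\<lambda>x. u x powr \<gamma>)"
  unfolding loc_bdd_below_def
proof (intro allI impI)
  fix K assume "compact K \<and> K \<subseteq> \<Omega>"
  then obtain c where c: "c > 0" "AE x in lebesgue. x \<in> K \<longrightarrow> c \<le> u x" using u(3) unfolding loc_bdd_below_def by blast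
  have "AE x in lebesgue. x \<in> K \<longrightarrow> c powr \<gamma> \<le> u x powr \<gamma>"
    using c(2) by eventually_elim (use c(1) \<gamma>1 in \<open>auto intro: powr_mono2\<close>)
  thus "\<exists>C>0. AE x in lebesgue. x \<in> K \<longrightarrow> C \<le> u x powr \<gamma>" using c(1) by (intro exI[of _ "c powr \<gamma>"]) auto
qed

lemma G_loc_int: "loc_int \<Omega> (\<lambda>x. norm (G x) powr p)"
  unfolding loc_int_def
proof (intro conjI allI impI)
  note [measurable] = G_m
  show "(\<lambda>x. norm (G x) powr p) \<in> borel_measurable lebesgue" by measurable
  fix K assume K: "compact K \<and> K \<subseteq> \<Omega>"
  have "set_integrable lebesgue \<Omega> (\<lambda>x. norm (G x) powr p)"
    using wp(2) by (simp add: set_integrable_def integrable_restrict_space)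
  hence "set_integrable lebesgue K (\<lambda>x. norm (G x) powr p)"
    by (rule set_integrable_subset) (use K compact_sets_lebesgue in auto)
  thus "integrable lebesgue (\<lambda>x. indicator K x * norm (G x) powr p)" by (simp add: set_integrable_def)
qed

text \<open>
  This function is constant along \<open>t = s powr \<gamma>\<close>; applied to the pair \<open>(u, u powr \<gamma>)\<close> it yields the
  relation between the weak gradients of the two components.
\<close>

lemma admissible_exp_diff:
  "admissible (\<lambda>s t. 2 + (exp (- s) + - exp (- (t powr (1 / \<gamma>))))) (\<lambda>s t. 1 * (- exp (- s)))
     (\<lambda>s t. 1 * (exp (- (t powr (1 / \<gamma>))) * (1 / \<gamma> * t powr (1 / \<gamma> - 1))))"
  unfolding admissible_def
proof (intro conjI allI impI)
  show "C1_quadrant (\<lambda>s t. 2 + (exp (- s) + - exp (- (t powr (1 / \<gamma>))))) (\<lambda>s t. 1 * (- exp (- s)))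
     (\<lambda>s t. 1 * (exp (- (t powr (1 / \<gamma>))) * (1 / \<gamma> * t powr (1 / \<gamma> - 1))))"
    by (rule C1_quadrant_sum[where F="\<lambda>x. 2 + x" and F'="\<lambda>_. 1"])
       (use \<gamma>1 in \<open>auto intro!: derivative_eq_intros continuous_intros\<close>)
  \<comment> \<open>The summand 2 secures nonnegativity, and the exponentials make the difference of
    two unbounded quantities bounded.\<close>
  have "\<forall>s>0. \<forall>t>0. 0 \<le> 2 + (exp (- s) + - exp (- (t powr (1 / \<gamma>)))) \<and> 2 + (exp (- s) + - exp (- (t powr (1 / \<gamma>)))) \<le> 3"
  proof (intro allI impI)
    fix s t :: real assume "s > 0" "t > 0"
    have "0 < exp (- s)" "exp (- s) \<le> 1" "0 < exp (- (t powr (1 / \<gamma>)))" "exp (- (t powr (1 / \<gamma>))) \<le> 1"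
      using \<open>s > 0\<close> by auto
    thus "0 \<le> 2 + (exp (- s) + - exp (- (t powr (1 / \<gamma>)))) \<and> 2 + (exp (- s) + - exp (- (t powr (1 / \<gamma>)))) \<le> 3" by linarith
  qed
  thus "\<exists>B. \<forall>s>0. \<forall>t>0. 0 \<le> 2 + (exp (- s) + - exp (- (t powr (1 / \<gamma>)))) \<and> 2 + (exp (- s) + - exp (- (t powr (1 / \<gamma>)))) \<le> B" by blast
  fix c :: real assume c: "c > 0"
  have "\<bar>1 * (- exp (- s))\<bar> \<le> 1 + 1 / \<gamma> * c powr (1 / \<gamma> - 1) \<and>
      \<bar>1 * (exp (- (t powr (1 / \<gamma>))) * (1 / \<gamma> * t powr (1 / \<gamma> - 1)))\<bar> \<le> 1 + 1 / \<gamma> * c powr (1 / \<gamma> - 1)"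
    if "s \<ge> c" "t \<ge> c" for s t
  proof -
    have "t powr (1 / \<gamma> - 1) \<le> c powr (1 / \<gamma> - 1)" using that c \<gamma>1 by (intro powr_mono2') auto
    hence "1 / \<gamma> * t powr (1 / \<gamma> - 1) \<le> 1 / \<gamma> * c powr (1 / \<gamma> - 1)" using \<gamma>1 by (intro mult_left_mono) auto
    moreover have "exp (- (t powr (1 / \<gamma>))) * (1 / \<gamma> * t powr (1 / \<gamma> - 1)) \<le> 1 * (1 / \<gamma> * t powr (1 / \<gamma> - 1))"
      using \<gamma>1 by (intro mult_right_mono) auto
    moreover have "exp (- s) \<le> 1" "0 \<le> 1 / \<gamma> * c powr (1 / \<gamma> - 1)" using that c \<gamma>1 by auto
    moreover have "0 \<le> exp (- (t powr (1 / \<gamma>))) * (1 / \<gamma> * t powr (1 / \<gamma> - 1))" using \<gamma>1 by simp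
    ultimately show ?thesis by (simp only: mult_1 abs_minus_cancel abs_exp_cancel abs_of_nonneg) linarith
  qed
  thus "\<exists>B. \<forall>s\<ge>c. \<forall>t\<ge>c. \<bar>1 * (- exp (- s))\<bar> \<le> B \<and> \<bar>1 * (exp (- (t powr (1 / \<gamma>))) * (1 / \<gamma> * t powr (1 / \<gamma> - 1)))\<bar> \<le> B"
    by blast
qed

text \<open>A chain rule obtained by testing. Along the pair \<open>(u, u powr \<gamma>)\<close> the
  function \<open>?T\<close> is constantly 2, so \<open>z i\<close> is formally a partial derivative
  of a constant. The composite inequality with constant fields shows that its integral against every
  nonnegative test function vanishes, and solving \<open>z i x = 0\<close> for
  \<open>G x $ i\<close> gives the formula.\<close>

lemma grad_power: "AE x in L. G x = (\<gamma> * u x powr (\<gamma> - 1)) *\<^sub>R gu x"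
proof -
  let ?w = "\<lambda>x. u x powr \<gamma>"
  let ?T = "\<lambda>s t. 2 + (exp (- s) + - exp (- (t powr (1 / \<gamma>))))"
  let ?T1 = "\<lambda>s t. 1 * (- exp (- s)) :: real"
  let ?T2 = "\<lambda>s t. 1 * (exp (- (t powr (1 / \<gamma>))) * (1 / \<gamma> * t powr (1 / \<gamma> - 1)))"
  note [measurable] = u_m borel_measurable_vec_nth_comp[OF gu_m] borel_measurable_vec_nth_comp[OF G_m]
  define z where "z i x = ?T1 (u x) (?w x) * gu x $ i + ?T2 (u x) (?w x) * G x $ i" for i x
  have zl: "loc_int \<Omega> (z i)" for i
  proof (rule loc_int_bound_local)
    show "loc_int \<Omega> (\<lambda>x. norm (gu x) + norm (G x))"
      by (intro loc_int_add loc_int_norm gu_m G_m weak_grad_loc_int(2)[OF u(1)] weak_grad_loc_int(2)[OF w])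
    show "z i \<in> borel_measurable lebesgue" unfolding z_def by measurable
    fix K assume K: "compact K" "K \<subseteq> \<Omega>"
    obtain c where c: "c > 0" "AE x in lebesgue. x \<in> K \<longrightarrow> c \<le> u x" using u(3) K unfolding loc_bdd_below_def by blast
    obtain d where d: "d > 0" "AE x in lebesgue. x \<in> K \<longrightarrow> d \<le> ?w x" using loc_bdd_below_w K unfolding loc_bdd_below_def by blast
    have "min c d > 0" using c(1) d(1) by simp
    then obtain B where B: "\<And>s t. s \<ge> min c d \<Longrightarrow> t \<ge> min c d \<Longrightarrow> \<bar>?T1 s t\<bar> \<le> B \<and> \<bar>?T2 s t\<bar> \<le> B"
      using admissible_exp_diff unfolding admissible_def by meson
    have "AE x in lebesgue. x \<in> K \<longrightarrow> \<bar>z i x\<bar> \<le> B * (norm (gu x) + norm (G x))"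
      using c(2) d(2)
    proof eventually_elim
      case (elim x)
      show ?case
      proof
        assume "x \<in> K"
        hence b: "\<bar>?T1 (u x) (?w x)\<bar> \<le> B" "\<bar>?T2 (u x) (?w x)\<bar> \<le> B" using elim B[of "u x" "?w x"] by auto
        have "\<bar>z i x\<bar> \<le> \<bar>?T1 (u x) (?w x)\<bar> * \<bar>gu x $ i\<bar> + \<bar>?T2 (u x) (?w x)\<bar> * \<bar>G x $ i\<bar>"
          unfolding z_def abs_mult[symmetric] by (rule abs_triangle_ineq)
        also have "\<dots> \<le> B * norm (gu x) + B * norm (G x)"
          by (intro add_mono mult_mono component_le_norm_cart b abs_ge_zero order_trans[OF abs_ge_zero b(1)])
        finally show "\<bar>z i x\<bar> \<le> B * (norm (gu x) + norm (G x))" by (simp add: distrib_left)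
      qed
    qed
    thus "\<exists>C. AE x in lebesgue. x \<in> K \<longrightarrow> \<bar>z i x\<bar> \<le> C * (norm (gu x) + norm (G x))" by blast
  qed
  have T2: "AE x in L. ?T (u x) (?w x) = 2"
    using positive by eventually_elim (use \<gamma>1 in \<open>simp add: powr_powr\<close>)
  have "AE x in lebesgue. x \<in> \<Omega> \<longrightarrow> z i x = 0" for i
  proof (rule fundamental_lemma[OF open_\<Omega> zl])
    fix \<eta> assume t: "test_fun \<Omega> \<eta>" and nn: "\<And>x. 0 \<le> \<eta> x"
    note ti = test_fun_integrable[OF t]
    have s: "smooth_on UNIV \<eta>" and K: "compact (tsupp \<eta>)" "tsupp \<eta> \<subseteq> \<Omega>" using t by (auto simp: test_fun_def)
    note g = smooth_on_has_grad[OF s]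
    have cut: "cutoff \<Omega> \<eta> (grad \<eta>)" using g K nn by (simp add: cutoff_def)
    have g0: "(LINT x|lebesgue. grad \<phi> x $ i) = 0" if "test_fun \<Omega> \<phi>" for \<phi>
    proof -
      have s: "smooth_on UNIV \<phi>" and K: "compact (tsupp \<phi>)" using that by (auto simp: test_fun_def)
      note g = smooth_on_has_grad[OF s]
      obtain R where R: "\<And>x. norm x > R \<Longrightarrow> \<phi> x = 0" using K compact_tsupp_iff by blast
      show ?thesis by (rule integral_partial_eq_0[OF g(1,2), of R]) (simp add: R)
    qed
    have gi: "integrable lebesgue (\<lambda>x. grad \<eta> x $ i)"
      using integrable_loc_int_mult[OF loc_int_const[of \<Omega> 1] _ K, of "\<lambda>x. grad \<eta> x $ i"] g has_grad_eq_0_tsupp[OF g(1)]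
      by (auto intro!: continuous_intros)
    \<comment> \<open>A constant field has no divergence, so zero is a valid right-hand side. Both
      signs of \<open>\<sigma>\<close> are used to turn the inequality into an equation.\<close>
    have le: "\<sigma> * (LINT x|lebesgue. z i x * \<eta> x) \<le> 0" for \<sigma> :: real
    proof -
      let ?X = "\<lambda>x::real^'n. \<sigma> *\<^sub>R axis i (1::real)"
      have "(LINT x|L. ?X x \<bullet> (?T (u x) (?w x) *\<^sub>R grad \<eta> x + \<eta> x *\<^sub>R (?T1 (u x) (?w x) *\<^sub>R gu x + ?T2 (u x) (?w x) *\<^sub>R G x)))
         \<le> (LINT x|L. 0 * (\<eta> x * ?T (u x) (?w x)))"
      proof (rule composite_ineq[OF _ loc_int_const loc_int_const _ w G_loc_int loc_bdd_below_w cut admissible_exp_diff])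
        fix \<phi> assume t': "test_fun \<Omega> \<phi>"
        show "(LINT x:\<Omega>|lebesgue. ?X x \<bullet> grad \<phi> x) \<le> (LINT x:\<Omega>|lebesgue. 0 * \<phi> x)"
          using g0[OF t'] by (subst (1 2) LINT_set_support) (simp_all add: test_fun_integrable[OF t'] inner_axis')
      qed simp
      also have "(LINT x|L. 0 * (\<eta> x * ?T (u x) (?w x))) = 0" by simp
      also have "(LINT x|L. ?X x \<bullet> (?T (u x) (?w x) *\<^sub>R grad \<eta> x + \<eta> x *\<^sub>R (?T1 (u x) (?w x) *\<^sub>R gu x + ?T2 (u x) (?w x) *\<^sub>R G x)))
         = (LINT x|L. \<sigma> * (2 * grad \<eta> x $ i + z i x * \<eta> x))"
      proof (rule integral_cong_AE)
        have [measurable]: "(\<lambda>x. grad \<eta> x $ i) \<in> borel_measurable L" "\<eta> \<in> borel_measurable L" "grad \<eta> \<in> borel_measurable L" "z i \<in> borel_measurable L"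
          by (intro measurable_L borel_measurable_lebesgue_continuous g(2) continuous_on_smooth[OF s] continuous_intros loc_intD(2)[OF zl])+
        show "(\<lambda>x. ?X x \<bullet> (?T (u x) (?w x) *\<^sub>R grad \<eta> x + \<eta> x *\<^sub>R (?T1 (u x) (?w x) *\<^sub>R gu x + ?T2 (u x) (?w x) *\<^sub>R G x))) \<in> borel_measurable L"
          by measurable
        show "(\<lambda>x. \<sigma> * (2 * grad \<eta> x $ i + z i x * \<eta> x)) \<in> borel_measurable L" by measurable
        show "AE x in L. ?X x \<bullet> (?T (u x) (?w x) *\<^sub>R grad \<eta> x + \<eta> x *\<^sub>R (?T1 (u x) (?w x) *\<^sub>R gu x + ?T2 (u x) (?w x) *\<^sub>R G x))
          = \<sigma> * (2 * grad \<eta> x $ i + z i x * \<eta> x)"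
          using T2
        proof eventually_elim
          case (elim x)
          show ?case unfolding elim z_def by (simp add: inner_axis' algebra_simps)
        qed
      qed
      also have "\<dots> = (LINT x|lebesgue. \<sigma> * (2 * grad \<eta> x $ i + z i x * \<eta> x))"
        unfolding LINT_lebesgue_on[OF sets_\<Omega>, symmetric] by (rule LINT_set_support) (simp add: ti)
      also have "\<dots> = \<sigma> * (2 * (LINT x|lebesgue. grad \<eta> x $ i) + (LINT x|lebesgue. z i x * \<eta> x))"
        using gi ti(1)[OF zl] by simp
      finally show ?thesis using g0[OF t] by simp
    qed
    show "(LINT x|lebesgue. z i x * \<eta> x) = 0" using le[of 1] le[of "-1"] by simp
  qed
  hence "\<forall>i. AE x in L. z i x = 0" by (simp only: AE_L) blast
  hence "AE x in L. \<forall>i. z i x = 0" by (subst AE_all_countable)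
  thus ?thesis using positive
  proof eventually_elim
    case (elim x)
    have "G x $ i = (\<gamma> * u x powr (\<gamma> - 1)) * gu x $ i" for i
    proof -
      have e: "(?w x) powr (1 / \<gamma>) = u x" "(?w x) powr (1 / \<gamma> - 1) = u x powr (1 - \<gamma>)"
        using elim \<gamma>1 by (simp_all add: powr_powr right_diff_distrib)
      have "exp (- u x) * (1 / \<gamma> * u x powr (1 - \<gamma>) * G x $ i - gu x $ i) = 0"
        using elim(1)[rule_format, of i] unfolding z_def e by (simp add: algebra_simps)
      hence "gu x $ i = 1 / \<gamma> * u x powr (1 - \<gamma>) * G x $ i" by simp
      hence "(\<gamma> * u x powr (\<gamma> - 1)) * gu x $ i = (u x powr (\<gamma> - 1) * u x powr (1 - \<gamma>)) * G x $ i" using \<gamma>1 by simp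
      also have "u x powr (\<gamma> - 1) * u x powr (1 - \<gamma>) = 1" using elim by (simp add: powr_add[symmetric])
      finally show ?thesis by simp
    qed
    thus ?case by (simp add: vec_eq_iff)
  qed
qed

end

text \<open>Fatou's lemma in a form that yields integrability of the limit from bounds on integrals
  alone. It serves where no common majorant is at hand, namely for the powers of \<open>gv\<close>
  along the sequence of cut-offs.\<close>

lemma integral_Fatou_bound:
  fixes f :: "nat \<Rightarrow> 'a \<Rightarrow> real"
  assumes f: "\<And>k. integrable M (f k)" "\<And>k. AE x in M. 0 \<le> f k x" and g: "g \<in> borel_measurable M"
    and lim: "AE x in M. (\<lambda>k. f k x) \<longlonglongrightarrow> g x" and le: "\<And>k. (LINT x|M. f k x) \<le> r k" and r: "r \<longlonglongrightarrow> s"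
  shows "integrable M g" "(LINT x|M. g x) \<le> s"
proof -
  note [measurable] = borel_measurable_integrable[OF f(1)] g
  have "AE x in M. \<forall>k. 0 \<le> f k x" by (subst AE_all_countable) (use f(2) in blast)
  hence g0: "AE x in M. 0 \<le> g x"
    using lim by eventually_elim (rule LIMSEQ_le_const, auto)
  have r0: "0 \<le> r k" for k using integral_nonneg_AE[OF f(2), of k] le[of k] by linarith
  have s0: "0 \<le> s" by (rule LIMSEQ_le_const[OF r]) (use r0 in auto)
  have "(\<integral>\<^sup>+x. ennreal (g x) \<partial>M) = (\<integral>\<^sup>+x. liminf (\<lambda>k. ennreal (f k x)) \<partial>M)"
  proof (rule nn_integral_cong_AE)
    show "AE x in M. ennreal (g x) = liminf (\<lambda>k. ennreal (f k x))"
      using lim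
    proof eventually_elim
      case (elim x)
      have "(\<lambda>k. ennreal (f k x)) \<longlonglongrightarrow> ennreal (g x)" by (rule tendsto_ennrealI[OF elim])
      thus ?case using lim_imp_Liminf[OF sequentially_bot] by metis
    qed
  qed
  also have "\<dots> \<le> liminf (\<lambda>k. \<integral>\<^sup>+x. ennreal (f k x) \<partial>M)" by (rule nn_integral_liminf) measurable
  also have "\<dots> \<le> liminf (\<lambda>k. ennreal (r k))"
  proof (rule Liminf_mono, rule always_eventually, rule allI)
    fix k
    have "(\<integral>\<^sup>+x. ennreal (f k x) \<partial>M) = ennreal (LINT x|M. f k x)"
      by (rule nn_integral_eq_integral[OF f])
    thus "(\<integral>\<^sup>+x. ennreal (f k x) \<partial>M) \<le> ennreal (r k)" using le[of k] by (simp add: ennreal_leI)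
  qed
  also have "\<dots> = ennreal s"
    by (rule lim_imp_Liminf[OF sequentially_bot tendsto_ennrealI[OF r]])
  finally have fin: "(\<integral>\<^sup>+x. ennreal (g x) \<partial>M) \<le> ennreal s" .
  show gi: "integrable M g"
    by (rule integrableI_nonneg[OF g g0]) (use fin in \<open>auto intro: le_less_trans[OF _ ennreal_less_top]\<close>)
  have "ennreal (LINT x|M. g x) \<le> ennreal s"
    using fin nn_integral_eq_integral[OF gi g0] by simp
  thus "(LINT x|M. g x) \<le> s" using s0 by simp
qed

lemma powr_mult_le_sum:
  fixes a b r :: real
  assumes "a \<ge> 0" "b \<ge> 0" "r > 1"
  shows "a powr (r - 1) * b \<le> a powr r + b powr r"
proof -
  have e: "x powr (r - 1) * x = x powr r" if "x \<ge> 0" for x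
    using norm_powr_mult_norm[OF assms(3), of x] that by simp
  show ?thesis
  proof (cases "a \<le> b")
    case True
    have "a powr (r - 1) * b \<le> b powr (r - 1) * b" using True assms by (intro mult_right_mono powr_mono2) auto
    also have "\<dots> = b powr r" by (rule e[OF assms(2)])
    finally show ?thesis by (simp add: add_increasing)
  next
    case False
    have "a powr (r - 1) * b \<le> a powr (r - 1) * a" using False assms by (intro mult_left_mono) auto
    also have "\<dots> = a powr r" by (rule e[OF assms(1)])
    finally show ?thesis by (simp add: add_increasing2)
  qed
qed

lemma tsupp_subset:
  assumes "\<And>x. g x = 0 \<Longrightarrow> f x = 0" shows "tsupp f \<subseteq> tsupp g"
  unfolding tsupp_def by (rule closure_mono) (use assms in auto)

text \<open>\<open>F 0 = 0\<close> keeps the support inside that of \<open>r\<close>, so compact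
  support in \<open>\<Omega>\<close> is inherited.\<close>

lemma cutoff_compose:
  assumes r: "has_grad r D" "continuous_on UNIV D" "compact (tsupp r)" "tsupp r \<subseteq> \<Omega>"
    and F: "\<And>s. (F has_real_derivative F' s) (at s)" "continuous_on UNIV F'" "F 0 = 0" "\<And>s. 0 \<le> F s"
  shows "cutoff \<Omega> (\<lambda>x. F (r x)) (\<lambda>x. F' (r x) *\<^sub>R D x)"
  unfolding cutoff_def
proof (intro conjI allI)
  show "has_grad (\<lambda>x. F (r x)) (\<lambda>x. F' (r x) *\<^sub>R D x)"
    unfolding has_grad_def
  proof
    fix x
    have "((\<lambda>x. F (r x)) has_derivative (\<lambda>h. F' (r x) * (D x \<bullet> h))) (at x)"
      by (rule has_derivative_compose[OF has_gradD[OF r(1)]]) (use F(1)[of "r x"] in \<open>simp add: has_field_derivative_def\<close>)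
    thus "((\<lambda>x. F (r x)) has_derivative (\<bullet>) (F' (r x) *\<^sub>R D x)) (at x)"
      by (rule has_derivative_eq_rhs) (simp add: fun_eq_iff)
  qed
  show "continuous_on UNIV (\<lambda>x. F' (r x) *\<^sub>R D x)"
    by (intro continuous_on_scaleR r(2) continuous_on_compose2[OF F(2) has_grad_continuous[OF r(1)]]) auto
  have s: "tsupp (\<lambda>x. F (r x)) \<subseteq> tsupp r" by (rule tsupp_subset) (simp add: F(3))
  thus "tsupp (\<lambda>x. F (r x)) \<subseteq> \<Omega>" using r(4) by blast
  show "compact (tsupp (\<lambda>x. F (r x)))"
    using compact_tsupp_subset[OF r(3) s] .
qed (rule F(4))

section \<open>Cut-offs along the level sets of \<open>u\<close>\<close>

context sub_super_pair
begin

lemma integrable_L: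
  fixes f :: "real^'n \<Rightarrow> real"
  shows "integrable lebesgue f \<Longrightarrow> integrable L f"
  using integrable_mult_indicator[of \<Omega> lebesgue f] by (simp add: integrable_restrict_space)

lemma integrable_diff_powr:
  fixes r g :: "real^'n \<Rightarrow> 'b::euclidean_space"
  assumes r: "continuous_on UNIV r" "compact K" "\<And>x. x \<notin> K \<Longrightarrow> r x = 0"
    and g: "g \<in> borel_measurable L" "integrable L (\<lambda>x. norm (g x) powr p)"
  shows "integrable L (\<lambda>x. norm (r x - g x) powr p)"
proof -
  obtain R where "\<And>x. x \<in> K \<Longrightarrow> norm x \<le> R" using compact_imp_bounded[OF r(2)] bounded_iff by blast
  hence "\<And>x. norm x > R \<Longrightarrow> r x = 0" using r(3) by fastforce
  then obtain B where B: "B > 0" "\<And>x. norm (r x) \<le> B" using compact_support_bounded[OF r(1), of R] by blast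
  show ?thesis
  proof (rule Bochner_Integration.integrable_bound)
    show "integrable L (\<lambda>x. 2 powr p * (B powr p + norm (g x) powr p))"
      by (intro integrable_mult_right Bochner_Integration.integrable_add integrable_const_L g)
    show "AE x in L. norm (norm (r x - g x) powr p) \<le> norm (2 powr p * (B powr p + norm (g x) powr p))"
    proof (rule AE_I2)
      fix x
      have "norm (r x - g x) powr p \<le> (B + norm (g x)) powr p"
        using B(2)[of x] p1 norm_triangle_ineq4[of "r x" "g x"] by (intro powr_mono2) auto
      also have "\<dots> \<le> 2 powr p * (B powr p + norm (g x) powr p)" using B(1) p1 by (intro powr_add_le) auto
      finally show "norm (norm (r x - g x) powr p) \<le> norm (2 powr p * (B powr p + norm (g x) powr p))" by simp
    qed
    have [measurable]: "r \<in> borel_measurable L" by (rule measurable_L[OF borel_measurable_lebesgue_continuous[OF r(1)]])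
    note [measurable] = g(1)
    show "(\<lambda>x. norm (r x - g x) powr p) \<in> borel_measurable L" by measurable
  qed
qed

text \<open>In terms of \<open>u powr \<gamma>\<close> the transition takes place between
  \<open>\<epsilon> powr \<gamma>\<close> and \<open>2 * \<epsilon> powr \<gamma>\<close>; since
  \<open>\<gamma> \<ge> 1\<close>, this lies within
  \<open>\<epsilon> \<le> u \<le> 2 * \<epsilon>\<close>.\<close>

definition cut_lim :: "real \<Rightarrow> real^'n \<Rightarrow> real" where
  "cut_lim \<epsilon> x = step_fun (u x powr \<gamma> / \<epsilon> powr \<gamma>)"

definition cut_grad :: "real \<Rightarrow> real^'n \<Rightarrow> real^'n" where
  "cut_grad \<epsilon> x = (step_fun' (u x powr \<gamma> / \<epsilon> powr \<gamma>) / \<epsilon> powr \<gamma>) *\<^sub>R G x"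

lemma cut_lim_measurable[measurable]: "cut_lim \<epsilon> \<in> borel_measurable L" "cut_grad \<epsilon> \<in> borel_measurable L"
proof -
  have [measurable]: "step_fun \<in> borel_measurable borel" "step_fun' \<in> borel_measurable borel"
    by (intro borel_measurable_continuous_onI continuous_on_step_fun'
       continuous_at_imp_continuous_on ballI DERIV_isCont[OF step_fun_deriv])+
  show "cut_lim \<epsilon> \<in> borel_measurable L" unfolding cut_lim_def by measurable
  show "cut_grad \<epsilon> \<in> borel_measurable L" unfolding cut_grad_def by measurable
qed

text \<open>One majorant \<open>\<Gamma>\<close> serves all \<open>k\<close>. It bounds the
  \<open>p\<close>-th powers of the gradients, the form in which they appear when Young's inequality
  is applied against the flux.\<close>

definition cutoff_seq :: "real \<Rightarrow> (nat \<Rightarrow> real^'n \<Rightarrow> real) \<Rightarrow> (nat \<Rightarrow> real^'n \<Rightarrow> real^'n) \<Rightarrow> (real^'n \<Rightarrow> real) \<Rightarrow> bool" where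
  "cutoff_seq \<epsilon> \<eta> D \<Gamma> \<longleftrightarrow> (\<forall>k. cutoff \<Omega> (\<eta> k) (D k)) \<and> (\<forall>k x. \<eta> k x \<le> 1) \<and> integrable L \<Gamma> \<and>
    (AE x in L. (\<lambda>k. \<eta> k x) \<longlonglongrightarrow> cut_lim \<epsilon> x \<and> (\<lambda>k. D k x) \<longlonglongrightarrow> cut_grad \<epsilon> x \<and>
       (\<forall>k. norm (D k x) powr p \<le> \<Gamma> x))"

lemma cutoff_seqD:
  assumes "cutoff_seq \<epsilon> \<eta> D \<Gamma>"
  shows "cutoff \<Omega> (\<eta> k) (D k)" "\<eta> k x \<le> 1" "integrable L \<Gamma>"
    "AE x in L. (\<lambda>k. \<eta> k x) \<longlonglongrightarrow> cut_lim \<epsilon> x \<and> (\<lambda>k. D k x) \<longlonglongrightarrow> cut_grad \<epsilon> x \<and>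
       (\<forall>k. norm (D k x) powr p \<le> \<Gamma> x)"
    "0 \<le> \<eta> k x" "\<eta> k \<in> borel_measurable L" "D k \<in> borel_measurable L" "\<Gamma> \<in> borel_measurable L"
proof -
  show c: "cutoff \<Omega> (\<eta> k) (D k)" "\<eta> k x \<le> 1" "integrable L \<Gamma>"
    "AE x in L. (\<lambda>k. \<eta> k x) \<longlonglongrightarrow> cut_lim \<epsilon> x \<and> (\<lambda>k. D k x) \<longlonglongrightarrow> cut_grad \<epsilon> x \<and>
       (\<forall>k. norm (D k x) powr p \<le> \<Gamma> x)"
    using assms unfolding cutoff_seq_def by blast+
  show "0 \<le> \<eta> k x" "\<eta> k \<in> borel_measurable L" "D k \<in> borel_measurable L"
    using c(1) unfolding cutoff_def
    by (auto intro!: measurable_L borel_measurable_lebesgue_continuous intro: has_grad_continuous)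
  show "\<Gamma> \<in> borel_measurable L" using c(3) by (rule borel_measurable_integrable)
qed

text \<open>The functions \<open>\<psi> k\<close> converge only in mean. A subsequence converges
  almost everywhere under an integrable majorant, and both properties pass through the rescaled step
  function because it is C1 with bounded derivative.\<close>

lemma cutoff_sequence:
  assumes e: "\<epsilon> > 0"
  shows "\<exists>\<eta> D \<Gamma>. cutoff_seq \<epsilon> \<eta> D \<Gamma>"
proof -
  let ?w = "\<lambda>x. u x powr \<gamma>"
  \<comment> \<open>Both errors are summed into one sequence, so that a single subsequence serves
    the functions and their gradients.\<close>
  define f where "f k x = \<bar>\<psi> k x - ?w x\<bar> powr p + norm (grad (\<psi> k) x - G x) powr p" for k x
  have sm: "smooth_on UNIV (\<psi> k)" and K: "compact (tsupp (\<psi> k))" "tsupp (\<psi> k) \<subseteq> \<Omega>" for k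
    using \<psi>[of k] by (auto simp: test_fun_def)
  note g = smooth_on_has_grad[OF sm]
  have i1: "integrable L (\<lambda>x. \<bar>\<psi> k x - ?w x\<bar> powr p)" for k
    using integrable_diff_powr[of "\<psi> k" "tsupp (\<psi> k)" ?w] continuous_on_smooth[OF sm] K(1) tsupp_eq_0 wp(1) by auto
  have i2: "integrable L (\<lambda>x. norm (grad (\<psi> k) x - G x) powr p)" for k
    using integrable_diff_powr[of "grad (\<psi> k)" "tsupp (\<psi> k)" G] g(2) K(1) has_grad_eq_0_tsupp[OF g(1)] wp(2) by auto
  have fi: "integrable L (f k)" for k unfolding f_def by (intro Bochner_Integration.integrable_add i1 i2)
  have f0: "0 \<le> f k x" for k x by (simp add: f_def)
  have "(\<lambda>k. (LINT x|L. \<bar>\<psi> k x - ?w x\<bar> powr p) + (LINT x|L. norm (grad (\<psi> k) x - G x) powr p)) \<longlonglongrightarrow> 0 + 0"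
    by (intro tendsto_add \<psi>_lim)
  hence lim: "(\<lambda>k. LINT x|L. \<bar>f k x\<bar>) \<longlonglongrightarrow> 0"
    using i1 i2 f0 by (simp add: f_def)
  obtain \<sigma> \<Gamma> where \<sigma>: "AE x in L. (\<lambda>k. f (\<sigma> k) x) \<longlonglongrightarrow> 0" and \<Gamma>: "integrable L \<Gamma>" "AE x in L. \<forall>k. \<bar>f (\<sigma> k) x\<bar> \<le> \<Gamma> x"
    by (rule L1_subseq_dominated[OF fi lim])
  let ?c = "\<epsilon> powr \<gamma>"
  have c: "?c > 0" using e by simp
  define F where "F t = step_fun (t / ?c)" for t
  define F' where "F' t = step_fun' (t / ?c) / ?c" for t
  have dF: "(F has_real_derivative F' t) (at t)" for t
  proof -
    have "((\<lambda>t. t / ?c) has_real_derivative 1 / ?c) (at t)" using c by (auto intro!: derivative_eq_intros)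
    from DERIV_chain2[OF step_fun_deriv this] show ?thesis by (simp add: F_def[abs_def] F'_def)
  qed
  have F'c: "continuous_on UNIV F'" unfolding F'_def
    by (intro continuous_intros continuous_on_compose2[OF continuous_on_step_fun']) (use c in auto)
  have Fc: "isCont F t" for t using dF DERIV_isCont by blast
  have F'i: "isCont F' t" for t using F'c by (simp add: continuous_on_eq_continuous_at)
  have F'b: "\<bar>F' t\<bar> \<le> 4 / ?c" for t
    using step_fun'_bounds(1,2)[of "t / ?c"] c by (simp add: F'_def divide_right_mono)
  define \<eta> where "\<eta> k x = F (\<psi> (\<sigma> k) x)" for k x
  define D where "D k x = F' (\<psi> (\<sigma> k) x) *\<^sub>R grad (\<psi> (\<sigma> k)) x" for k x
  have cut: "cutoff \<Omega> (\<eta> k) (D k)" for k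
    unfolding \<eta>_def D_def
    by (rule cutoff_compose[OF g(1,2) K dF F'c]) (auto simp: F_def step_fun_eq_0 step_fun_bounds)
  have \<eta>1: "\<eta> k x \<le> 1" for k x by (simp add: \<eta>_def F_def step_fun_bounds)
  define \<Gamma>' where "\<Gamma>' x = (4 / ?c) powr p * (2 powr p * (\<Gamma> x + norm (G x) powr p))" for x
  have "integrable L \<Gamma>'" unfolding \<Gamma>'_def by (intro integrable_mult_right Bochner_Integration.integrable_add \<Gamma> wp)
  moreover have "AE x in L. (\<lambda>k. \<eta> k x) \<longlonglongrightarrow> cut_lim \<epsilon> x \<and> (\<lambda>k. D k x) \<longlonglongrightarrow> cut_grad \<epsilon> x \<and> (\<forall>k. norm (D k x) powr p \<le> \<Gamma>' x)"
    using \<sigma> \<Gamma>(2)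
  proof eventually_elim
    case (elim x)
    have z: "(\<lambda>k. y k powr p) \<longlonglongrightarrow> 0 \<Longrightarrow> (\<And>k. 0 \<le> y k) \<Longrightarrow> y \<longlonglongrightarrow> 0" for y :: "nat \<Rightarrow> real"
    proof -
      assume a: "(\<lambda>k. y k powr p) \<longlonglongrightarrow> 0" "\<And>k. 0 \<le> y k"
      have "(\<lambda>k. (y k powr p) powr (1 / p)) \<longlonglongrightarrow> 0"
        by (rule tendsto_zero_powrI[OF a(1) tendsto_const]) (use p1 in auto)
      thus "y \<longlonglongrightarrow> 0" using a(2) p1 by (simp add: powr_powr)
    qed
    have "(\<lambda>k. \<bar>\<psi> (\<sigma> k) x - ?w x\<bar> powr p) \<longlonglongrightarrow> 0"
      by (rule tendsto_sandwich[OF _ _ tendsto_const elim(1)]) (auto simp: f_def)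
    from z[OF this] have "(\<lambda>k. \<psi> (\<sigma> k) x - ?w x) \<longlonglongrightarrow> 0" by (simp add: tendsto_rabs_zero_iff)
    hence 1: "(\<lambda>k. \<psi> (\<sigma> k) x) \<longlonglongrightarrow> ?w x" by (rule LIM_zero_cancel)
    have "(\<lambda>k. norm (grad (\<psi> (\<sigma> k)) x - G x) powr p) \<longlonglongrightarrow> 0"
      by (rule tendsto_sandwich[OF _ _ tendsto_const elim(1)]) (auto simp: f_def)
    from z[OF this] have "(\<lambda>k. grad (\<psi> (\<sigma> k)) x - G x) \<longlonglongrightarrow> 0" by (simp add: tendsto_norm_zero_iff)
    hence 2: "(\<lambda>k. grad (\<psi> (\<sigma> k)) x) \<longlonglongrightarrow> G x" by (rule LIM_zero_cancel)
    have "norm (D k x) powr p \<le> \<Gamma>' x" for k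
    proof -
      have "norm (D k x) \<le> 4 / ?c * norm (grad (\<psi> (\<sigma> k)) x)"
        using mult_right_mono[OF F'b norm_ge_zero] by (simp add: D_def)
      hence "norm (D k x) powr p \<le> (4 / ?c * norm (grad (\<psi> (\<sigma> k)) x)) powr p" using p1 by (intro powr_mono2) auto
      also have "\<dots> = (4 / ?c) powr p * norm (grad (\<psi> (\<sigma> k)) x) powr p" by (rule powr_mult)
      also have "norm (grad (\<psi> (\<sigma> k)) x) powr p \<le> (norm (grad (\<psi> (\<sigma> k)) x - G x) + norm (G x)) powr p"
        using p1 norm_triangle_ineq[of "grad (\<psi> (\<sigma> k)) x - G x" "G x"] by (intro powr_mono2) auto
      also have "\<dots> \<le> 2 powr p * (norm (grad (\<psi> (\<sigma> k)) x - G x) powr p + norm (G x) powr p)"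
        using p1 by (intro powr_add_le) auto
      also have "norm (grad (\<psi> (\<sigma> k)) x - G x) powr p \<le> f (\<sigma> k) x" by (simp add: f_def)
      also have "f (\<sigma> k) x \<le> \<Gamma> x" using elim(2) f0[of "\<sigma> k" x] by (metis abs_of_nonneg)
      finally show ?thesis using c by (simp add: \<Gamma>'_def mult_left_mono)
    qed
    moreover have "(\<lambda>k. \<eta> k x) \<longlonglongrightarrow> cut_lim \<epsilon> x"
      unfolding \<eta>_def using isCont_tendsto_compose[OF Fc 1] by (simp add: cut_lim_def F_def)
    moreover have "(\<lambda>k. D k x) \<longlonglongrightarrow> cut_grad \<epsilon> x"
      unfolding D_def using tendsto_scaleR[OF isCont_tendsto_compose[OF F'i 1] 2] by (simp add: cut_grad_def F'_def)
    ultimately show ?case by blast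
  qed
  ultimately show ?thesis using cut \<eta>1 unfolding cutoff_seq_def by blast
qed

lemma cut_lim_bounds: "0 \<le> cut_lim \<epsilon> x" "cut_lim \<epsilon> x \<le> 1"
  by (simp_all add: cut_lim_def step_fun_bounds)

lemma cut_eq_1:
  assumes "\<epsilon> > 0" "2 * \<epsilon> \<le> u x" shows "cut_lim \<epsilon> x = 1" "cut_grad \<epsilon> x = 0"
proof -
  have "2 * \<epsilon> powr \<gamma> \<le> 2 powr \<gamma> * \<epsilon> powr \<gamma>" using powr_mono[of 1 \<gamma> 2] \<gamma>1 by (intro mult_right_mono) auto
  also have "\<dots> = (2 * \<epsilon>) powr \<gamma>" by (simp add: powr_mult)
  also have "\<dots> \<le> u x powr \<gamma>" using assms \<gamma>1 by (intro powr_mono2) auto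
  finally have "2 \<le> u x powr \<gamma> / \<epsilon> powr \<gamma>" using assms by (simp add: le_divide_eq)
  thus "cut_lim \<epsilon> x = 1" "cut_grad \<epsilon> x = 0" by (simp_all add: cut_lim_def cut_grad_def step_fun_eq_1)
qed

text \<open>Origin of the constant: 4 bounds \<open>step_fun'\<close>, the factor
  \<open>\<gamma>\<close> comes from the chain rule, and where \<open>step_fun'\<close> is nonzero
  \<open>u powr \<gamma>\<close> is less than twice \<open>\<epsilon> powr \<gamma>\<close>, which
  accounts for \<open>2 / \<epsilon>\<close>.\<close>

lemma cut_grad_bound:
  assumes e: "\<epsilon> > 0"
  shows "AE x in L. norm (cut_grad \<epsilon> x) \<le> (if \<epsilon> \<le> u x then 8 * \<gamma> / \<epsilon> * norm (gu x) else 0)"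
  using grad_power positive
proof eventually_elim
  case (elim x)
  let ?s = "u x powr \<gamma> / \<epsilon> powr \<gamma>"
  have s: "?s = (u x / \<epsilon>) powr \<gamma>" using elim e by (simp add: powr_divide)
  show ?case
  proof (cases "step_fun' ?s = 0")
    case True
    thus ?thesis using e \<gamma>1 by (simp add: cut_grad_def)
  next
    case False
    hence s12: "1 < ?s" "?s < 2" using step_fun'_bounds(3)[of ?s] by auto
    have "\<epsilon> \<le> u x"
    proof (rule ccontr)
      assume "\<not> \<epsilon> \<le> u x"
      hence "(u x / \<epsilon>) powr \<gamma> \<le> 1" using elim e \<gamma>1 by (intro powr_le1) auto
      thus False using s12 s by simp
    qed
    hence r: "1 \<le> u x / \<epsilon>" using e by simp
    have "u x powr (\<gamma> - 1) / \<epsilon> powr \<gamma> = (u x / \<epsilon>) powr (\<gamma> - 1) / \<epsilon>"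
      using elim e by (simp add: powr_divide powr_diff)
    also have "\<dots> \<le> (u x / \<epsilon>) powr \<gamma> / \<epsilon>"
      using r e by (intro divide_right_mono powr_mono) auto
    also have "\<dots> \<le> 2 / \<epsilon>" using s12 s e by (intro divide_right_mono) auto
    finally have le: "u x powr (\<gamma> - 1) / \<epsilon> powr \<gamma> \<le> 2 / \<epsilon>" .
    have "norm (cut_grad \<epsilon> x) = step_fun' ?s * (\<gamma> * (u x powr (\<gamma> - 1) / \<epsilon> powr \<gamma>) * norm (gu x))"
      unfolding cut_grad_def elim(1) using step_fun'_bounds(1)[of ?s] \<gamma>1 by (simp add: abs_mult)
    also have "\<dots> \<le> 4 * (\<gamma> * (2 / \<epsilon>) * norm (gu x))"
      using le step_fun'_bounds(2)[of ?s] \<gamma>1 e by (intro mult_mono mult_left_mono) auto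
    finally show ?thesis using \<open>\<epsilon> \<le> u x\<close> by simp
  qed
qed

text \<open>Where \<open>u \<ge> \<epsilon>\<close> the factor
  \<open>\<gamma> * u powr (\<gamma> - 1)\<close> of the chain rule is bounded below, so
  \<open>G\<close> controls \<open>gu\<close>. The power \<open>q\<close> follows from the power
  \<open>p\<close> because \<open>\<Omega>\<close> has finite measure.\<close>

lemma gu_integrable:
  assumes e: "\<epsilon> > 0"
  shows "integrable L (\<lambda>x. if \<epsilon> \<le> u x then norm (gu x) powr p else 0)"
    "integrable L (\<lambda>x. if \<epsilon> \<le> u x then norm (gu x) powr q else 0)"
proof -
  show i: "integrable L (\<lambda>x. if \<epsilon> \<le> u x then norm (gu x) powr p else 0)"
  proof (rule Bochner_Integration.integrable_bound)
    show "integrable L (\<lambda>x. (1 / (\<gamma> * \<epsilon> powr (\<gamma> - 1))) powr p * norm (G x) powr p)" by (intro integrable_mult_right wp)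
    show "AE x in L. norm (if \<epsilon> \<le> u x then norm (gu x) powr p else 0) \<le> norm ((1 / (\<gamma> * \<epsilon> powr (\<gamma> - 1))) powr p * norm (G x) powr p)"
      using grad_power positive
    proof eventually_elim
      case (elim x)
      show ?case
      proof (cases "\<epsilon> \<le> u x")
        case True
        have "\<gamma> * \<epsilon> powr (\<gamma> - 1) * norm (gu x) \<le> \<gamma> * u x powr (\<gamma> - 1) * norm (gu x)"
          using True e \<gamma>1 by (intro mult_right_mono mult_left_mono powr_mono2) auto
        also have "\<dots> = norm (G x)" using elim \<gamma>1 by (simp add: abs_mult)
        finally have "norm (gu x) \<le> 1 / (\<gamma> * \<epsilon> powr (\<gamma> - 1)) * norm (G x)" using e \<gamma>1 by (simp add: field_simps)
        hence "norm (gu x) powr p \<le> (1 / (\<gamma> * \<epsilon> powr (\<gamma> - 1)) * norm (G x)) powr p" using p1 by (intro powr_mono2) auto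
        also have "\<dots> = (1 / (\<gamma> * \<epsilon> powr (\<gamma> - 1))) powr p * norm (G x) powr p" by (rule powr_mult)
        finally show ?thesis using True by simp
      qed simp
    qed
  qed measurable
  show "integrable L (\<lambda>x. if \<epsilon> \<le> u x then norm (gu x) powr q else 0)"
  proof (rule Bochner_Integration.integrable_bound[OF Bochner_Integration.integrable_add[OF integrable_const_L[of 1] i]])
    show "AE x in L. norm (if \<epsilon> \<le> u x then norm (gu x) powr q else 0) \<le> norm (1 + (if \<epsilon> \<le> u x then norm (gu x) powr p else 0))"
    proof (rule AE_I2)
      fix x show "norm (if \<epsilon> \<le> u x then norm (gu x) powr q else 0) \<le> norm (1 + (if \<epsilon> \<le> u x then norm (gu x) powr p else 0))"
        using powr_le_one_plus[of "norm (gu x)" q p] q1 qp by simp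
    qed
  qed measurable
qed

section \<open>Caccioppoli estimate for the super-solution\<close>

lemma admissible_exp:
  assumes M: "M > 0"
  shows "admissible (\<lambda>s t. exp (0 + - (t / M))) (\<lambda>s t. exp (0 + - (t / M)) * 0) (\<lambda>s t. exp (0 + - (t / M)) * (- (1 / M)))"
  unfolding admissible_def
proof (intro conjI allI impI)
  show "C1_quadrant (\<lambda>s t. exp (0 + - (t / M))) (\<lambda>s t. exp (0 + - (t / M)) * 0) (\<lambda>s t. exp (0 + - (t / M)) * (- (1 / M)))"
    by (rule C1_quadrant_sum[where a="\<lambda>_. 0" and a'="\<lambda>_. 0" and F=exp and F'=exp])
       (use M in \<open>auto intro!: derivative_eq_intros continuous_intros\<close>)
  have "\<forall>s>(0::real). \<forall>t>0. 0 \<le> exp (0 + - (t / M)) \<and> exp (0 + - (t / M)) \<le> 1" using M by simp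
  thus "\<exists>B. \<forall>s>(0::real). \<forall>t>0. 0 \<le> exp (0 + - (t / M)) \<and> exp (0 + - (t / M)) \<le> B" by blast
  fix c :: real assume c: "c > 0"
  have "\<forall>s\<ge>c. \<forall>t\<ge>c. \<bar>exp (0 + - (t / M)) * 0\<bar> \<le> 1 / M \<and> \<bar>exp (0 + - (t / M)) * (- (1 / M))\<bar> \<le> 1 / M"
    using M c by (auto simp: abs_mult divide_le_cancel)
  thus "\<exists>B. \<forall>s\<ge>c. \<forall>t\<ge>c. \<bar>exp (0 + - (t / M)) * 0\<bar> \<le> B \<and> \<bar>exp (0 + - (t / M)) * (- (1 / M))\<bar> \<le> B" by blast
qed

lemma cutoff_power:
  assumes "cutoff \<Omega> \<eta> D" "m \<ge> 2"
  shows "cutoff \<Omega> (\<lambda>x. \<eta> x ^ m) (\<lambda>x. (real m * \<eta> x ^ (m - 1)) *\<^sub>R D x)"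
  unfolding cutoff_def
proof (intro conjI allI)
  have c: "has_grad \<eta> D" "continuous_on UNIV D" "compact (tsupp \<eta>)" "tsupp \<eta> \<subseteq> \<Omega>" "\<And>x. 0 \<le> \<eta> x"
    using assms(1) unfolding cutoff_def by blast+
  show "has_grad (\<lambda>x. \<eta> x ^ m) (\<lambda>x. (real m * \<eta> x ^ (m - 1)) *\<^sub>R D x)"
    unfolding has_grad_def
  proof
    fix x
    show "((\<lambda>x. \<eta> x ^ m) has_derivative (\<bullet>) ((real m * \<eta> x ^ (m - 1)) *\<^sub>R D x)) (at x)"
      by (rule has_derivative_power[OF has_gradD[OF c(1)], THEN has_derivative_eq_rhs]) (simp add: fun_eq_iff)
  qed
  show "continuous_on UNIV (\<lambda>x. (real m * \<eta> x ^ (m - 1)) *\<^sub>R D x)"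
    by (intro continuous_intros c(2) has_grad_continuous[OF c(1)])
  have s: "tsupp (\<lambda>x. \<eta> x ^ m) \<subseteq> tsupp \<eta>" by (rule tsupp_subset) (use assms(2) in simp)
  thus "tsupp (\<lambda>x. \<eta> x ^ m) \<subseteq> \<Omega>" using c(4) by blast
  show "compact (tsupp (\<lambda>x. \<eta> x ^ m))"
    using compact_tsupp_subset[OF c(3) s] .
  show "0 \<le> \<eta> x ^ m" for x using c(5)[of x] by simp
qed

text \<open>Differentiating the weight yields \<open>- S x / M\<close>, the favourable term;
  differentiating \<open>\<eta> ^ m\<close> yields a cross term, bounded by
  \<open>S x / (2 * M)\<close> and powers of \<open>norm (D x)\<close>. Raising the cut-off to a
  power \<open>m\<close> with \<open>real m \<ge> p\<close> leaves enough factors of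
  \<open>\<eta>\<close> in the cross term for this absorption.\<close>

lemma caccioppoli_cutoff:
  assumes \<eta>: "cutoff \<Omega> \<eta> D" "\<And>x. \<eta> x \<le> 1" and Dp: "integrable L (\<lambda>x. norm (D x) powr p)" and M: "M > 0"
    and m: "real m \<ge> p" "m \<ge> 2"
  defines "S \<equiv> \<lambda>x. \<eta> x ^ m * exp (- (v x / M)) * (norm (gv x) powr p + norm (gv x) powr q)"
  shows "integrable L S"
    "(LINT x|L. S x) \<le> (LINT x|L. (2 * real m * M) powr p * norm (D x) powr p + (2 * real m * M) powr q * norm (D x) powr q)"
proof -
  let ?m = "real m"
  have c: "has_grad \<eta> D" "continuous_on UNIV D" "compact (tsupp \<eta>)" "tsupp \<eta> \<subseteq> \<Omega>" "\<And>x. 0 \<le> \<eta> x"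
    using \<eta>(1) unfolding cutoff_def by blast+
  note \<eta>c = has_grad_continuous[OF c(1)]
  have [measurable]: "\<eta> \<in> borel_measurable L" "D \<in> borel_measurable L"
    by (intro measurable_L borel_measurable_lebesgue_continuous \<eta>c c(2))+
  have Dq: "integrable L (\<lambda>x. norm (D x) powr q)"
  proof (rule Bochner_Integration.integrable_bound[OF Bochner_Integration.integrable_add[OF integrable_const_L[of 1] Dp]])
    show "AE x in L. norm (norm (D x) powr q) \<le> norm (1 + norm (D x) powr p)"
    proof (rule AE_I2)
      fix x show "norm (norm (D x) powr q) \<le> norm (1 + norm (D x) powr p)"
        using powr_le_one_plus[of "norm (D x)" q p] q1 qp by simp
    qed
  qed measurable
  have Sm[measurable]: "S \<in> borel_measurable L" unfolding S_def by measurable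
  \<comment> \<open>For a fixed cut-off, integrability follows from compact support. It is what
    makes the later step of moving the integral of \<open>S\<close> to the left-hand side
    meaningful.\<close>
  show Si: "integrable L S"
  proof (rule Bochner_Integration.integrable_bound)
    have "integrable lebesgue (\<lambda>x. (1 + norm (gv x) powr p + norm (gv x) powr p) * \<eta> x ^ m)"
      by (rule integrable_loc_int_mult[OF loc_int_add[OF loc_int_add[OF loc_int_const v(2)] v(2)] _ c(3,4)])
         (use m in \<open>auto intro!: continuous_intros \<eta>c tsupp_eq_0\<close>)
    thus "integrable L (\<lambda>x. (1 + norm (gv x) powr p + norm (gv x) powr p) * \<eta> x ^ m)"
      by (rule integrable_L)
    show "AE x in L. norm (S x) \<le> norm ((1 + norm (gv x) powr p + norm (gv x) powr p) * \<eta> x ^ m)"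
      using positive
    proof eventually_elim
      case (elim x)
      have "exp (- (v x / M)) \<le> 1" using elim M by simp
      hence "\<eta> x ^ m * exp (- (v x / M)) * (norm (gv x) powr p + norm (gv x) powr q)
         \<le> \<eta> x ^ m * 1 * (norm (gv x) powr p + (1 + norm (gv x) powr p))"
        using powr_le_one_plus[of "norm (gv x)" q p] q1 qp c(5)[of x] by (intro mult_mono add_mono) auto
      thus ?case using c(5)[of x] by (simp add: S_def algebra_simps)
    qed
  qed measurable
  define Q where "Q x = ?m * (2 * ?m * M) powr (p - 1) * norm (D x) powr p + ?m * (2 * ?m * M) powr (q - 1) * norm (D x) powr q" for x
  have Qi: "integrable L Q" unfolding Q_def by (intro Bochner_Integration.integrable_add integrable_mult_right Dp Dq)
  let ?K = "\<lambda>x. exp (0 + - (v x / M))"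
  let ?F = "\<lambda>x. flux p q (gv x) \<bullet> (?K x *\<^sub>R ((?m * \<eta> x ^ (m - 1)) *\<^sub>R D x) +
      (\<eta> x ^ m) *\<^sub>R ((?K x * 0) *\<^sub>R gu x + (?K x * (- (1 / M))) *\<^sub>R gv x))"
  have F0: "0 \<le> (LINT x|L. ?F x)"
    by (rule super_ineq[OF cutoff_power[OF \<eta>(1) m(2)] admissible_exp[OF M]])
  have pt: "AE x in L. \<bar>?F x + S x / M\<bar> \<le> S x / (2 * M) + Q x"
    using positive
  proof eventually_elim
    case (elim x)
    let ?a = "norm (gv x)" and ?d = "norm (D x)"
    have K1: "0 \<le> ?K x" "?K x \<le> 1" using elim M by auto
    have y: "?m * \<eta> x ^ (m - 1) * ?d * ?a powr (r - 1) \<le> \<eta> x ^ m * ?a powr r / (2 * M) + ?m * (2 * ?m * M) powr (r - 1) * ?d powr r"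
      if "r \<in> {p, q}" for r
      by (rule powr_cutoff_young) (use that c(5) \<eta>(2) m M p1 q1 qp in auto)
    have F: "?F x = ?K x * (?m * \<eta> x ^ (m - 1)) * (flux p q (gv x) \<bullet> D x) - S x / M"
      using flux_inner_self[OF p1 q1, of "gv x"] by (simp add: S_def inner_add_right algebra_simps)
    have "\<bar>?F x + S x / M\<bar> = ?K x * (?m * \<eta> x ^ (m - 1)) * \<bar>flux p q (gv x) \<bullet> D x\<bar>"
      unfolding F using c(5)[of x] by (simp add: abs_mult)
    also have "\<dots> \<le> ?K x * (?m * \<eta> x ^ (m - 1)) * ((?a powr (p - 1) + ?a powr (q - 1)) * ?d)"
      using Cauchy_Schwarz_ineq2[of "flux p q (gv x)" "D x"] c(5)[of x] by (intro mult_left_mono) (auto simp: norm_flux[OF p1 q1])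
    also have "\<dots> = ?K x * (?m * \<eta> x ^ (m - 1) * ?d * ?a powr (p - 1) + ?m * \<eta> x ^ (m - 1) * ?d * ?a powr (q - 1))"
      by (simp add: algebra_simps)
    also have "\<dots> \<le> ?K x * ((\<eta> x ^ m * ?a powr p / (2 * M) + ?m * (2 * ?m * M) powr (p - 1) * ?d powr p) +
        (\<eta> x ^ m * ?a powr q / (2 * M) + ?m * (2 * ?m * M) powr (q - 1) * ?d powr q))"
      using K1 y by (intro mult_left_mono add_mono) auto
    also have "\<dots> = S x / (2 * M) + ?K x * Q x"
      using M by (simp add: S_def Q_def field_simps)
    also have "?K x * Q x \<le> 1 * Q x"
      using K1 M by (intro mult_right_mono) (auto simp: Q_def)
    finally show ?case by simp
  qed
  have Fm: "?F \<in> borel_measurable L" by measurable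
  have Fi: "integrable L ?F"
  proof (rule Bochner_Integration.integrable_bound)
    show "integrable L (\<lambda>x. (S x / (2 * M) + Q x) + S x / M)" using Si Qi by simp
    show "AE x in L. norm (?F x) \<le> norm ((S x / (2 * M) + Q x) + S x / M)"
      using pt
    proof eventually_elim
      case (elim x)
      have "0 \<le> S x / M" using c(5)[of x] M by (simp add: S_def)
      thus ?case using elim unfolding real_norm_def by linarith
    qed
  qed (rule Fm)
  have "(LINT x|L. ?F x) \<le> (LINT x|L. Q x - S x / (2 * M))"
  proof (rule integral_mono_AE)
    show "integrable L ?F" by (rule Fi)
    show "integrable L (\<lambda>x. Q x - S x / (2 * M))" using Si Qi by simp
    show "AE x in L. ?F x \<le> Q x - S x / (2 * M)"
      using pt
    proof eventually_elim
      case (elim x)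
      have "?F x + S x / M \<le> S x / (2 * M) + Q x" using elim by (rule abs_le_D1)
      moreover have "S x / M = S x / (2 * M) + S x / (2 * M)" using M by (simp add: field_simps)
      ultimately show ?case by linarith
    qed
  qed
  hence "0 \<le> (LINT x|L. Q x) - (LINT x|L. S x) / (2 * M)" using F0 Si Qi by simp
  hence "(LINT x|L. S x) \<le> 2 * M * (LINT x|L. Q x)" using M by (simp add: field_simps)
  also have "\<dots> = (LINT x|L. 2 * M * Q x)" by simp
  \<comment> \<open>The factor \<open>2 * M\<close> from solving for the integral of
    \<open>S\<close> completes \<open>?m * (2 * ?m * M) powr (r - 1)\<close> to
    \<open>(2 * ?m * M) powr r\<close>.\<close>
  also have "(\<lambda>x. 2 * M * Q x) = (\<lambda>x. (2 * ?m * M) powr p * norm (D x) powr p + (2 * ?m * M) powr q * norm (D x) powr q)"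
  proof
    fix x
    have e: "2 * M * (?m * (2 * ?m * M) powr (r - 1)) = (2 * ?m * M) powr r" if "r > 1" for r
      using norm_powr_mult_norm[OF that, of "2 * ?m * M"] M by (simp add: mult_ac)
    show "2 * M * Q x = (2 * ?m * M) powr p * norm (D x) powr p + (2 * ?m * M) powr q * norm (D x) powr q"
      unfolding Q_def e[OF p1, symmetric] e[OF q1, symmetric] by (simp add: algebra_simps)
  qed
  finally show "(LINT x|L. S x) \<le> (LINT x|L. (2 * ?m * M) powr p * norm (D x) powr p + (2 * ?m * M) powr q * norm (D x) powr q)" .
qed

text \<open>Limit of the estimate for cut-offs, by dominated convergence on the right and by Fatou's
  lemma on the left. \<open>\<Lambda>\<close> joins the factor of \<open>caccioppoli_cutoff\<close>
  with that of \<open>cut_grad_bound\<close>, so it depends on \<open>M\<close> and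
  \<open>\<epsilon>\<close> only through \<open>M / \<epsilon>\<close>.\<close>

lemma caccioppoli:
  assumes e: "\<epsilon> > 0" and M: "M > 0" and m: "real m \<ge> p" "m \<ge> 2"
  defines "\<Lambda> \<equiv> 2 * real m * M * (8 * \<gamma> / \<epsilon>)"
  shows "integrable L (\<lambda>x. if 2 * \<epsilon> \<le> u x then exp (- (v x / M)) * (norm (gv x) powr p + norm (gv x) powr q) else 0)" (is "integrable L ?S")
    "(LINT x|L. (if 2 * \<epsilon> \<le> u x then exp (- (v x / M)) * (norm (gv x) powr p + norm (gv x) powr q) else 0)) \<le>
     (LINT x|L. (if \<epsilon> \<le> u x then \<Lambda> powr p * norm (gu x) powr p + \<Lambda> powr q * norm (gu x) powr q else 0))"
proof -
  obtain \<eta> D \<Gamma> where "cutoff_seq \<epsilon> \<eta> D \<Gamma>" using cutoff_sequence[OF e] by blast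
  note c = cutoff_seqD[OF this]
  let ?A = "2 * real m * M"
  have A: "?A > 0" using M m by simp
  note [measurable] = c(6-8)
  have Dp: "integrable L (\<lambda>x. norm (D k x) powr p)" for k
  proof (rule Bochner_Integration.integrable_bound[OF c(3)])
    show "AE x in L. norm (norm (D k x) powr p) \<le> norm (\<Gamma> x)"
      using c(4)
    proof eventually_elim
      case (elim x)
      hence "norm (D k x) powr p \<le> \<Gamma> x" by blast
      thus ?case by simp
    qed
  qed measurable
  let ?Sk = "\<lambda>k x. \<eta> k x ^ m * exp (- (v x / M)) * (norm (gv x) powr p + norm (gv x) powr q)"
  let ?S' = "\<lambda>x. cut_lim \<epsilon> x ^ m * exp (- (v x / M)) * (norm (gv x) powr p + norm (gv x) powr q)"
  let ?R = "\<lambda>D. ?A powr p * norm D powr p + ?A powr q * norm D powr q"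
  note cac = caccioppoli_cutoff[OF c(1,2) Dp M m]
  have r: "(\<lambda>k. LINT x|L. ?R (D k x)) \<longlonglongrightarrow> (LINT x|L. ?R (cut_grad \<epsilon> x))"
  proof (rule integral_dominated_convergence[where w="\<lambda>x. ?A powr p * \<Gamma> x + ?A powr q * (1 + \<Gamma> x)"])
    show "integrable L (\<lambda>x. ?A powr p * \<Gamma> x + ?A powr q * (1 + \<Gamma> x))"
      by (intro Bochner_Integration.integrable_add integrable_mult_right integrable_const_L c(3))
    show "AE x in L. (\<lambda>k. ?R (D k x)) \<longlonglongrightarrow> ?R (cut_grad \<epsilon> x)"
      using c(4)
    proof eventually_elim
      case (elim x)
      hence "(\<lambda>k. norm (D k x)) \<longlonglongrightarrow> norm (cut_grad \<epsilon> x)" by (intro tendsto_norm) blast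
      thus ?case using p1 q1 by (intro tendsto_add tendsto_mult tendsto_const tendsto_powr') auto
    qed
    show "AE x in L. norm (?R (D k x)) \<le> ?A powr p * \<Gamma> x + ?A powr q * (1 + \<Gamma> x)" for k
      using c(4)
    proof eventually_elim
      case (elim x)
      hence d: "norm (D k x) powr p \<le> \<Gamma> x" by blast
      have "?R (D k x) \<le> ?A powr p * \<Gamma> x + ?A powr q * (1 + \<Gamma> x)"
        using d powr_le_one_plus[of "norm (D k x)" q p] q1 qp by (intro add_mono mult_left_mono) auto
      thus ?case by simp
    qed
  qed measurable
  have fat: "integrable L ?S'" "(LINT x|L. ?S' x) \<le> (LINT x|L. ?R (cut_grad \<epsilon> x))"
  proof -
    have lim: "AE x in L. (\<lambda>k. ?Sk k x) \<longlonglongrightarrow> ?S' x"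
      using c(4) by eventually_elim (intro tendsto_intros, blast)
    have nn: "AE x in L. 0 \<le> ?Sk k x" for k
      using c(5)[of k] by (intro AE_I2) simp
    have S'm: "?S' \<in> borel_measurable L" by measurable
    show "integrable L ?S'" "(LINT x|L. ?S' x) \<le> (LINT x|L. ?R (cut_grad \<epsilon> x))"
      by (rule integral_Fatou_bound[OF cac(1) nn S'm lim cac(2) r])+
  qed
  have le: "?S x \<le> ?S' x" "0 \<le> ?S x" for x
    using cut_eq_1(1)[OF e, of x] cut_lim_bounds(1)[of \<epsilon> x] by auto
  show Si: "integrable L ?S"
  proof (rule Bochner_Integration.integrable_bound[OF fat(1)])
    show "AE x in L. norm (?S x) \<le> norm (?S' x)"
    proof (rule AE_I2)
      fix x show "norm (?S x) \<le> norm (?S' x)" unfolding real_norm_def using le[of x] by linarith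
    qed
  qed measurable
  have "(LINT x|L. ?S x) \<le> (LINT x|L. ?S' x)" by (rule integral_mono[OF Si fat(1)]) (rule le(1))
  also note fat(2)
  also have "(LINT x|L. ?R (cut_grad \<epsilon> x)) \<le> (LINT x|L. (if \<epsilon> \<le> u x then \<Lambda> powr p * norm (gu x) powr p + \<Lambda> powr q * norm (gu x) powr q else 0))"
  proof -
    let ?Z = "\<lambda>x. if \<epsilon> \<le> u x then \<Lambda> powr p * norm (gu x) powr p + \<Lambda> powr q * norm (gu x) powr q else 0"
    have "integrable L (\<lambda>x. \<Lambda> powr p * (if \<epsilon> \<le> u x then norm (gu x) powr p else 0) + \<Lambda> powr q * (if \<epsilon> \<le> u x then norm (gu x) powr q else 0))"
      by (intro Bochner_Integration.integrable_add integrable_mult_right gu_integrable[OF e])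
    also have "(\<lambda>x. \<Lambda> powr p * (if \<epsilon> \<le> u x then norm (gu x) powr p else 0) + \<Lambda> powr q * (if \<epsilon> \<le> u x then norm (gu x) powr q else 0)) = ?Z"
      by (auto simp: fun_eq_iff)
    finally have Zi: "integrable L ?Z" .
    have pt: "AE x in L. 0 \<le> ?R (cut_grad \<epsilon> x) \<and> ?R (cut_grad \<epsilon> x) \<le> ?Z x"
      using cut_grad_bound[OF e]
    proof eventually_elim
      case (elim x)
      have b: "?A powr r * norm (cut_grad \<epsilon> x) powr r \<le> (if \<epsilon> \<le> u x then \<Lambda> powr r * norm (gu x) powr r else 0)" if "r > 1" for r
      proof (cases "\<epsilon> \<le> u x")
        case True
        hence "?A * norm (cut_grad \<epsilon> x) \<le> ?A * (8 * \<gamma> / \<epsilon> * norm (gu x))"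
          using elim A by (intro mult_left_mono) auto
        also have "\<dots> = \<Lambda> * norm (gu x)" by (simp add: \<Lambda>_def)
        finally have "(?A * norm (cut_grad \<epsilon> x)) powr r \<le> (\<Lambda> * norm (gu x)) powr r"
          using that A by (intro powr_mono2) auto
        thus ?thesis using True by (simp add: powr_mult)
      next
        case False
        thus ?thesis using elim by simp
      qed
      show ?case using b[OF p1] b[OF q1] by (cases "\<epsilon> \<le> u x") auto
    qed
    have "integrable L (\<lambda>x. ?R (cut_grad \<epsilon> x))"
    proof (rule Bochner_Integration.integrable_bound[OF Zi])
      show "AE x in L. norm (?R (cut_grad \<epsilon> x)) \<le> norm (?Z x)"
        using pt by eventually_elim (simp only: real_norm_def, linarith)
    qed measurable
    thus ?thesis by (rule integral_mono_AE[OF _ Zi]) (use pt in \<open>auto elim!: eventually_mono\<close>)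
  qed
  finally show "(LINT x|L. ?S x) \<le> (LINT x|L. (if \<epsilon> \<le> u x then \<Lambda> powr p * norm (gu x) powr p + \<Lambda> powr q * norm (gu x) powr q else 0))" .
qed

end

lemma sat_fun_measurable[measurable]: "sat_fun \<in> borel_measurable borel" "sat_fun' \<in> borel_measurable borel"
  "trunc M \<in> borel_measurable borel" "trunc' M \<in> borel_measurable borel"
proof -
  have [measurable]: "pos_sq \<in> borel_measurable borel" by (rule borel_measurable_continuous_onI[OF continuous_on_pos_sq])
  show "sat_fun \<in> borel_measurable borel" "sat_fun' \<in> borel_measurable borel"
    "trunc M \<in> borel_measurable borel" "trunc' M \<in> borel_measurable borel"
    unfolding sat_fun_def sat_fun'_def trunc_def trunc'_def by measurable
qed

text \<open>Stated for a general \<open>a\<close> with slopes between 0 and 1, because it is used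
  for \<open>trunc M\<close> and for the identity.\<close>

lemma admissible_sat:
  assumes a: "\<And>s. s > 0 \<Longrightarrow> (a has_real_derivative a' s) (at s)" "continuous_on {0<..} a'"
    and [measurable]: "a \<in> borel_measurable borel" "a' \<in> borel_measurable borel"
    and a': "\<And>s. s > 0 \<Longrightarrow> 0 \<le> a' s \<and> a' s \<le> 1"
  shows "admissible (\<lambda>s t. sat_fun (a s + (- t - c))) (\<lambda>s t. sat_fun' (a s + (- t - c)) * a' s) (\<lambda>s t. sat_fun' (a s + (- t - c)) * (-1))"
  unfolding admissible_def
proof (intro conjI allI impI)
  show "C1_quadrant (\<lambda>s t. sat_fun (a s + (- t - c))) (\<lambda>s t. sat_fun' (a s + (- t - c)) * a' s) (\<lambda>s t. sat_fun' (a s + (- t - c)) * (-1))"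
    by (rule C1_quadrant_sum[OF a _ _ _ _ _ _ sat_fun_deriv continuous_on_sat_fun'])
       (auto intro!: derivative_eq_intros)
  show "\<exists>B. \<forall>s>0. \<forall>t>0. 0 \<le> sat_fun (a s + (- t - c)) \<and> sat_fun (a s + (- t - c)) \<le> B"
    using sat_fun_bounds(1,2) by blast
  fix d :: real assume d: "d > 0"
  have "\<bar>sat_fun' (a s + (- t - c)) * a' s\<bar> \<le> 1" "\<bar>sat_fun' (a s + (- t - c)) * (-1)\<bar> \<le> 1" if "s \<ge> d" for s t
  proof -
    have "sat_fun' (a s + (- t - c)) * a' s \<le> 1 * 1"
      using a'[of s] d that sat_fun'_bounds(1,2) by (intro mult_mono) auto
    thus "\<bar>sat_fun' (a s + (- t - c)) * a' s\<bar> \<le> 1" "\<bar>sat_fun' (a s + (- t - c)) * (-1)\<bar> \<le> 1"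
      using a'[of s] d that sat_fun'_bounds(1,2)[of "a s + (- t - c)"] by auto
  qed
  thus "\<exists>B. \<forall>s\<ge>d. \<forall>t\<ge>d. \<bar>sat_fun' (a s + (- t - c)) * a' s\<bar> \<le> B \<and> \<bar>sat_fun' (a s + (- t - c)) * (-1)\<bar> \<le> B"
    by blast
qed

section \<open>The comparison inequality with truncated \<open>u\<close>\<close>

context sub_super_pair
begin

definition caccioppoli_exponent :: nat where "caccioppoli_exponent = nat \<lceil>p\<rceil> + 2"

lemma caccioppoli_exponent: "real caccioppoli_exponent \<ge> p" "caccioppoli_exponent \<ge> 2"
  using p1 by (simp_all add: caccioppoli_exponent_def) linarith

text \<open>Removes the weight of the Caccioppoli estimate at the price of \<open>exp 2\<close>. The
  bound \<open>2 * M\<close> on \<open>v\<close> is the ceiling of \<open>trunc M\<close>.\<close>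

lemma exp_weight: "M > 0 \<Longrightarrow> v x \<le> 2 * M \<Longrightarrow> 1 \<le> exp 2 * exp (- (v x / M))"
  by (simp add: exp_add[symmetric] pos_divide_le_eq)

text \<open>Majorant for the passage to the limit along the cut-offs. The factor 3 counts the uses
  of Young's inequality: against the gradients of the cut-off, of \<open>u\<close> and of
  \<open>v\<close>.\<close>

lemma zone_integrable:
  assumes e: "\<epsilon> > 0" and M: "M > 0"
  shows "integrable L (\<lambda>x. if 2 * \<epsilon> \<le> u x \<and> v x \<le> 2 * M then
     3 * norm (flux p q (gu x) - flux p q (gv x)) powr (p / (p - 1)) + norm (gu x) powr p + norm (gv x) powr p else 0)"
proof -
  let ?r = "p / (p - 1)"
  let ?Y = "\<lambda>x. norm (flux p q (gu x) - flux p q (gv x)) powr ?r"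
  define C where "C = (2 * 2 * 3) powr ?r"
  have C: "C \<ge> 0" by (simp add: C_def)
  have e2: "2 * \<epsilon> > 0" using e by simp
  let ?c = "\<lambda>x. if 2 * \<epsilon> \<le> u x then exp (- (v x / M)) * (norm (gv x) powr p + norm (gv x) powr q) else 0"
  let ?g = "\<lambda>x. if 2 * \<epsilon> \<le> u x then norm (gu x) powr p else 0"
  show ?thesis
  proof (rule Bochner_Integration.integrable_bound)
    show "integrable L (\<lambda>x. 3 * (C * (2 + ?g x + exp 2 * ?c x)) + ?g x + exp 2 * ?c x)"
      by (intro Bochner_Integration.integrable_add integrable_mult_right integrable_const_L gu_integrable[OF e2] caccioppoli[OF e M caccioppoli_exponent])
    show "AE x in L. norm (if 2 * \<epsilon> \<le> u x \<and> v x \<le> 2 * M then 3 * ?Y x + norm (gu x) powr p + norm (gv x) powr p else 0) \<le>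
       norm (3 * (C * (2 + ?g x + exp 2 * ?c x)) + ?g x + exp 2 * ?c x)"
    proof (rule AE_I2)
      fix x
      show "norm (if 2 * \<epsilon> \<le> u x \<and> v x \<le> 2 * M then 3 * ?Y x + norm (gu x) powr p + norm (gv x) powr p else 0) \<le>
       norm (3 * (C * (2 + ?g x + exp 2 * ?c x)) + ?g x + exp 2 * ?c x)"
      proof (cases "2 * \<epsilon> \<le> u x \<and> v x \<le> 2 * M")
        case True
        have "1 * norm (gv x) powr p \<le> (exp 2 * exp (- (v x / M))) * (norm (gv x) powr p + norm (gv x) powr q)"
          using exp_weight[OF M, of x] True by (intro mult_mono) auto
        hence v': "norm (gv x) powr p \<le> exp 2 * ?c x" using True by simp
        have u': "norm (gu x) powr p = ?g x" using True by simp
        have "?Y x \<le> C * (2 + norm (gu x) powr p + norm (gv x) powr p)"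
          unfolding C_def by (rule norm_flux_diff_powr_le[OF q1 qp])
        also have "\<dots> \<le> C * (2 + ?g x + exp 2 * ?c x)" using u' v' C by (intro mult_left_mono) linarith+
        finally have "3 * ?Y x + norm (gu x) powr p + norm (gv x) powr p \<le> 3 * (C * (2 + ?g x + exp 2 * ?c x)) + ?g x + exp 2 * ?c x"
          using u' v' by linarith
        thus ?thesis using True by simp
      next
        case False
        show ?thesis unfolding if_not_P[OF False] by simp
      qed
    qed
  qed measurable
qed

text \<open>Limit of \<open>comparison_ineq\<close> along the cut-offs. A positive argument of
  \<open>sat_fun\<close> forces \<open>u > 2 * \<epsilon>\<close> and \<open>v < 2 * M\<close>. On
  this set the limit cut-off is 1 with zero gradient, and \<open>zone_integrable\<close> together
  with \<open>\<Gamma>\<close> supplies the majorant.\<close>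

lemma truncated_ineq:
  assumes e: "\<epsilon> > 0" and M: "M > 0"
  defines "s \<equiv> \<lambda>x. sat_fun' (trunc M (u x) + (- v x - 2 * \<epsilon>))"
  defines "F \<equiv> \<lambda>x. (flux p q (gu x) - flux p q (gv x)) \<bullet> ((s x * trunc' M (u x)) *\<^sub>R gu x + (s x * (-1)) *\<^sub>R gv x)"
  shows "integrable L F" "(LINT x|L. F x) \<le> 0"
proof -
  let ?A = "\<lambda>x. flux p q (gu x) - flux p q (gv x)"
  let ?Y = "\<lambda>x. norm (?A x) powr (p / (p - 1))"
  let ?arg = "\<lambda>x. trunc M (u x) + (- v x - 2 * \<epsilon>)"
  let ?T = "\<lambda>x. sat_fun (?arg x)"
  obtain \<eta> D \<Gamma> where "cutoff_seq \<epsilon> \<eta> D \<Gamma>" using cutoff_sequence[OF e] by blast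
  note c = cutoff_seqD[OF this]
  note [measurable] = c(6-8)
  have adm: "admissible (\<lambda>s t. sat_fun (trunc M s + (- t - 2 * \<epsilon>))) (\<lambda>s t. sat_fun' (trunc M s + (- t - 2 * \<epsilon>)) * trunc' M s)
     (\<lambda>s t. sat_fun' (trunc M s + (- t - 2 * \<epsilon>)) * (-1))"
    by (rule admissible_sat) (use M trunc_deriv continuous_on_trunc trunc_bounds in auto)
  let ?F = "\<lambda>k x. ?A x \<bullet> (?T x *\<^sub>R D k x + \<eta> k x *\<^sub>R ((s x * trunc' M (u x)) *\<^sub>R gu x + (s x * (-1)) *\<^sub>R gv x))"
  have le: "(LINT x|L. ?F k x) \<le> 0" for k
    unfolding s_def
  proof (rule comparison_ineq[OF c(1) adm])
    fix s t :: real assume st: "0 < s" "0 < t" "s \<le> t"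
    show "sat_fun (trunc M s + (- t - 2 * \<epsilon>)) = 0"
      by (rule sat_fun_bounds(3)) (use trunc_bounds(1)[OF M st(1)] st e in linarith)
  qed
  define W where "W x = (if 2 * \<epsilon> \<le> u x \<and> v x \<le> 2 * M then 3 * ?Y x + norm (gu x) powr p + norm (gv x) powr p else 0) + \<Gamma> x" for x
  have Wi: "integrable L W" unfolding W_def by (intro Bochner_Integration.integrable_add zone_integrable[OF e M] c(3))
  have zone: "2 * \<epsilon> \<le> u x \<and> v x \<le> 2 * M" if "0 < u x" "0 < v x" "0 < ?arg x" for x
    using that trunc_bounds(1,2)[OF M that(1)] e by linarith
  have [measurable]: "s \<in> borel_measurable L" unfolding s_def by measurable
  have Fm: "?F k \<in> borel_measurable L" "F \<in> borel_measurable L" for k unfolding F_def by measurable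
  have lim: "AE x in L. (\<lambda>k. ?F k x) \<longlonglongrightarrow> F x"
    using c(4) positive
  proof eventually_elim
    case (elim x)
    hence l: "(\<lambda>k. ?F k x) \<longlonglongrightarrow> ?A x \<bullet> (?T x *\<^sub>R cut_grad \<epsilon> x + cut_lim \<epsilon> x *\<^sub>R ((s x * trunc' M (u x)) *\<^sub>R gu x + (s x * (-1)) *\<^sub>R gv x))"
      by (intro tendsto_inner tendsto_add tendsto_scaleR tendsto_const) auto
    show ?case
    proof (cases "0 < ?arg x")
      case True
      hence "2 * \<epsilon> \<le> u x" using zone elim by blast
      thus ?thesis using l cut_eq_1[OF e, of x] by (simp add: F_def)
    next
      case False
      hence "?T x = 0" "s x = 0" unfolding s_def by (auto intro: sat_fun_bounds(3) sat_fun'_bounds(3))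
      thus ?thesis by (simp add: F_def)
    qed
  qed
  have dom: "AE x in L. norm (?F k x) \<le> W x" for k
    using c(4) positive
  proof eventually_elim
    case (elim x)
    have \<Gamma>: "norm (D k x) powr p \<le> \<Gamma> x" using elim by blast
    have \<eta>01: "0 \<le> \<eta> k x" "\<eta> k x \<le> 1" by (rule c)+
    show ?case
    proof (cases "0 < ?arg x")
      case True
      hence Z: "2 * \<epsilon> \<le> u x \<and> v x \<le> 2 * M" using zone elim by blast
      have s01: "0 \<le> s x" "s x \<le> 1" by (simp_all add: s_def sat_fun'_bounds)
      have t01: "0 \<le> trunc' M (u x)" "trunc' M (u x) \<le> 1" using trunc_bounds[OF M, of "u x"] elim by auto
      have "norm (?T x *\<^sub>R D k x + \<eta> k x *\<^sub>R ((s x * trunc' M (u x)) *\<^sub>R gu x + (s x * (-1)) *\<^sub>R gv x))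
         \<le> 1 * norm (D k x) + 1 * (1 * norm (gu x) + 1 * norm (gv x))"
      proof (intro norm_triangle_le add_mono)
        show "norm (?T x *\<^sub>R D k x) \<le> 1 * norm (D k x)"
          using sat_fun_bounds(1,2)[of "?arg x"] by (simp add: mult_left_le_one_le)
        have "norm ((s x * trunc' M (u x)) *\<^sub>R gu x + (s x * (-1)) *\<^sub>R gv x) \<le> 1 * norm (gu x) + 1 * norm (gv x)"
        proof (intro norm_triangle_le add_mono)
          have "s x * trunc' M (u x) \<le> 1 * 1" using s01 t01 by (intro mult_mono) auto
          thus "norm ((s x * trunc' M (u x)) *\<^sub>R gu x) \<le> 1 * norm (gu x)"
            unfolding norm_scaleR using s01 t01 by (intro mult_right_mono) auto
          show "norm ((s x * (-1)) *\<^sub>R gv x) \<le> 1 * norm (gv x)"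
            unfolding norm_scaleR using s01 by (intro mult_right_mono) auto
        qed
        thus "norm (\<eta> k x *\<^sub>R ((s x * trunc' M (u x)) *\<^sub>R gu x + (s x * (-1)) *\<^sub>R gv x)) \<le> 1 * (1 * norm (gu x) + 1 * norm (gv x))"
          unfolding norm_scaleR using \<eta>01 by (intro mult_mono) auto
      qed
      hence n: "norm (?T x *\<^sub>R D k x + \<eta> k x *\<^sub>R ((s x * trunc' M (u x)) *\<^sub>R gu x + (s x * (-1)) *\<^sub>R gv x))
         \<le> norm (D k x) + norm (gu x) + norm (gv x)" by simp
      have "norm (?F k x) \<le> norm (?A x) * (norm (D k x) + norm (gu x) + norm (gv x))"
        using Cauchy_Schwarz_ineq2 mult_left_mono[OF n norm_ge_zero[of "?A x"]] order_trans unfolding real_norm_def by blast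
      also have "\<dots> = norm (?A x) * norm (D k x) + norm (?A x) * norm (gu x) + norm (?A x) * norm (gv x)" by (simp add: distrib_left)
      also have "\<dots> \<le> (?Y x + norm (D k x) powr p) + (?Y x + norm (gu x) powr p) + (?Y x + norm (gv x) powr p)"
        by (intro add_mono young_conj p1 norm_ge_zero)
      also have "\<dots> \<le> W x" using \<Gamma> Z by (simp add: W_def)
      finally show ?thesis .
    next
      case False
      hence "?T x = 0" "s x = 0" unfolding s_def by (auto intro: sat_fun_bounds(3) sat_fun'_bounds(3))
      moreover have "0 \<le> \<Gamma> x" by (rule order_trans[OF powr_ge_zero \<Gamma>])
      hence "0 \<le> W x" by (simp add: W_def)
      ultimately show ?thesis by simp
    qed
  qed
  show "integrable L F" by (rule integrable_dominated_convergence[OF Fm(2,1) Wi lim dom])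
  have "(\<lambda>k. LINT x|L. ?F k x) \<longlonglongrightarrow> (LINT x|L. F x)" by (rule integral_dominated_convergence[OF Fm(2,1) Wi lim dom])
  thus "(LINT x|L. F x) \<le> 0" by (rule LIMSEQ_le_const2) (use le in auto)
qed

section \<open>Letting the truncation height tend to infinity\<close>

definition tail :: "real \<Rightarrow> real" where
  "tail \<epsilon> = (LINT x|L. (if \<epsilon> \<le> u x then norm (gu x) powr p + norm (gu x) powr q else 0))"

lemma tail_integrable:
  assumes "\<epsilon> > 0"
  shows "integrable L (\<lambda>x. if \<epsilon> \<le> u x then norm (gu x) powr p + norm (gu x) powr q else 0)"
proof -
  have "(\<lambda>x. if \<epsilon> \<le> u x then norm (gu x) powr p + norm (gu x) powr q else 0) =
    (\<lambda>x. (if \<epsilon> \<le> u x then norm (gu x) powr p else 0) + (if \<epsilon> \<le> u x then norm (gu x) powr q else 0))"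
    by (simp add: fun_eq_iff)
  thus ?thesis using gu_integrable[OF assms] by simp
qed

lemma tail_tendsto_0: "(\<lambda>n. tail (real (Suc n))) \<longlonglongrightarrow> 0"
proof -
  have "(\<lambda>n. tail (real (Suc n))) \<longlonglongrightarrow> (LINT x|L. (0::real))"
    unfolding tail_def
  proof (rule integral_dominated_convergence[where w="\<lambda>x. if 1 \<le> u x then norm (gu x) powr p + norm (gu x) powr q else 0"])
    show "AE x in L. (\<lambda>n. if real (Suc n) \<le> u x then norm (gu x) powr p + norm (gu x) powr q else 0) \<longlonglongrightarrow> 0"
    proof (rule AE_I2, rule tendsto_eventually)
      fix x
      obtain N where "u x < real N" using reals_Archimedean2 by blast
      thus "\<forall>\<^sub>F n in sequentially. (if real (Suc n) \<le> u x then norm (gu x) powr p + norm (gu x) powr q else 0) = 0"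
        by (intro eventually_sequentiallyI[of N]) auto
    qed
    show "integrable L (\<lambda>x. if 1 \<le> u x then norm (gu x) powr p + norm (gu x) powr q else 0)" by (rule tail_integrable) simp
    show "AE x in L. norm (if real (Suc n) \<le> u x then norm (gu x) powr p + norm (gu x) powr q else 0)
        \<le> (if 1 \<le> u x then norm (gu x) powr p + norm (gu x) powr q else 0)" for n
    proof (rule AE_I2)
      fix x
      have "real (Suc n) \<le> u x \<Longrightarrow> 1 \<le> u x" by simp
      thus "norm (if real (Suc n) \<le> u x then norm (gu x) powr p + norm (gu x) powr q else 0)
        \<le> (if 1 \<le> u x then norm (gu x) powr p + norm (gu x) powr q else 0)" by (cases "real (Suc n) \<le> u x") simp_all
    qed
    show "(\<lambda>x. if real (Suc n) \<le> u x then norm (gu x) powr p + norm (gu x) powr q else 0) \<in> borel_measurable L" for n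
      by measurable
  qed simp
  thus ?thesis by simp
qed

text \<open>Bounds the one term of the truncation error with an unfavourable sign. In the constant,
  1 accounts for \<open>gu\<close> after Young's inequality, and the rest for \<open>gv\<close>
  through the Caccioppoli estimate with its weight removed.\<close>

lemma remainder_bound:
  assumes M: "M > 0"
  defines "R \<equiv> \<lambda>x. if M \<le> u x \<and> v x \<le> 2 * M then norm (flux p q (gu x)) * norm (gv x) else 0"
  defines "\<Lambda> \<equiv> 32 * real caccioppoli_exponent * \<gamma>"
  shows "integrable L R" "(LINT x|L. R x) \<le> (1 + exp 2 * (\<Lambda> powr p + \<Lambda> powr q)) * tail (M / 2)"
proof -
  let ?t = "\<lambda>\<epsilon> x. if \<epsilon> \<le> u x then norm (gu x) powr p + norm (gu x) powr q else 0"
  let ?c = "\<lambda>x. if 2 * (M / 2) \<le> u x then exp (- (v x / M)) * (norm (gv x) powr p + norm (gv x) powr q) else 0"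
  have M2: "M / 2 > 0" using M by simp
  note cac = caccioppoli[OF M2 M caccioppoli_exponent]
  note ti = tail_integrable[OF M2]
  have pt: "0 \<le> R x \<and> R x \<le> ?t (M / 2) x + exp 2 * ?c x" for x
  proof (cases "M \<le> u x \<and> v x \<le> 2 * M")
    case True
    have "norm (flux p q (gu x)) * norm (gv x) = norm (gu x) powr (p - 1) * norm (gv x) + norm (gu x) powr (q - 1) * norm (gv x)"
      by (simp add: norm_flux[OF p1 q1] distrib_right)
    also have "\<dots> \<le> (norm (gu x) powr p + norm (gv x) powr p) + (norm (gu x) powr q + norm (gv x) powr q)"
      by (intro add_mono powr_mult_le_sum norm_ge_zero p1 q1)
    also have "\<dots> = ?t (M / 2) x + 1 * (norm (gv x) powr p + norm (gv x) powr q)" using True M by simp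
    also have "\<dots> \<le> ?t (M / 2) x + (exp 2 * exp (- (v x / M))) * (norm (gv x) powr p + norm (gv x) powr q)"
      using exp_weight[OF M, of x] True by (intro add_left_mono mult_right_mono) auto
    also have "\<dots> = ?t (M / 2) x + exp 2 * ?c x" using True by simp
    finally show ?thesis using True by (simp add: R_def)
  next
    case False
    hence "R x = 0" unfolding R_def by (rule if_not_P)
    thus ?thesis by simp
  qed
  have bi: "integrable L (\<lambda>x. ?t (M / 2) x + exp 2 * ?c x)"
    by (intro Bochner_Integration.integrable_add integrable_mult_right ti cac(1))
  have Rm: "R \<in> borel_measurable L" unfolding R_def by measurable
  show Ri: "integrable L R"
  proof (rule Bochner_Integration.integrable_bound[OF bi Rm], rule AE_I2)
    fix x show "norm (R x) \<le> norm (?t (M / 2) x + exp 2 * ?c x)"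
      using pt[of x] unfolding real_norm_def by linarith
  qed
  \<comment> \<open>with \<open>\<epsilon> = M / 2\<close> the constant of the Caccioppoli estimate is independent of \<open>M\<close>\<close>
  have l: "2 * real caccioppoli_exponent * M * (8 * \<gamma> / (M / 2)) = \<Lambda>" using M by (simp add: \<Lambda>_def)
  have "(LINT x|L. R x) \<le> (LINT x|L. ?t (M / 2) x + exp 2 * ?c x)"
    by (rule integral_mono[OF Ri bi]) (use pt in blast)
  also have "\<dots> = tail (M / 2) + exp 2 * (LINT x|L. ?c x)"
    unfolding tail_def using ti cac(1) by (subst Bochner_Integration.integral_add) auto
  also have "(LINT x|L. ?c x) \<le> (LINT x|L. (\<Lambda> powr p + \<Lambda> powr q) * ?t (M / 2) x)"
  proof (rule order_trans[OF cac(2)[unfolded l]], rule integral_mono)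
    let ?z = "\<lambda>x. if M / 2 \<le> u x then \<Lambda> powr p * norm (gu x) powr p + \<Lambda> powr q * norm (gu x) powr q else 0"
    have "?z = (\<lambda>x. \<Lambda> powr p * (if M / 2 \<le> u x then norm (gu x) powr p else 0) + \<Lambda> powr q * (if M / 2 \<le> u x then norm (gu x) powr q else 0))"
      by (simp add: fun_eq_iff)
    thus "integrable L ?z" using gu_integrable[OF M2] by simp
    show "integrable L (\<lambda>x. (\<Lambda> powr p + \<Lambda> powr q) * ?t (M / 2) x)" by (rule integrable_mult_right[OF ti])
    show "?z x \<le> (\<Lambda> powr p + \<Lambda> powr q) * ?t (M / 2) x" for x
      by (simp add: distrib_left distrib_right add_increasing add_increasing2)
  qed
  also have "(LINT x|L. (\<Lambda> powr p + \<Lambda> powr q) * ?t (M / 2) x) = (\<Lambda> powr p + \<Lambda> powr q) * tail (M / 2)"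
    by (simp add: tail_def)
  finally show "(LINT x|L. R x) \<le> (1 + exp 2 * (\<Lambda> powr p + \<Lambda> powr q)) * tail (M / 2)"
    by (simp add: algebra_simps)
qed

text \<open>\<open>P\<close> is restricted to \<open>u \<le> N\<close> so that for every
  \<open>M \<ge> N\<close> the same function is estimated, while the bound on its integral tends to
  0 as \<open>M\<close> grows. Being nonnegative with integral 0, \<open>P\<close> vanishes almost
  everywhere, and strict monotonicity of the flux does the rest.\<close>

lemma gradients_agree_truncated:
  assumes e: "\<epsilon> > 0" and N: "N > 0"
  shows "AE x in L. u x \<le> N \<and> 2 * \<epsilon> < u x - v x \<longrightarrow> gu x = gv x"
proof -
  let ?A = "\<lambda>x. flux p q (gu x) - flux p q (gv x)"
  define P where "P x = (if u x \<le> N then sat_fun' (u x + (- v x - 2 * \<epsilon>)) * (?A x \<bullet> (gu x - gv x)) else 0)" for x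
  have P0: "0 \<le> P x" for x
    unfolding P_def using flux_monotone(1)[OF p1 q1, of "gu x" "gv x"] sat_fun'_bounds(1) by simp
  have Pm[measurable]: "P \<in> borel_measurable L" unfolding P_def by measurable
  define \<Lambda> where "\<Lambda> = 32 * real caccioppoli_exponent * \<gamma>"
  have step: "integrable L P \<and> (LINT x|L. P x) \<le> (1 + exp 2 * (\<Lambda> powr p + \<Lambda> powr q)) * tail (M / 2)" if MN: "M \<ge> N" for M
  proof -
    have M: "M > 0" using MN N by simp
    let ?s = "\<lambda>x. sat_fun' (trunc M (u x) + (- v x - 2 * \<epsilon>))"
    let ?F = "\<lambda>x. ?A x \<bullet> ((?s x * trunc' M (u x)) *\<^sub>R gu x + (?s x * (-1)) *\<^sub>R gv x)"
    let ?R = "\<lambda>x. if M \<le> u x \<and> v x \<le> 2 * M then norm (flux p q (gu x)) * norm (gv x) else 0"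
    note F = truncated_ineq[OF e M]
    note R = remainder_bound[OF M]
    have le: "AE x in L. P x \<le> ?F x + ?R x"
      using positive
    proof eventually_elim
      case (elim x)
      have R0: "0 \<le> ?R x" by simp
      \<comment> \<open>With \<open>t = trunc' M (u x)\<close>, the vector \<open>t gu - gv\<close>
        is split as \<open>t (gu - gv) - (1 - t) gv\<close>. The first part pairs monotonically with
        the flux difference; the second is the truncation error and vanishes for
        \<open>u \<le> M\<close>.\<close>
      have Feq: "?F x = ?s x * (trunc' M (u x) * (?A x \<bullet> (gu x - gv x)) - (1 - trunc' M (u x)) * (?A x \<bullet> gv x))"
        by (simp add: inner_add_right inner_diff_right algebra_simps)
      show ?case
      proof (cases "u x \<le> M")
        case True
        hence "trunc M (u x) = u x" "trunc' M (u x) = 1" using trunc_bounds[OF M, of "u x"] elim by auto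
        hence "?F x = sat_fun' (u x + (- v x - 2 * \<epsilon>)) * (?A x \<bullet> (gu x - gv x))" unfolding Feq by simp
        moreover have "P x \<le> sat_fun' (u x + (- v x - 2 * \<epsilon>)) * (?A x \<bullet> (gu x - gv x))"
          unfolding P_def using flux_monotone(1)[OF p1 q1, of "gu x" "gv x"] sat_fun'_bounds(1) by simp
        ultimately show ?thesis using R0 by linarith
      next
        case False
        hence P: "P x = 0" using MN by (simp add: P_def)
        have t: "0 \<le> trunc' M (u x)" "trunc' M (u x) \<le> 1" using trunc_bounds[OF M, of "u x"] elim by auto
        show ?thesis
        proof (cases "?s x = 0")
          case True
          thus ?thesis using P R0 by simp
        next
          case s: False
          hence "0 < trunc M (u x) + (- v x - 2 * \<epsilon>)" using sat_fun'_bounds(3) not_le by blast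
          hence "v x \<le> 2 * M" using trunc_bounds(2)[OF M, of "u x"] elim e by linarith
          hence Rx: "?R x = norm (flux p q (gu x)) * norm (gv x)" using False by simp
          \<comment> \<open>This product enters with a favourable sign, so only the mixed product of
            \<open>flux p q (gu x)\<close> and \<open>gv x\<close> has to be bounded.\<close>
          have "flux p q (gv x) \<bullet> gv x \<ge> 0" by (simp add: flux_inner_self[OF p1 q1])
          hence "?A x \<bullet> gv x \<le> ?R x"
            using norm_cauchy_schwarz[of "flux p q (gu x)" "gv x"] unfolding Rx inner_diff_left by linarith
          hence "?s x * (1 - trunc' M (u x)) * (?A x \<bullet> gv x) \<le> ?s x * (1 - trunc' M (u x)) * ?R x"
            using t sat_fun'_bounds(1) by (intro mult_left_mono) auto
          also have "\<dots> \<le> 1 * ?R x"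
          proof (rule mult_right_mono[OF _ R0])
            have "?s x * (1 - trunc' M (u x)) \<le> 1 * 1" using t sat_fun'_bounds(1,2) by (intro mult_mono) auto
            thus "?s x * (1 - trunc' M (u x)) \<le> 1" by simp
          qed
          finally have "?s x * (1 - trunc' M (u x)) * (?A x \<bullet> gv x) \<le> ?R x" by simp
          moreover have "0 \<le> ?s x * (trunc' M (u x) * (?A x \<bullet> (gu x - gv x)))"
            using t sat_fun'_bounds(1) flux_monotone(1)[OF p1 q1, of "gu x" "gv x"] by simp
          ultimately show ?thesis unfolding P Feq by (simp add: algebra_simps)
        qed
      qed
    qed
    have FRi: "integrable L (\<lambda>x. ?F x + ?R x)" by (rule Bochner_Integration.integrable_add[OF F(1) R(1)])
    have Pi: "integrable L P"
    proof (rule Bochner_Integration.integrable_bound[OF FRi Pm])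
      show "AE x in L. norm (P x) \<le> norm (?F x + ?R x)"
        using le
      proof eventually_elim
        case (elim x)
        thus ?case using P0[of x] unfolding real_norm_def by linarith
      qed
    qed
    have "(LINT x|L. P x) \<le> (LINT x|L. ?F x + ?R x)" by (rule integral_mono_AE[OF Pi FRi le])
    also have "\<dots> = (LINT x|L. ?F x) + (LINT x|L. ?R x)" by (rule Bochner_Integration.integral_add[OF F(1) R(1)])
    finally show ?thesis using Pi F(2) R(2) unfolding \<Lambda>_def by linarith
  qed
  have Pi: "integrable L P" using step[of N] by simp
  have "(LINT x|L. P x) \<le> 0"
  proof (rule LIMSEQ_le_const)
    show "(\<lambda>n. (1 + exp 2 * (\<Lambda> powr p + \<Lambda> powr q)) * tail (real (Suc n))) \<longlonglongrightarrow> 0"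
      using tendsto_mult_right_zero[OF tail_tendsto_0] by blast
    obtain n0 where n0: "real n0 \<ge> N" using real_arch_simple by blast
    \<comment> \<open>Heights \<open>M = 2 * real (Suc n)\<close> turn \<open>tail (M / 2)\<close>
      into the sequence of \<open>tail_tendsto_0\<close>.\<close>
    have "(LINT x|L. P x) \<le> (1 + exp 2 * (\<Lambda> powr p + \<Lambda> powr q)) * tail (real (Suc n))" if "n \<ge> n0" for n
    proof -
      have "real n0 \<le> real n" using that by simp
      hence "2 * real (Suc n) \<ge> N" using n0 by simp
      moreover have "2 * real (Suc n) / 2 = real (Suc n)" by simp
      ultimately show ?thesis using step[of "2 * real (Suc n)"] by metis
    qed
    thus "\<exists>K. \<forall>n\<ge>K. (LINT x|L. P x) \<le> (1 + exp 2 * (\<Lambda> powr p + \<Lambda> powr q)) * tail (real (Suc n))" by blast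
  qed
  moreover have "0 \<le> (LINT x|L. P x)" by (rule integral_nonneg_AE) (simp add: P0)
  ultimately have "(LINT x|L. P x) = 0" by simp
  hence "AE x in L. P x = 0" using integral_nonneg_eq_0_iff_AE[OF Pi] P0 by simp
  thus ?thesis
  proof eventually_elim
    case (elim x)
    show ?case
    proof
      assume a: "u x \<le> N \<and> 2 * \<epsilon> < u x - v x"
      hence "sat_fun' (u x + (- v x - 2 * \<epsilon>)) > 0" by (intro sat_fun'_bounds(4)) simp
      hence "?A x \<bullet> (gu x - gv x) = 0" using elim a by (simp add: P_def)
      thus "gu x = gv x" by (rule flux_monotone(2)[OF p1 q1])
    qed
  qed
qed

section \<open>From equal gradients to \<open>u \<le> v\<close>\<close>

lemma gradients_agree:
  assumes e: "\<epsilon> > 0"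
  shows "AE x in L. 2 * \<epsilon> < u x - v x \<longrightarrow> gu x = gv x"
proof -
  have "AE x in L. \<forall>n. u x \<le> real (Suc n) \<and> 2 * \<epsilon> < u x - v x \<longrightarrow> gu x = gv x"
    by (subst AE_all_countable) (intro allI gradients_agree_truncated[OF e], simp)
  thus ?thesis
  proof eventually_elim
    case (elim x)
    obtain n where "u x \<le> real n" using real_arch_simple by blast
    hence "u x \<le> real (Suc n)" by simp
    thus ?case using elim by blast
  qed
qed

text \<open>Where \<open>sat_fun'\<close> is nonzero the two gradients cancel, so the gradient of
  the tested product is \<open>sat_fun\<close> times the gradient of the cut-off. Its limit is zero,
  because the limit cut-off is flat where \<open>u \<ge> 2 * \<epsilon>\<close>; the coordinate
  factor is bounded together with \<open>\<Omega>\<close>.\<close>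

lemma difference_bound:
  assumes e: "\<epsilon> > 0"
  shows "AE x in L. u x - v x \<le> 2 * \<epsilon>"
proof -
  \<comment> \<open>A single coordinate direction is enough, and one exists because types are
    nonempty.\<close>
  fix i :: 'n
  obtain \<eta> D \<Gamma> where "cutoff_seq \<epsilon> \<eta> D \<Gamma>" using cutoff_sequence[OF e] by blast
  note c = cutoff_seqD[OF this]
  have xm: "(\<lambda>x. x $ i) \<in> borel_measurable L"
    by (intro measurable_L borel_measurable_lebesgue_continuous continuous_intros)
  have Dm: "(\<lambda>x. D k x $ i) \<in> borel_measurable L" for k by (rule borel_measurable_vec_nth_comp[OF c(7)])
  note [measurable] = c(6-8) xm Dm borel_measurable_vec_nth_comp[OF L_measurable(1)] borel_measurable_vec_nth_comp[OF L_measurable(2)]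
  let ?arg = "\<lambda>x. u x + (- v x - 2 * \<epsilon>)"
  let ?T = "\<lambda>x. sat_fun (?arg x)"
  have adm: "admissible (\<lambda>s t. sat_fun (s + (- t - 2 * \<epsilon>))) (\<lambda>s t. sat_fun' (s + (- t - 2 * \<epsilon>)) * 1)
     (\<lambda>s t. sat_fun' (s + (- t - 2 * \<epsilon>)) * (-1))"
    by (rule admissible_sat) (auto intro!: derivative_eq_intros)
  let ?V = "\<lambda>k x. ?T x *\<^sub>R D k x + \<eta> k x *\<^sub>R ((sat_fun' (?arg x) * 1) *\<^sub>R gu x + (sat_fun' (?arg x) * (-1)) *\<^sub>R gv x)"
  have ineq: "(LINT x|L. \<eta> k x * ?T x) \<le> - (LINT x|L. x $ i * (?V k x) $ i)" for k
    by (rule divergence_ineq[OF c(1) adm])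
  have eq: "(LINT x|L. x $ i * (?V k x) $ i) = (LINT x|L. x $ i * (?T x * D k x $ i))" for k
  proof (rule integral_cong_AE)
    show "AE x in L. x $ i * (?V k x) $ i = x $ i * (?T x * D k x $ i)"
      using gradients_agree[OF e]
    proof eventually_elim
      case (elim x)
      show ?case
      proof (cases "0 < ?arg x")
        case True
        hence "gu x = gv x" using elim by simp
        thus ?thesis by simp
      next
        case False
        hence "sat_fun' (?arg x) = 0" by (intro sat_fun'_bounds(3)) simp
        thus ?thesis by simp
      qed
    qed
    show "(\<lambda>x. x $ i * (?V k x) $ i) \<in> borel_measurable L"
      by (intro borel_measurable_times xm borel_measurable_vec_nth_comp) measurable
    show "(\<lambda>x. x $ i * (?T x * D k x $ i)) \<in> borel_measurable L"
      by (intro borel_measurable_times xm Dm) measurable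
  qed
  obtain B where B: "\<And>x. x \<in> \<Omega> \<Longrightarrow> norm x \<le> B" using bounded_\<Omega> bounded_iff by blast
  have zone: "2 * \<epsilon> \<le> u x" if "0 < v x" "0 < ?arg x" for x using that by linarith
  have l1: "(\<lambda>k. LINT x|L. \<eta> k x * ?T x) \<longlonglongrightarrow> (LINT x|L. ?T x)"
  proof (rule integral_dominated_convergence[OF _ _ integrable_const_L[of 1]])
    show "AE x in L. (\<lambda>k. \<eta> k x * ?T x) \<longlonglongrightarrow> ?T x"
      using c(4) positive
    proof eventually_elim
      case (elim x)
      hence l: "(\<lambda>k. \<eta> k x * ?T x) \<longlonglongrightarrow> cut_lim \<epsilon> x * ?T x" by (intro tendsto_mult tendsto_const) blast
      show ?case
      proof (cases "0 < ?arg x")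
        case True thus ?thesis using l cut_eq_1(1)[OF e zone] elim by simp
      next
        case False thus ?thesis using sat_fun_bounds(3)[of "?arg x"] by simp
      qed
    qed
    show "AE x in L. norm (\<eta> k x * ?T x) \<le> 1" for k
    proof (rule AE_I2)
      fix x
      have "0 \<le> \<eta> k x" "\<eta> k x \<le> 1" by (rule c)+
      hence "\<bar>\<eta> k x\<bar> * \<bar>?T x\<bar> \<le> 1 * 1" using sat_fun_bounds(1,2)[of "?arg x"] by (intro mult_mono) auto
      thus "norm (\<eta> k x * ?T x) \<le> 1" by (simp add: abs_mult)
    qed
  qed measurable
  have l2: "(\<lambda>k. - (LINT x|L. x $ i * (?T x * D k x $ i))) \<longlonglongrightarrow> - (LINT x|L. (0::real))"
  proof (rule tendsto_minus, rule integral_dominated_convergence[where w="\<lambda>x. B * (1 + \<Gamma> x)"])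
    show "AE x in L. (\<lambda>k. x $ i * (?T x * D k x $ i)) \<longlonglongrightarrow> 0"
      using c(4) positive
    proof eventually_elim
      case (elim x)
      hence l: "(\<lambda>k. x $ i * (?T x * D k x $ i)) \<longlonglongrightarrow> x $ i * (?T x * cut_grad \<epsilon> x $ i)"
        by (intro tendsto_mult tendsto_const tendsto_vec_nth) blast
      show ?case
      proof (cases "0 < ?arg x")
        case True thus ?thesis using l cut_eq_1(2)[OF e zone] elim by simp
      next
        case False thus ?thesis using sat_fun_bounds(3)[of "?arg x"] by simp
      qed
    qed
    show "AE x in L. norm (x $ i * (?T x * D k x $ i)) \<le> B * (1 + \<Gamma> x)" for k
      using c(4) AE_space
    proof eventually_elim
      case (elim x)
      have xB: "\<bar>x $ i\<bar> \<le> B" using B[of x] component_le_norm_cart[of x i] elim by simp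
      have "\<bar>D k x $ i\<bar> \<le> 1 + norm (D k x) powr p"
        using component_le_norm_cart[of "D k x" i] le_one_plus_powr[of "norm (D k x)" p] p1 by simp
      also have "\<dots> \<le> 1 + \<Gamma> x" using elim by simp
      finally have "\<bar>?T x\<bar> * \<bar>D k x $ i\<bar> \<le> 1 * (1 + \<Gamma> x)"
        using sat_fun_bounds(1,2)[of "?arg x"] by (intro mult_mono) auto
      hence "\<bar>x $ i\<bar> * (\<bar>?T x\<bar> * \<bar>D k x $ i\<bar>) \<le> B * (1 + \<Gamma> x)" using xB by (intro mult_mono) auto
      thus ?case by (simp add: abs_mult)
    qed
    show "integrable L (\<lambda>x. B * (1 + \<Gamma> x))" using c(3) integrable_const_L[of 1] by simp
  qed measurable
  have Ti: "integrable L ?T"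
    by (rule Bochner_Integration.integrable_bound[OF integrable_const_L[of 1]]) (auto simp: sat_fun_bounds)
  have "(LINT x|L. ?T x) \<le> - (LINT x|L. (0::real))"
    by (rule LIMSEQ_le[OF l1 l2]) (use ineq eq in auto)
  moreover have "0 \<le> (LINT x|L. ?T x)" by (rule integral_nonneg_AE) (simp add: sat_fun_bounds)
  ultimately have "(LINT x|L. ?T x) = 0" by simp
  hence "AE x in L. ?T x = 0" using integral_nonneg_eq_0_iff_AE[OF Ti] by (simp add: sat_fun_bounds)
  thus ?thesis
  proof eventually_elim
    case (elim x)
    thus ?case using sat_fun_bounds(4)[of "?arg x"] by (cases "0 < ?arg x") auto
  qed
qed

theorem comparison: "AE x in L. u x \<le> v x"
proof -
  have "AE x in L. \<forall>n. u x - v x \<le> 2 * inverse (real (Suc n))"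
    by (subst AE_all_countable) (intro allI difference_bound, simp)
  thus ?thesis
  proof eventually_elim
    case (elim x)
    have "(\<lambda>n. 2 * inverse (real (Suc n))) \<longlonglongrightarrow> 2 * 0"
      by (intro tendsto_mult tendsto_const LIMSEQ_inverse_real_of_nat)
    hence "u x - v x \<le> 2 * 0" by (rule LIMSEQ_le_const) (use elim in blast)
    thus ?case by simp
  qed
qed

end

section \<open>From the weak formulation to the locale\<close>

lemma loc_int_rhs:
  assumes f: "Linf_loc \<Omega> f" and u: "u \<in> borel_measurable lebesgue" "loc_bdd_below \<Omega> u" and d: "\<delta> > 0"
  shows "loc_int \<Omega> (\<lambda>x. f x * u x powr (- \<delta>))"
proof (rule loc_int_bound_local[OF loc_int_const[of \<Omega> 1]])
  have [measurable]: "f \<in> borel_measurable lebesgue" using f by (simp add: Linf_loc_def)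
  show "(\<lambda>x. f x * u x powr (- \<delta>)) \<in> borel_measurable lebesgue" using u(1) by measurable
  fix K assume K: "compact K" "K \<subseteq> \<Omega>"
  obtain B where B: "AE x in lebesgue. x \<in> K \<longrightarrow> \<bar>f x\<bar> \<le> B" using f K unfolding Linf_loc_def by blast
  obtain c where c: "c > 0" "AE x in lebesgue. x \<in> K \<longrightarrow> c \<le> u x" using u(2) K unfolding loc_bdd_below_def by blast
  have "AE x in lebesgue. x \<in> K \<longrightarrow> \<bar>f x * u x powr (- \<delta>)\<bar> \<le> (B * c powr (- \<delta>)) * 1"
    using B c(2)
  proof eventually_elim
    case (elim x)
    show ?case
    proof
      assume x: "x \<in> K"
      have "u x powr (- \<delta>) \<le> c powr (- \<delta>)" using elim x c(1) d by (intro powr_mono2') auto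
      hence "\<bar>f x\<bar> * u x powr (- \<delta>) \<le> B * c powr (- \<delta>)" using elim x by (intro mult_mono) auto
      thus "\<bar>f x * u x powr (- \<delta>)\<bar> \<le> (B * c powr (- \<delta>)) * 1" by (simp add: abs_mult)
    qed
  qed
  thus "\<exists>C. AE x in lebesgue. x \<in> K \<longrightarrow> \<bar>f x * u x powr (- \<delta>)\<bar> \<le> C * 1" by blast
qed

text \<open>The two integrals of the weak formulation can be merged because each integrand is
  integrable on its own; a non-integrable one would have integral 0 by convention, and additivity
  could fail.\<close>

lemma flux_set_integral:
  fixes g :: "real^'n \<Rightarrow> real^'n"
  assumes t: "test_fun \<Omega> \<phi>" and g: "g \<in> borel_measurable lebesgue" "loc_int \<Omega> (\<lambda>x. norm (g x) powr p)" and pq: "1 < q" "q < p"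
  shows "(LINT x:\<Omega>|lebesgue. norm (g x) powr (p - 2) * (g x \<bullet> grad \<phi> x)) + (LINT x:\<Omega>|lebesgue. norm (g x) powr (q - 2) * (g x \<bullet> grad \<phi> x))
    = (LINT x:\<Omega>|lebesgue. flux p q (g x) \<bullet> grad \<phi> x)"
proof -
  note [measurable] = g(1)
  have i: "integrable lebesgue (\<lambda>x. norm (g x) powr (r - 2) * (g x \<bullet> grad \<phi> x))" if r: "1 < r" "r \<le> p" for r
  proof -
    have "loc_int \<Omega> (\<lambda>x. norm (norm (g x) powr (r - 2) *\<^sub>R g x))"
    proof (rule loc_int_bound[OF loc_int_add[OF loc_int_const[of \<Omega> 1] g(2)]])
      show "AE x in lebesgue. x \<in> K \<longrightarrow> \<bar>norm (norm (g x) powr (r - 2) *\<^sub>R g x)\<bar> \<le> 1 + norm (g x) powr p" for K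
        using powr_le_one_plus[of "norm (g _)" "r - 1" p] r by (intro AE_I2) (simp add: powr_minus2_mult_norm)
    qed measurable
    from test_fun_integrable(2)[OF t _ this] show ?thesis by simp
  qed
  have 0: "x \<notin> \<Omega> \<Longrightarrow> norm (g x) powr (r - 2) * (g x \<bullet> grad \<phi> x) = 0" for x r
    using test_fun_integrable(4)[OF t] by simp
  have 1: "x \<notin> \<Omega> \<Longrightarrow> flux p q (g x) \<bullet> grad \<phi> x = 0" for x
    using test_fun_integrable(4)[OF t] by simp
  have 2: "(LINT x:\<Omega>|lebesgue. norm (g x) powr (r - 2) * (g x \<bullet> grad \<phi> x)) = (LINT x|lebesgue. norm (g x) powr (r - 2) * (g x \<bullet> grad \<phi> x))" for r
    by (rule LINT_set_support[OF 0])
  have 3: "(LINT x:\<Omega>|lebesgue. flux p q (g x) \<bullet> grad \<phi> x) = (LINT x|lebesgue. flux p q (g x) \<bullet> grad \<phi> x)"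
    by (rule LINT_set_support[OF 1])
  show ?thesis
    unfolding 2 3 unfolding flux_def inner_scaleR_left distrib_right
    by (rule Bochner_Integration.integral_add[symmetric]) (use i[of p] i[of q] pq in auto)
qed

lemma W1p_locD:
  assumes "W1p_loc \<Omega> p u g"
  shows "weak_grad \<Omega> u g" "loc_int \<Omega> (\<lambda>x. norm (g x) powr p)"
proof -
  have [measurable]: "g \<in> borel_measurable lebesgue" using assms by (simp add: W1p_loc_def Lp_loc_vec_def)
  have "(\<lambda>x. norm (g x) powr p) \<in> borel_measurable lebesgue" by measurable
  thus "weak_grad \<Omega> u g" "loc_int \<Omega> (\<lambda>x. norm (g x) powr p)"
    using assms by (simp_all add: W1p_loc_def Lp_loc_vec_def loc_int_def set_integrable_def)
qed

theorem theorem1p5: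
  fixes \<Omega> :: "(real^'n) set" and p q \<delta> \<beta> c1 c2 \<rho> :: real
    and f u v :: "real^'n \<Rightarrow> real"
  assumes dom: "bounded_C2_domain \<Omega>"
    and pq: "1 < q" "q < p"
    and delta: "0 < \<delta>"
    and f_loc: "Linf_loc \<Omega> f"
    and f_nonneg: "AE x in lebesgue. x \<in> \<Omega> \<longrightarrow> 0 \<le> f x"
    and cs: "0 \<le> c1" "0 \<le> c2" "0 < \<rho>"
    and beta: "0 \<le> \<beta>" "\<beta> < 2 - 1 / p"
    and f_bounds: "AE x in lebesgue. x \<in> \<Omega> \<and> infdist x (frontier \<Omega>) < \<rho> \<longrightarrow>
         c1 * infdist x (frontier \<Omega>) powr (- \<beta>) \<le> f x \<and>
         f x \<le> c2 * infdist x (frontier \<Omega>) powr (- \<beta>)"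
    and sub: "weak_subsol \<Omega> p q \<delta> f u"
    and super: "weak_supersol \<Omega> p q \<delta> f v"
  shows "AE x in lebesgue. x \<in> \<Omega> \<longrightarrow> u x \<le> v x"
  proof -
  have \<Omega>: "open \<Omega>" "bounded \<Omega>" using dom by (auto simp: bounded_C2_domain_def)
  obtain gu \<gamma> where u: "W1p_loc \<Omega> p u gu" "loc_bdd_below \<Omega> u" "1 \<le> \<gamma>" "W01p \<Omega> p (\<lambda>x. u x powr \<gamma>)"
    and usub: "\<And>\<phi>. test_fun \<Omega> \<phi> \<and> (\<forall>x. 0 \<le> \<phi> x) \<Longrightarrow>
        (LINT x:\<Omega>|lebesgue. norm (gu x) powr (p - 2) * (gu x \<bullet> grad \<phi> x))
        + (LINT x:\<Omega>|lebesgue. norm (gu x) powr (q - 2) * (gu x \<bullet> grad \<phi> x))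
        \<le> (LINT x:\<Omega>|lebesgue. f x * u x powr (- \<delta>) * \<phi> x)"
    using sub unfolding weak_subsol_def loc_bdd_below_def by blast
  obtain gv where v: "W1p_loc \<Omega> p v gv" "loc_bdd_below \<Omega> v"
    and vsup: "\<And>\<phi>. test_fun \<Omega> \<phi> \<and> (\<forall>x. 0 \<le> \<phi> x) \<Longrightarrow>
        (LINT x:\<Omega>|lebesgue. norm (gv x) powr (p - 2) * (gv x \<bullet> grad \<phi> x))
        + (LINT x:\<Omega>|lebesgue. norm (gv x) powr (q - 2) * (gv x \<bullet> grad \<phi> x))
        \<ge> (LINT x:\<Omega>|lebesgue. f x * v x powr (- \<delta>) * \<phi> x)"
    using super unfolding weak_supersol_def loc_bdd_below_def by blast
  obtain G \<psi> where w: "W1p \<Omega> p (\<lambda>x. u x powr \<gamma>) G" "\<And>k. test_fun \<Omega> (\<psi> k)"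
    "(\<lambda>k. LINT x:\<Omega>|lebesgue. \<bar>\<psi> k x - u x powr \<gamma>\<bar> powr p) \<longlonglongrightarrow> 0"
    "(\<lambda>k. LINT x:\<Omega>|lebesgue. norm (grad (\<psi> k) x - G x) powr p) \<longlonglongrightarrow> 0"
    using u(4) unfolding W01p_def by blast
  note uw = W1p_locD[OF u(1)] and vw = W1p_locD[OF v(1)]
  note um = loc_intD(2)[OF weak_grad_loc_int(1)[OF uw(1)]] and vm = loc_intD(2)[OF weak_grad_loc_int(1)[OF vw(1)]]
  interpret sub_super_pair \<Omega> p q \<gamma> u v gu gv G "\<lambda>x. f x * u x powr (- \<delta>)" "\<lambda>x. f x * v x powr (- \<delta>)" \<psi>
  proof
    show "open \<Omega>" "bounded \<Omega>" "1 < q" "q < p" "1 \<le> \<gamma>" by fact+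
    show "weak_grad \<Omega> u gu" "loc_int \<Omega> (\<lambda>x. norm (gu x) powr p)" "loc_bdd_below \<Omega> u"
      "weak_grad \<Omega> v gv" "loc_int \<Omega> (\<lambda>x. norm (gv x) powr p)" "loc_bdd_below \<Omega> v" by fact+
    show "loc_int \<Omega> (\<lambda>x. f x * u x powr (- \<delta>))" "loc_int \<Omega> (\<lambda>x. f x * v x powr (- \<delta>))"
      by (intro loc_int_rhs f_loc um vm u(2) v(2) delta)+
    \<comment> \<open>Where \<open>0 < v x\<close> and \<open>v x < u x\<close>, the negative power
      reverses the order, and \<open>f x \<ge> 0\<close> preserves the resulting inequality.\<close>
    have "AE x in lebesgue. x \<in> \<Omega> \<longrightarrow> 0 \<le> f x * v x powr (- \<delta>) \<and> (v x < u x \<longrightarrow> f x * u x powr (- \<delta>) \<le> f x * v x powr (- \<delta>))"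
      using f_nonneg loc_bdd_below_pos[OF \<Omega>(1) v(2)]
    proof eventually_elim
      case (elim x)
      thus ?case using delta by (auto intro!: mult_left_mono powr_mono2')
    qed
    thus "AE x in lebesgue_on \<Omega>. 0 \<le> f x * v x powr (- \<delta>) \<and> (v x < u x \<longrightarrow> f x * u x powr (- \<delta>) \<le> f x * v x powr (- \<delta>))"
      using \<Omega>(1) by (subst AE_restrict_space_iff) auto
    show "(LINT x:\<Omega>|lebesgue. flux p q (gu x) \<bullet> grad \<phi> x) \<le> (LINT x:\<Omega>|lebesgue. f x * u x powr (- \<delta>) * \<phi> x)"
      if "test_fun \<Omega> \<phi>" "\<And>x. 0 \<le> \<phi> x" for \<phi>
      using usub[of \<phi>] that flux_set_integral[OF that(1) weak_grad_loc_int(3)[OF uw(1)] uw(2) pq] by simp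
    show "(LINT x:\<Omega>|lebesgue. f x * v x powr (- \<delta>) * \<phi> x) \<le> (LINT x:\<Omega>|lebesgue. flux p q (gv x) \<bullet> grad \<phi> x)"
      if "test_fun \<Omega> \<phi>" "\<And>x. 0 \<le> \<phi> x" for \<phi>
      using vsup[of \<phi>] that flux_set_integral[OF that(1) weak_grad_loc_int(3)[OF vw(1)] vw(2) pq] by simp
    show "weak_grad \<Omega> (\<lambda>x. u x powr \<gamma>) G" using w(1) by (simp add: W1p_def)
    show "integrable (lebesgue_on \<Omega>) (\<lambda>x. \<bar>u x powr \<gamma>\<bar> powr p)" "integrable (lebesgue_on \<Omega>) (\<lambda>x. norm (G x) powr p)"
      using w(1) \<Omega>(1) by (simp_all add: W1p_def set_integrable_def integrable_restrict_space)
    show "test_fun \<Omega> (\<psi> k)" for k by fact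
    have "\<Omega> \<in> sets lebesgue" using \<Omega>(1) by simp
    from w(3,4)[unfolded LINT_lebesgue_on[OF this]]
    show "(\<lambda>k. LINT x|lebesgue_on \<Omega>. \<bar>\<psi> k x - u x powr \<gamma>\<bar> powr p) \<longlonglongrightarrow> 0"
      "(\<lambda>k. LINT x|lebesgue_on \<Omega>. norm (grad (\<psi> k) x - G x) powr p) \<longlonglongrightarrow> 0" .
  qed
  show ?thesis using comparison by (simp only: AE_L)
qed

end
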